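(* Let $G$ be a Lie group with Lie algebra $\mathfrak g$, let $l:\mathfrak g\to\mathbb R$ be a reduced Lagrangian for which the matrix $\bigl(\frac{\partial^2l}{\partial\xi^a\partial\xi^b}\bigr)$ is positive-definite, let $a^1,\dots,a^m\in\mathfrak g^*$ be linearly independent, and let $\mathfrak g^D=\{\xi\in\mathfrak g:\langle a^\alpha,\xi\rangle=0,\ \alpha=1,\dots,m\}$. Then any $\mathfrak g^D$-preserving discretization of the Euler-Poincaré-Suslov equations $$\frac{d}{dt}\Bigl(\frac{\partial l}{\partial\xi}\Bigr)=\mathrm{ad}^*_\xi\Bigl(\frac{\partial l}{\partial\xi}\Bigr)+\lambda_\alpha a^\alpha,\qquad\langle a^\alpha,\xi\rangle=0,$$ the consistency order of which is $p$ with respect to the dynamical part, can be embedded into the time evolution of a non-autonomous perturbation of the form $$\frac{\partial^2l}{\partial\xi^b\partial\xi^c}\dot\xi^c=C^d_{be}\,\xi^e\frac{\partial l}{\partial\xi^d}+\lambda_\alpha a^\alpha_b+\epsilon^p\,\tilde d_b(\epsilon,t/\epsilon,\xi),\qquad\langle a^\alpha,\xi\rangle=0,$$ where $C^d_{be}$ denote the structure constants of $\mathfrak g$ with respect to the chosen coordinates.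
   Context: Einstein's summation convention is used; $\xi^a$ are linear coordinates on $\mathfrak g$ with respect to a basis $(e_a)$, $a^\alpha_b$ are the components of $a^\alpha$, $\lambda_\alpha$ are Lagrange multipliers, and $\epsilon>0$ is the fixed step size of the discretization. The structure constants are indexed so that $(\mathrm{ad}^*_\xi\mu)_b=C^d_{be}\xi^e\mu_d$, where $\langle\mathrm{ad}^*_\xi\mu,\eta\rangle=\langle\mu,[\xi,\eta]\rangle$; that is, $[e_e,e_b]=C^d_{be}e_d$. Since the Hessian of $l$ is positive-definite, the multipliers can be eliminated by differentiating the constraints, and the Euler-Poincaré-Suslov equations become an autonomous ODE $\dot\xi=h(\xi)$ on the linear space $\mathfrak g^D$, where $h$ is assumed to be of class $C^r$, $r\ge1$. Let $F(t,\xi)$, $F(0,\xi)=\xi$, be its solution flow. A $\mathfrak g^D$-preserving discretization is one producing sequences $\{\xi_k\}$ with $\xi_k\in\mathfrak g^D$ for every $k$; it is a one-step scheme $\xi_{k+1}=\phi(\epsilon,\xi_k)$, $0<\epsilon\le\epsilon_0$. It has consistency order $p$ (an integer $p\ge1$) with respect to the dynamical part if $|\phi(\epsilon,\xi)-F(\epsilon,\xi)|\le C(|\xi|)\,\epsilon^{p+1}$ for a continuous function $C:[0,\infty)\to[0,\infty)$. "Can be embedded into the time evolution" of the perturbed equations means: there is a function $\tilde d(\epsilon,t/\epsilon,\xi)$ with values in $\mathfrak g^*$, periodic in $t$ of period $\epsilon$, such that eliminating the multipliers from the perturbed equations gives an $\epsilon$-periodic ODE $\dot\xi=h(\xi)+\epsilon^p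 d(\epsilon,t/\epsilon,\xi)$ on $\mathfrak g^D$, with $d$ as smooth as $h$, whose solution flow $\Psi(t,s;\epsilon,\xi)$, $\Psi(s,s;\epsilon,\xi)=\xi$, satisfies $\Psi(\epsilon,0;\epsilon,\xi)=\phi(\epsilon,\xi)$; i.e. the discretization is the time-$\epsilon$ period (Poincaré) map, with initial time $0$, of the perturbed system.
   Formalization: The scheme φ is assumed C^r jointly in (ε,ξ) up to ε=0, and the embedding identity is asserted on each bounded subset of g^D for all sufficiently small ε (with one d for all); without this it fails, e.g. h=0, φ=ξ+ε^{p+1}ξ² is not injective. *)

theory Defs
  imports "HOL-Analysis.Analysis"
begin

(* C^k functions on a set S that need not be open. The derivatives are taken within S, and f' may be
   chosen freely in directions transverse to S. Hence on a linear subspace this is C^k regularity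
   along the subspace, and on a product of a subspace with intervals and lines the derivatives at a
   closed endpoint of an interval are one-sided. *)
primrec C_class ::
  "nat \<Rightarrow> 'a::real_normed_vector set \<Rightarrow> ('a \<Rightarrow> 'b::real_normed_vector) \<Rightarrow> bool" where
  "C_class 0 S f \<longleftrightarrow> continuous_on S f"
| "C_class (Suc k) S f \<longleftrightarrow>
     (\<exists>f'. (\<forall>x\<in>S. (f has_derivative f' x) (at x within S)) \<and> (\<forall>v. C_class k S (\<lambda>x. f' x v)))"

(* The Lie group enters only through its Lie algebra, and every finite-dimensional real Lie algebra
   is the Lie algebra of a Lie group (Lie's third theorem). The inner product of the carrier type
   plays no role: it only provides finite dimension and some norm. *)
definition lie_bracket :: "('g::real_vector \<Rightarrow> 'g \<Rightarrow> 'g) \<Rightarrow> bool" where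
  "lie_bracket br \<longleftrightarrow>
     (\<forall>x. linear (br x)) \<and> (\<forall>y. linear (\<lambda>x. br x y)) \<and> (\<forall>x. br x x = 0) \<and>
     (\<forall>x y z. br x (br y z) + br y (br z x) + br z (br x y) = 0)"

definition is_basis :: "('n \<Rightarrow> 'g::real_vector) \<Rightarrow> bool" where
  "is_basis e \<longleftrightarrow> inj e \<and> independent (range e) \<and> span (range e) = UNIV"

definition coord :: "('n \<Rightarrow> 'g::real_vector) \<Rightarrow> 'n \<Rightarrow> 'g \<Rightarrow> real" where
  "coord e a \<xi> = representation (range e) \<xi> (e a)"

(* struct_const br e d b c is C^d_{bc}, with [e_c, e_b] = C^d_{bc} e_d; note the order of the
   two lower indices. *)
definition struct_const ::
  "('g::real_vector \<Rightarrow> 'g \<Rightarrow> 'g) \<Rightarrow> ('n \<Rightarrow> 'g) \<Rightarrow> 'n \<Rightarrow> 'n \<Rightarrow> 'n \<Rightarrow> real" where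
  "struct_const br e d b c = coord e d (br (e c) (e b))"

(* The partial derivative with respect to the linear coordinate xi^a is the derivative in the
   direction of e_a. *)
definition partial :: "('n \<Rightarrow> 'g::euclidean_space) \<Rightarrow> 'n \<Rightarrow> ('g \<Rightarrow> real) \<Rightarrow> 'g \<Rightarrow> real" where
  "partial e a f \<xi> = frechet_derivative f (at \<xi>) (e a)"

definition hess ::
  "('n \<Rightarrow> 'g::euclidean_space) \<Rightarrow> ('g \<Rightarrow> real) \<Rightarrow> 'g \<Rightarrow> 'n \<Rightarrow> 'n \<Rightarrow> real" where
  "hess e l \<xi> b c = partial e b (partial e c l) \<xi>"

definition pos_def :: "('n::finite \<Rightarrow> 'n \<Rightarrow> real) \<Rightarrow> bool" where
  "pos_def H \<longleftrightarrow> (\<forall>b c. H b c = H c b) \<and>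
     (\<forall>v. v \<noteq> (\<lambda>_. 0) \<longrightarrow> 0 < (\<Sum>b\<in>UNIV. \<Sum>c\<in>UNIV. v b * H b c * v c))"

definition ad_star :: "('g \<Rightarrow> 'g \<Rightarrow> 'g) \<Rightarrow> 'g \<Rightarrow> ('g \<Rightarrow> real) \<Rightarrow> 'g \<Rightarrow> real" where
  "ad_star br \<xi> \<mu> = (\<lambda>\<eta>. \<mu> (br \<xi> \<eta>))"

(* The dual space is the space of bounded linear functionals; in finite dimension all of them are. *)
definition constr_space :: "nat \<Rightarrow> (nat \<Rightarrow> 'g::euclidean_space \<Rightarrow>\<^sub>L real) \<Rightarrow> 'g set" where
  "constr_space m a = {\<xi>. \<forall>\<alpha>\<in>{1..m}. blinfun_apply (a \<alpha>) \<xi> = 0}"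

(* Differentiable solutions, on a time interval T, of
   d/dt (dl/dxi) = ad*_xi (dl/dxi) + lambda_alpha a^alpha, <a^alpha, xi> = 0.
   The covector equation is evaluated on all vectors eta. *)
definition suslov_solution ::
  "('g::euclidean_space \<Rightarrow> 'g \<Rightarrow> 'g) \<Rightarrow> ('g \<Rightarrow> real) \<Rightarrow> nat \<Rightarrow> (nat \<Rightarrow> 'g \<Rightarrow>\<^sub>L real) \<Rightarrow>
     real set \<Rightarrow> (real \<Rightarrow> 'g) \<Rightarrow> bool" where
  "suslov_solution br l m a T x \<longleftrightarrow>
     x differentiable_on T \<and>
     (\<forall>t\<in>T. x t \<in> constr_space m a \<and>
        (\<exists>\<Lambda>::nat \<Rightarrow> real. \<forall>\<eta>.
           ((\<lambda>s. frechet_derivative l (at (x s)) \<eta>) has_real_derivative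
              ad_star br (x t) (frechet_derivative l (at (x t))) \<eta>
                + (\<Sum>\<alpha>=1..m. \<Lambda> \<alpha> * blinfun_apply (a \<alpha>) \<eta>)) (at t within T)))"

(* The dynamical equations at the point xi in coordinates, with velocity v, multipliers Lambda and
   an additional force f in the dual of the Lie algebra. *)
definition forced_eq ::
  "('g::euclidean_space \<Rightarrow> 'g \<Rightarrow> 'g) \<Rightarrow> ('n::finite \<Rightarrow> 'g) \<Rightarrow> ('g \<Rightarrow> real) \<Rightarrow>
     nat \<Rightarrow> (nat \<Rightarrow> 'g \<Rightarrow>\<^sub>L real) \<Rightarrow> ('g \<Rightarrow>\<^sub>L real) \<Rightarrow> 'g \<Rightarrow> 'g \<Rightarrow> (nat \<Rightarrow> real) \<Rightarrow> bool" where
  "forced_eq br e l m a f \<xi> v \<Lambda> \<longleftrightarrow>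
     (\<forall>b. (\<Sum>c\<in>UNIV. hess e l \<xi> b c * coord e c v) =
           (\<Sum>d\<in>UNIV. \<Sum>c\<in>UNIV. struct_const br e d b c * coord e c \<xi> * partial e d l \<xi>)
           + (\<Sum>\<alpha>=1..m. \<Lambda> \<alpha> * blinfun_apply (a \<alpha>) (e b))
           + blinfun_apply f (e b))"

definition forced_solution ::
  "('g::euclidean_space \<Rightarrow> 'g \<Rightarrow> 'g) \<Rightarrow> ('n::finite \<Rightarrow> 'g) \<Rightarrow> ('g \<Rightarrow> real) \<Rightarrow>
     nat \<Rightarrow> (nat \<Rightarrow> 'g \<Rightarrow>\<^sub>L real) \<Rightarrow> (real \<Rightarrow> 'g \<Rightarrow> 'g \<Rightarrow>\<^sub>L real) \<Rightarrow>
     real set \<Rightarrow> (real \<Rightarrow> 'g) \<Rightarrow> bool" where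
  "forced_solution br e l m a f T x \<longleftrightarrow>
     (\<forall>t\<in>T. x t \<in> constr_space m a \<and>
        (\<exists>v \<Lambda>. (x has_vector_derivative v) (at t within T) \<and>
               forced_eq br e l m a (f t (x t)) (x t) v \<Lambda>))"

(* Elimination of the multipliers: by the differentiated constraints <a^alpha, v> = 0, the velocity
   at xi is determined, and it equals w. *)
definition eliminates_to ::
  "('g::euclidean_space \<Rightarrow> 'g \<Rightarrow> 'g) \<Rightarrow> ('n::finite \<Rightarrow> 'g) \<Rightarrow> ('g \<Rightarrow> real) \<Rightarrow>
     nat \<Rightarrow> (nat \<Rightarrow> 'g \<Rightarrow>\<^sub>L real) \<Rightarrow> ('g \<Rightarrow>\<^sub>L real) \<Rightarrow> 'g \<Rightarrow> 'g \<Rightarrow> bool" where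
  "eliminates_to br e l m a f \<xi> w \<longleftrightarrow>
     (\<forall>v. (v \<in> constr_space m a \<and> (\<exists>\<Lambda>. forced_eq br e l m a f \<xi> v \<Lambda>)) \<longleftrightarrow> v = w)"

(* The exact flow F(eps, xi) is the value x eps of the solution x with x 0 = xi. Solutions may blow
   up before time eps, so the estimate is required only where F(eps, xi) exists. *)
definition consistency_order ::
  "('g::euclidean_space \<Rightarrow> 'g \<Rightarrow> 'g) \<Rightarrow> ('g \<Rightarrow> real) \<Rightarrow> nat \<Rightarrow> (nat \<Rightarrow> 'g \<Rightarrow>\<^sub>L real) \<Rightarrow>
     real \<Rightarrow> (real \<Rightarrow> 'g \<Rightarrow> 'g) \<Rightarrow> nat \<Rightarrow> bool" where
  "consistency_order br l m a \<epsilon>0 \<phi> p \<longleftrightarrow>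
     (\<exists>C::real \<Rightarrow> real. continuous_on {0..} C \<and> (\<forall>s\<ge>0. 0 \<le> C s) \<and>
        (\<forall>\<epsilon> \<xi> x. 0 < \<epsilon> \<and> \<epsilon> \<le> \<epsilon>0 \<and> \<xi> \<in> constr_space m a \<and>
            suslov_solution br l m a {0..\<epsilon>} x \<and> x 0 = \<xi> \<longrightarrow>
            norm (\<phi> \<epsilon> \<xi> - x \<epsilon>) \<le> C (norm \<xi>) * \<epsilon> ^ (p + 1)))"

(* Psi(T, 0; xi) = eta for the system with solutions on {0..T} given by sol: a solution from xi
   exists on the whole interval, and every such solution ends at eta. *)
definition time_map_value ::
  "(real set \<Rightarrow> (real \<Rightarrow> 'g) \<Rightarrow> bool) \<Rightarrow> real \<Rightarrow> 'g \<Rightarrow> 'g \<Rightarrow> bool" where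
  "time_map_value sol T \<xi> \<eta> \<longleftrightarrow>
     (\<exists>x. sol {0..T} x \<and> x 0 = \<xi>) \<and> (\<forall>x. sol {0..T} x \<and> x 0 = \<xi> \<longrightarrow> x T = \<eta>)"

end

theory Submission
  imports Defs
begin

text \<open>Suppose that \<open>\<Psi> (t; \<xi>)\<close> is a path of maps with \<open>\<Psi> (0; \<xi>) = \<xi>\<close> and \<open>\<Psi> (\<epsilon>; \<xi>) = \<phi> (\<epsilon>, \<xi>)\<close>,
  each of which is invertible; then \<open>\<phi> (\<epsilon>, \<cdot>)\<close> is the time-\<open>\<epsilon>\<close> map of the vector field
  \<open>X (t, x) = \<partial>\<^sub>t \<Psi> (t; \<Psi> (t)\<^sup>-\<^sup>1 x)\<close>. Replacing the exact flow by a Picard iterate \<open>Q\<close> of order \<open>p\<close>, one takes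
  \<open>\<Psi> (t; \<xi>) = (1 - \<theta>) Q (t, \<xi>) + \<theta> Q (t - \<epsilon>, \<phi> (\<epsilon>, \<xi>))\<close> with a cutoff \<open>\<theta> = \<theta> (t / \<epsilon>)\<close> that is constant near the
  end points. Then \<open>\<partial>\<^sub>t Q (t, \<xi>)\<close> is \<open>h\<close> at the preceding iterate, so \<open>X\<close> is as smooth as \<open>h\<close>; it extends
  periodically, because \<open>\<Psi>\<close> before and after time \<open>\<epsilon>\<close> differ by \<open>\<phi>\<close>; and consistency of order \<open>p\<close> makes
  \<open>X - h\<close> of size \<open>\<epsilon>\<^sup>p\<close>. Since \<open>\<Psi>\<close> is close to the identity only locally uniformly, it is truncated
  outside a ball whose radius tends to infinity as \<open>\<epsilon>\<close> tends to 0. Composing with a projection onto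
  the constraint space turns the constrained problem into one on the whole Lie algebra.\<close>

section \<open>Functions of class \<open>C\<^sup>k\<close>\<close>

text \<open>Picard iterates replace the exact flow because the flow may fail to exist up to time
  \<epsilon>, and its smoothness in the initial value would need a theory of its own; an iterate is
  defined for all times and points, and integration over a fixed interval keeps the class of
  \<open>h\<close>. The powers balance as follows: the iterate of index p solves the equation up to
  a defect of size \<epsilon>^p, the two branches of the path differ by \<epsilon>^(p+1), and the
  derivative of the cutoff in t / \<epsilon> costs a factor 1/\<epsilon>. The obstacle is that
  \<epsilon> must be small depending on \<xi>, while one field d has to be of class C^r jointly in
  (\<epsilon>, \<tau>, \<xi>) and bounded locally uniformly in \<xi> as \<epsilon> tends to 0. Hence
  the truncation radius must itself be a C^r function of \<epsilon>. A change w of the velocity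
  tangent to the constraint space is produced by the covector that the Hessian assigns to w, with
  unchanged multipliers; this turns d into the required force.\<close>

lemma C_class_SucD: "C_class (Suc k) S f \<Longrightarrow> C_class k S f"
proof (induction k arbitrary: f)
  case 0
  then show ?case
    by (auto simp: continuous_on_eq_continuous_within intro: has_derivative_continuous)
next
  case (Suc k)
  obtain f' where f': "\<forall>x\<in>S. (f has_derivative f' x) (at x within S)"
      "\<forall>v. C_class (Suc k) S (\<lambda>x. f' x v)"
    using Suc.prems by (subst (asm) C_class.simps(2)) blast
  then have "\<forall>v. C_class k S (\<lambda>x. f' x v)"
    using Suc.IH by blast
  with f'(1) show ?case
    by (subst C_class.simps(2)) blast
qed

lemma C_class_le: "C_class k S f \<Longrightarrow> j \<le> k \<Longrightarrow> C_class j S f"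
  by (induction k) (auto simp: le_Suc_eq simp del: C_class.simps dest: C_class_SucD)

lemma C_class_continuous_on: "C_class k S f \<Longrightarrow> continuous_on S f"
  using C_class_le[of k S f 0] by simp

lemma C_class_subset: "C_class k T f \<Longrightarrow> S \<subseteq> T \<Longrightarrow> C_class k S f"
proof (induction k arbitrary: f)
  case (Suc k)
  then obtain f' where "\<forall>x\<in>T. (f has_derivative f' x) (at x within T)"
      "\<forall>v. C_class k T (\<lambda>x. f' x v)"
    by auto
  with Suc show ?case
    by (auto intro!: exI[of _ f'] intro: has_derivative_subset)
qed (auto intro: continuous_on_subset)

lemma C_class_SucI:
  "(\<And>x. x \<in> S \<Longrightarrow> (f has_derivative f' x) (at x within S)) \<Longrightarrow>
   (\<And>v. C_class k S (\<lambda>x. f' x v)) \<Longrightarrow> C_class (Suc k) S f"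
  by auto

declare C_class.simps(2) [simp del]

lemma C_class_cong:
  assumes "C_class k S f" "\<And>x. x \<in> S \<Longrightarrow> f x = g x"
  shows "C_class k S g"
proof (cases k)
  case 0
  then show ?thesis
    using assms continuous_on_cong[of S S f g] by auto
next
  case (Suc j)
  then show ?thesis
    using assms unfolding Suc C_class.simps(2) by (metis has_derivative_transform)
qed

lemma C_class_const: "C_class k S (\<lambda>x. c)"
proof (induction k arbitrary: c)
  case (Suc k)
  then show ?case
    by (intro C_class_SucI[where f' = "\<lambda>x v. 0"]) auto
qed auto

lemma C_class_bounded_linear:
  assumes L: "bounded_linear L"
  shows "C_class k S f \<Longrightarrow> C_class k S (\<lambda>x. L (f x))"
proof (induction k arbitrary: f)
  case 0
  then show ?case
    using bounded_linear.continuous_on[OF L] by auto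
next
  case (Suc k)
  obtain f' where f': "\<And>x. x \<in> S \<Longrightarrow> (f has_derivative f' x) (at x within S)"
      "\<And>v. C_class k S (\<lambda>x. f' x v)"
    using Suc.prems by (auto simp: C_class.simps(2))
  show ?case
    by (rule C_class_SucI[where f' = "\<lambda>x v. L (f' x v)"])
       (intro bounded_linear.has_derivative[OF L] Suc.IH f'; assumption)+
qed

lemma C_class_id: "C_class k S (\<lambda>x. x)"
proof (cases k)
  case (Suc j)
  then show ?thesis
    by (auto simp: C_class.simps(2) intro!: exI[of _ "\<lambda>x v. v"] C_class_const)
qed auto

lemma C_class_add: "C_class k S f \<Longrightarrow> C_class k S g \<Longrightarrow> C_class k S (\<lambda>x. f x + g x)"
proof (induction k arbitrary: f g)
  case (Suc k)
  obtain f' where f': "\<And>x. x \<in> S \<Longrightarrow> (f has_derivative f' x) (at x within S)"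
      "\<And>v. C_class k S (\<lambda>x. f' x v)"
    using Suc.prems(1) by (auto simp: C_class.simps(2))
  obtain g' where g': "\<And>x. x \<in> S \<Longrightarrow> (g has_derivative g' x) (at x within S)"
      "\<And>v. C_class k S (\<lambda>x. g' x v)"
    using Suc.prems(2) by (auto simp: C_class.simps(2))
  show ?case
    by (rule C_class_SucI[where f' = "\<lambda>x v. f' x v + g' x v"])
       (intro has_derivative_add Suc.IH f' g'; assumption)+
qed (auto intro: continuous_on_add)

lemma C_class_minus: "C_class k S f \<Longrightarrow> C_class k S (\<lambda>x. - f x)"
  by (rule C_class_bounded_linear[OF bounded_linear_minus[OF bounded_linear_ident]])

lemma C_class_diff: "C_class k S f \<Longrightarrow> C_class k S g \<Longrightarrow> C_class k S (\<lambda>x. f x - g x)"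
  using C_class_add[OF _ C_class_minus, of k S f g] by simp

lemma C_class_sum: "(\<And>i. i \<in> I \<Longrightarrow> C_class k S (f i)) \<Longrightarrow> C_class k S (\<lambda>x. \<Sum>i\<in>I. f i x)"
  by (induction I rule: infinite_finite_induct) (auto intro: C_class_const C_class_add)

lemma (in bounded_bilinear) C_class_bilinear:
  "C_class k S f \<Longrightarrow> C_class k S g \<Longrightarrow> C_class k S (\<lambda>x. prod (f x) (g x))"
proof (induction k arbitrary: f g)
  case (Suc k)
  obtain f' where f': "\<And>x. x \<in> S \<Longrightarrow> (f has_derivative f' x) (at x within S)"
      "\<And>v. C_class k S (\<lambda>x. f' x v)"
    using Suc.prems(1) by (auto simp: C_class.simps(2))
  obtain g' where g': "\<And>x. x \<in> S \<Longrightarrow> (g has_derivative g' x) (at x within S)"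
      "\<And>v. C_class k S (\<lambda>x. g' x v)"
    using Suc.prems(2) by (auto simp: C_class.simps(2))
  show ?case
    by (rule C_class_SucI[where f' = "\<lambda>x v. prod (f x) (g' x v) + prod (f' x v) (g x)"])
       (intro FDERIV C_class_add Suc.IH f' g' Suc.prems[THEN C_class_SucD]; assumption)+
qed (auto intro: continuous_on)

lemmas C_class_scaleR = bounded_bilinear.C_class_bilinear[OF bounded_bilinear_scaleR]
lemmas C_class_inner = bounded_bilinear.C_class_bilinear[OF bounded_bilinear_inner]
lemmas C_class_mult = bounded_bilinear.C_class_bilinear[OF bounded_bilinear_mult]
lemmas C_class_blinfun_compose =
  bounded_bilinear.C_class_bilinear[OF bounded_bilinear_blinfun_compose]
lemmas C_class_fst = C_class_bounded_linear[OF bounded_linear_fst]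
lemmas C_class_snd = C_class_bounded_linear[OF bounded_linear_snd]

lemma C_class_Pair:
  assumes "C_class k S f" "C_class k S g"
  shows "C_class k S (\<lambda>x. (f x, g x))"
proof -
  have "bounded_linear (\<lambda>y. (y, 0))" "bounded_linear (\<lambda>y. (0, y))"
    by (auto intro!: bounded_linear_Pair bounded_linear_ident)
  from C_class_add[OF C_class_bounded_linear[OF this(1) assms(1)]
      C_class_bounded_linear[OF this(2) assms(2)]]
  show ?thesis
    by simp
qed

lemma C_class_power:
  fixes f :: "'a::real_normed_vector \<Rightarrow> real"
  shows "C_class k S f \<Longrightarrow> C_class k S (\<lambda>x. f x ^ n)"
  by (induction n) (auto intro: C_class_const C_class_mult)

text \<open>The induction hypothesis covers \<open>g'\<close> in a fixed direction only, while the
  chain rule evaluates it in the direction \<open>f' x v\<close>, which moves with \<open>x\<close>.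
  Expanding that direction in \<open>Basis\<close> leaves finitely many fixed ones, which is why the
  middle space is euclidean.\<close>

lemma C_class_compose:
  fixes f :: "'a::real_normed_vector \<Rightarrow> 'b::euclidean_space"
    and g :: "'b \<Rightarrow> 'c::real_normed_vector"
  shows "C_class k T g \<Longrightarrow> C_class k S f \<Longrightarrow> f ` S \<subseteq> T \<Longrightarrow> C_class k S (\<lambda>x. g (f x))"
proof (induction k arbitrary: g)
  case 0
  then show ?case
    by (auto intro: continuous_on_compose2)
next
  case (Suc k)
  obtain f' where f': "\<And>x. x \<in> S \<Longrightarrow> (f has_derivative f' x) (at x within S)"
      "\<And>v. C_class k S (\<lambda>x. f' x v)"
    using Suc.prems(2) by (auto simp: C_class.simps(2))
  obtain g' where g': "\<And>y. y \<in> T \<Longrightarrow> (g has_derivative g' y) (at y within T)"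
      "\<And>v. C_class k T (\<lambda>y. g' y v)"
    using Suc.prems(1) by (auto simp: C_class.simps(2))
  show ?case
  proof (rule C_class_SucI[where f' = "\<lambda>x v. g' (f x) (f' x v)"])
    show "((\<lambda>x. g (f x)) has_derivative (\<lambda>v. g' (f x) (f' x v))) (at x within S)" if "x \<in> S" for x
    proof (rule has_derivative_in_compose[OF f'(1)[OF that]])
      show "(g has_derivative g' (f x)) (at (f x) within f ` S)"
        using that Suc.prems(3) by (intro has_derivative_subset[OF g'(1)]) auto
    qed
  next
    fix v
    have "C_class k S (\<lambda>x. \<Sum>b\<in>Basis. (f' x v \<bullet> b) *\<^sub>R g' (f x) b)"
      by (intro C_class_sum C_class_scaleR C_class_inner f'(2) C_class_const
          Suc.IH[OF g'(2) C_class_SucD[OF Suc.prems(2)] Suc.prems(3)])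
    then show "C_class k S (\<lambda>x. g' (f x) (f' x v))"
    proof (rule C_class_cong)
      fix x assume "x \<in> S"
      then have "linear (g' (f x))"
        using g'(1)[of "f x"] Suc.prems(3) by (auto dest: has_derivative_linear)
      then have "g' (f x) (\<Sum>b\<in>Basis. (f' x v \<bullet> b) *\<^sub>R b) =
          (\<Sum>b\<in>Basis. (f' x v \<bullet> b) *\<^sub>R g' (f x) b)"
        by (simp add: linear_sum linear_cmul)
      then show "(\<Sum>b\<in>Basis. (f' x v \<bullet> b) *\<^sub>R g' (f x) b) = g' (f x) (f' x v)"
        by (simp add: euclidean_representation)
    qed
  qed
qed

text \<open>On an open set the derivative within \<open>S\<close> is the full derivative and
  therefore unique, so the witness hidden in \<open>C_class\<close> can be exchanged for the
  canonical \<open>frechet_derivative\<close>.\<close>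

lemma C_class_open_SucD:
  assumes "open S" "C_class (Suc k) S f"
  shows "\<And>x. x \<in> S \<Longrightarrow> (f has_derivative frechet_derivative f (at x)) (at x)"
    and "C_class k S (\<lambda>x. frechet_derivative f (at x) v)"
proof -
  obtain f' where f': "\<And>x. x \<in> S \<Longrightarrow> (f has_derivative f' x) (at x within S)"
      "\<And>v. C_class k S (\<lambda>x. f' x v)"
    using assms(2) by (auto simp: C_class.simps(2))
  have f'': "(f has_derivative f' x) (at x)" if "x \<in> S" for x
    using f'(1)[OF that] at_within_open[OF that assms(1)] by simp
  have fr: "frechet_derivative f (at x) = f' x" if "x \<in> S" for x
    using frechet_derivative_at[OF f''[OF that]] by (rule sym)
  show "(f has_derivative frechet_derivative f (at x)) (at x)" if "x \<in> S" for x
    unfolding fr[OF that] by (rule f''[OF that])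
  show "C_class k S (\<lambda>x. frechet_derivative f (at x) v)"
    by (rule C_class_cong[OF f'(2)]) (simp add: fr)
qed

text \<open>Witnesses chosen on different neighbourhoods need not match as functions on
  \<open>S\<close>; the canonical derivative serves all neighbourhoods at once.\<close>

lemma C_class_local:
  assumes "\<And>x. x \<in> S \<Longrightarrow> \<exists>U. open U \<and> x \<in> U \<and> C_class k U f"
  shows "C_class k S f"
  using assms
proof (induction k arbitrary: f)
  case 0
  have "continuous (at x within S) f" if "x \<in> S" for x
    using 0[OF that] continuous_on_eq_continuous_at[of _ f] continuous_at_imp_continuous_within
    by fastforce
  then show ?case
    by (simp add: continuous_on_eq_continuous_within)
next
  case (Suc k)
  show ?case
  proof (rule C_class_SucI)
    show "(f has_derivative frechet_derivative f (at x)) (at x within S)" if "x \<in> S" for x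
      using Suc.prems[OF that] C_class_open_SucD(1) has_derivative_at_withinI by blast
    show "C_class k S (\<lambda>x. frechet_derivative f (at x) v)" for v
    proof (rule Suc.IH)
      fix x assume "x \<in> S"
      then obtain U where "open U" "x \<in> U" "C_class (Suc k) U f"
        using Suc.prems by blast
      then show "\<exists>U. open U \<and> x \<in> U \<and> C_class k U (\<lambda>a. frechet_derivative f (at a) v)"
        using C_class_open_SucD(2) by blast
    qed
  qed
qed

section \<open>Building blocks for cutoff functions, and bounds from derivatives on compact
  sets\<close>

lemma C_class_real_inverse: "C_class k {0<..} (\<lambda>x::real. inverse x)"
proof (induction k)
  case 0
  then show ?case
    by (auto intro!: continuous_intros)
next
  case (Suc k)
  show ?case
    by (rule C_class_SucI[where f' = "\<lambda>x v. - (inverse x * v * inverse x)"])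
       (auto intro!: has_derivative_inverse' C_class_minus C_class_mult Suc C_class_const)
qed

text \<open>Truncated powers supply cutoffs of any finite smoothness without exponentials. The
  derivative is a multiple of the truncated power one degree lower, which drives the induction; only
  the corner at 0 calls for a difference quotient.\<close>

lemma C_class_max_power: "C_class k UNIV (\<lambda>x::real. max 0 x ^ Suc k)"
proof (induction k)
  case 0
  then show ?case
    by (auto intro!: continuous_intros)
next
  case (Suc k)
  show ?case
  proof (rule C_class_SucI[where f' = "\<lambda>x v. (real (Suc (Suc k)) * v) * max 0 x ^ Suc k"])
    show "C_class k UNIV (\<lambda>x. real (Suc (Suc k)) * v * max 0 x ^ Suc k)" for v
      by (intro C_class_mult C_class_const Suc)
    fix x :: real
    consider "x < 0" | "x > 0" | "x = 0"
      by linarith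
    then have "((\<lambda>x. max 0 x ^ Suc (Suc k)) has_real_derivative
        (real (Suc (Suc k)) * max 0 x ^ Suc k)) (at x)"
    proof cases
      case 1
      have "((\<lambda>x. 0) has_real_derivative (real (Suc (Suc k)) * max 0 x ^ Suc k)) (at x)"
        using 1 by (simp add: max_def)
      then show ?thesis
        by (rule has_field_derivative_transform_within[where d = "- x"]) (use 1 in \<open>auto simp: dist_real_def max_def\<close>)
    next
      case 2
      have "((\<lambda>x. x ^ Suc (Suc k)) has_real_derivative (real (Suc (Suc k)) * max 0 x ^ Suc k)) (at x)"
        using 2 DERIV_pow[of "Suc (Suc k)" x] by (simp add: max_def)
      then show ?thesis
        by (rule has_field_derivative_transform_within[where d = x]) (use 2 in \<open>auto simp: dist_real_def max_def\<close>)
    next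
      case 3
      have "((\<lambda>h. max 0 h ^ Suc k) \<longlongrightarrow> max 0 0 ^ Suc k) (at (0::real))"
        by (intro tendsto_intros)
      then have lim: "((\<lambda>h. max 0 h ^ Suc k) \<longlongrightarrow> 0) (at (0::real))"
        by simp
      have "\<forall>\<^sub>F h in at (0::real). norm (max 0 h ^ Suc (Suc k) / h) \<le> max 0 h ^ Suc k"
      proof (rule eventually_mono)
        show "\<forall>\<^sub>F h in at (0::real). h \<noteq> 0"
          by (simp add: eventually_at_filter)
        show "norm (max 0 h ^ Suc (Suc k) / h) \<le> max 0 h ^ Suc k" if "h \<noteq> 0" for h :: real
          using that by (auto simp: max_def)
      qed
      from Lim_null_comparison[OF this lim]
      have "((\<lambda>h. max 0 h ^ Suc (Suc k) / h) \<longlongrightarrow> 0) (at (0::real))" .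
      then show ?thesis
        using 3 by (simp add: DERIV_def)
    qed
    then show "((\<lambda>x. max 0 x ^ Suc (Suc k)) has_derivative
        (\<lambda>v. real (Suc (Suc k)) * v * max 0 x ^ Suc k)) (at x)"
      unfolding has_field_derivative_def by (rule has_derivative_eq_rhs) (simp add: fun_eq_iff)
  qed
qed

text \<open>\<open>C_class\<close> controls derivatives one direction at a time; this turns bounds
  on the basis vectors into a bound on the operator norm, as the mean value inequality
  demands.\<close>

lemma norm_linear_le_Basis:
  fixes f :: "'a::euclidean_space \<Rightarrow> 'b::real_normed_vector"
  assumes lin: "linear f" and B: "\<And>b. b \<in> Basis \<Longrightarrow> norm (f b) \<le> B b"
  shows "norm (f v) \<le> (\<Sum>b\<in>Basis. B b) * norm v"
proof -
  have "norm (f v) = norm (f (\<Sum>b\<in>Basis. (v \<bullet> b) *\<^sub>R b))"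
    by (simp add: euclidean_representation)
  also have "\<dots> = norm (\<Sum>b\<in>Basis. (v \<bullet> b) *\<^sub>R f b)"
    using lin by (simp add: linear_sum linear_cmul)
  also have "\<dots> \<le> (\<Sum>b\<in>Basis. norm v * B b)"
  proof (rule sum_norm_le)
    fix b :: 'a assume "b \<in> Basis"
    then show "norm ((v \<bullet> b) *\<^sub>R f b) \<le> norm v * B b"
      using B[of b] Basis_le_norm[of b v] by (auto intro!: mult_mono)
  qed
  finally show ?thesis
    using sum_distrib_left[of "norm v" B Basis] by (metis mult.commute)
qed

lemma C_class_Lipschitz:
  fixes f :: "'a::euclidean_space \<Rightarrow> 'b::real_normed_vector"
  assumes f: "C_class (Suc k) S f" and K: "compact K" "convex K" "K \<subseteq> S"
  obtains L where "L > 0" "\<And>x y. x \<in> K \<Longrightarrow> y \<in> K \<Longrightarrow> norm (f x - f y) \<le> L * norm (x - y)"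
proof -
  obtain f' where f': "\<And>x. x \<in> S \<Longrightarrow> (f has_derivative f' x) (at x within S)"
      "\<And>v. C_class k S (\<lambda>x. f' x v)"
    using f by (auto simp: C_class.simps(2))
  have "\<forall>b. \<exists>B. \<forall>x\<in>K. norm (f' x b) \<le> B"
  proof
    fix b
    have "compact ((\<lambda>x. f' x b) ` K)"
      using C_class_continuous_on[OF C_class_subset[OF f'(2) K(3)]] K(1)
      by (rule compact_continuous_image)
    from compact_imp_bounded[OF this] show "\<exists>B. \<forall>x\<in>K. norm (f' x b) \<le> B"
      by (auto simp: bounded_iff)
  qed
  from choice[OF this] obtain B where "\<forall>b. \<forall>x\<in>K. norm (f' x b) \<le> B b" ..
  then have B: "norm (f' x b) \<le> B b" if "x \<in> K" for x b
    using that by simp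
  define L where "L = (\<Sum>b\<in>Basis. \<bar>B b\<bar>) + 1"
  have "onorm (f' x) \<le> L" if x: "x \<in> K" for x
  proof (rule onorm_le)
    fix v
    have lin: "linear (f' x)"
      using f'(1)[of x] x K(3) by (auto dest: has_derivative_linear)
    have "norm (f' x v) \<le> (\<Sum>b\<in>Basis. \<bar>B b\<bar>) * norm v"
      by (rule norm_linear_le_Basis[OF lin]) (use B[OF x] in \<open>auto intro: order_trans[OF _ abs_ge_self]\<close>)
    also have "\<dots> \<le> L * norm v"
      by (simp add: L_def mult_right_mono)
    finally show "norm (f' x v) \<le> L * norm v" .
  qed
  moreover have "L > 0"
    unfolding L_def by (smt (verit) sum_nonneg abs_ge_zero)
  moreover have "(f has_derivative f' x) (at x within K)" if "x \<in> K" for x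
    using f'(1)[of x] that K(3) by (auto intro: has_derivative_subset)
  ultimately show thesis
    by (intro that[of L] differentiable_bound[OF K(2), of f f' L])
qed

text \<open>Differentiation under the integral sign. The partial derivative in \<open>x\<close> is
  \<open>g'\<close> on the vectors \<open>(0, v)\<close>, again a function of both arguments of
  class \<open>k\<close>, so the induction applies to it.\<close>

lemma C_class_integral_param:
  fixes g :: "real \<times> 'b::euclidean_space \<Rightarrow> 'c::euclidean_space"
  shows "C_class k UNIV g \<Longrightarrow> C_class k UNIV (\<lambda>x. integral {0..1} (\<lambda>s. g (s, x)))"
proof (induction k arbitrary: g)
  case 0
  then have "continuous_on UNIV g"
    by simp
  then have "continuous_on (UNIV \<times> cbox 0 1) (\<lambda>(x, s). g (s, x))"
    unfolding case_prod_unfold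
    by (rule continuous_on_compose2) (auto intro!: continuous_intros)
  then show ?case
    using integral_continuous_on_param[of UNIV 0 "1::real" "\<lambda>x s. g (s, x)"] by simp
next
  case (Suc k)
  obtain g' where g': "\<And>y. (g has_derivative g' y) (at y)" "\<And>v. C_class k UNIV (\<lambda>y. g' y v)"
    using Suc.prems by (auto simp: C_class.simps(2))
  have bl: "bounded_linear (g' y)" for y
    by (rule has_derivative_bounded_linear[OF g'(1)])
  define D where "D x s = Blinfun (\<lambda>v. g' (s, x) (0, v))" for x s
  have D: "blinfun_apply (D x s) v = g' (s, x) (0, v)" for x s v
  proof -
    have "bounded_linear (\<lambda>v. g' (s, x) (0, v))"
      by (rule bounded_linear_compose[OF bl]) (intro bounded_linear_Pair bounded_linear_zero bounded_linear_ident)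
    then show ?thesis
      by (simp add: D_def bounded_linear_Blinfun_apply)
  qed
  have cont: "continuous_on UNIV g" "\<And>v. continuous_on UNIV (\<lambda>y. g' y v)"
    using C_class_continuous_on[OF Suc.prems] C_class_continuous_on[OF g'(2)] by auto
  have cont_swap: "continuous_on (UNIV \<times> cbox 0 1) (\<lambda>(x, s). h (s, x))"
    if "continuous_on UNIV h" for h :: "real \<times> 'b \<Rightarrow> 'c"
    unfolding case_prod_unfold
    by (rule continuous_on_compose2[OF that]) (auto intro!: continuous_intros)
  have cont_slice: "continuous_on (cbox 0 1) (\<lambda>s. h (s, x))"
    if "continuous_on UNIV h" for h :: "real \<times> 'b \<Rightarrow> 'c" and x
    by (rule continuous_on_compose2[OF that]) (auto intro!: continuous_intros)
  have contD: "continuous_on (UNIV \<times> cbox 0 1) (\<lambda>(x, s). D x s)"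
  proof (rule continuous_on_blinfun_componentwise)
    fix i :: 'b
    show "continuous_on (UNIV \<times> cbox 0 1) (\<lambda>y. blinfun_apply (case y of (x, s) \<Rightarrow> D x s) i)"
      using cont_swap[OF cont(2), of "(0, i)"] by (simp add: case_prod_unfold D)
  qed
  have der: "((\<lambda>x. integral (cbox 0 1) (\<lambda>s. g (s, x))) has_derivative integral (cbox 0 1) (D x)) (at x)" for x
  proof (rule leibniz_rule[where U = UNIV])
    show "((\<lambda>x. g (s, x)) has_derivative blinfun_apply (D x s)) (at x)" for x s
    proof (rule has_derivative_eq_rhs)
      show "((\<lambda>x. g (s, x)) has_derivative (\<lambda>v. g' (s, x) (0, v))) (at x)"
        by (rule has_derivative_compose[of "Pair s" "Pair 0", OF _ g'(1)])
           (auto intro!: derivative_eq_intros)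
    qed (simp add: D fun_eq_iff)
    show "(\<lambda>s. g (s, x)) integrable_on cbox 0 1" for x
      by (rule integrable_continuous[OF cont_slice[OF cont(1)]])
  qed (use contD in auto)
  have "blinfun_apply (integral (cbox 0 1) (D x)) v = integral {0..1} (\<lambda>s. g' (s, x) (0, v))" for x v
  proof -
    have "D x integrable_on cbox 0 1"
    proof (rule integrable_continuous)
      have "continuous_on (cbox 0 1) (\<lambda>s. (case (x, s) of (x, s) \<Rightarrow> D x s))"
        by (rule continuous_on_compose2[OF contD]) (auto intro!: continuous_intros)
      then show "continuous_on (cbox 0 1) (D x)"
        by simp
    qed
    then have "integral (cbox 0 1) ((\<lambda>A. blinfun_apply A v) \<circ> D x) = blinfun_apply (integral (cbox 0 1) (D x)) v"
      by (rule integral_linear) (rule bounded_bilinear.bounded_linear_left[OF bounded_bilinear_blinfun_apply])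
    then show ?thesis
      by (simp add: o_def D)
  qed
  then show ?case
    using der Suc.IH[OF g'(2)]
    by (intro C_class_SucI[where f' = "\<lambda>x. blinfun_apply (integral (cbox 0 1) (D x))"]) auto
qed

lemma obtain_cutoff:
  obtains f :: "real \<Rightarrow> real" and L
  where "C_class k UNIV f" "\<And>s. 0 \<le> f s" "\<And>s. f s \<le> 1" "\<And>s. s \<le> 0 \<Longrightarrow> f s = 1"
    "\<And>s. 1 \<le> s \<Longrightarrow> f s = 0" "L > 0" "\<And>s t. \<bar>f s - f t\<bar> \<le> L * \<bar>s - t\<bar>"
proof -
  \<comment> \<open>The inner truncated power smooths the corner at 0, the outer one the corner at
    1. The exponent gives one order more than required, so that a Lipschitz constant can be read off
    the derivative.\<close>
  define f :: "real \<Rightarrow> real" where "f s = max 0 (1 - max 0 s ^ Suc (Suc k)) ^ Suc (Suc k)" for s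
  have C: "C_class (Suc k) UNIV f"
    unfolding f_def
    by (rule C_class_compose[OF C_class_max_power])
       (auto intro!: C_class_diff C_class_const C_class_max_power simp del: power_Suc)
  have f0: "f s = 1" if "s \<le> 0" for s
    using that by (simp add: f_def max_def)
  have f1: "f s = 0" if "1 \<le> s" for s
  proof -
    have "1 \<le> s ^ Suc (Suc k)"
      using that by (rule one_le_power)
    then have "max 0 (1 - max 0 s ^ Suc (Suc k)) = 0"
      using that by (simp del: power_Suc)
    then show ?thesis
      by (simp add: f_def)
  qed
  obtain L where L: "L > 0" "\<And>x y. x \<in> {0..1} \<Longrightarrow> y \<in> {0..1} \<Longrightarrow> norm (f x - f y) \<le> L * norm (x - y)"
    using C_class_Lipschitz[OF C, of "{0..1}"] by auto
  \<comment> \<open>Clamping to [0, 1] does not change the value of \<open>f\<close> and does not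
    increase distances, so the Lipschitz constant on the compact interval is valid on the whole
    line.\<close>
  define c :: "real \<Rightarrow> real" where "c s = max 0 (min 1 s)" for s
  have fc: "f s = f (c s)" for s
    using f0[of s] f0[of 0] f1[of s] f1[of 1] by (auto simp: c_def max_def min_def)
  have "\<bar>f s - f t\<bar> \<le> L * \<bar>s - t\<bar>" for s t
  proof -
    have "\<bar>f s - f t\<bar> \<le> L * \<bar>c s - c t\<bar>"
      using L(2)[of "c s" "c t"] by (subst (1 2) fc) (auto simp: c_def)
    also have "\<dots> \<le> L * \<bar>s - t\<bar>"
      using L(1) by (intro mult_left_mono) (auto simp: c_def)
    finally show ?thesis .
  qed
  moreover have "0 \<le> f s" "f s \<le> 1" for s
    unfolding f_def by (auto intro!: power_le_one simp del: power_Suc)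
  ultimately show thesis
    using that[of f L] C_class_SucD[OF C] f0 f1 L(1) by blast
qed

section \<open>Smoothness of inverses\<close>

lemma C_class_Blinfun:
  fixes F :: "'x::real_normed_vector \<Rightarrow> 'a::euclidean_space \<Rightarrow> 'b::real_normed_vector"
  assumes "\<And>x. x \<in> S \<Longrightarrow> bounded_linear (F x)" "\<And>v. C_class k S (\<lambda>x. F x v)"
  shows "C_class k S (\<lambda>x. Blinfun (F x))"
proof -
  \<comment> \<open>The operator is a finite sum of rank one operators whose coefficients are the
    values on the basis; this passes from control in each direction to control in operator
    norm.\<close>
  have "C_class k S (\<lambda>x. \<Sum>b\<in>Basis. blinfun_scaleR_left (F x b) o\<^sub>L blinfun_inner_left b)"
    by (intro C_class_sum C_class_blinfun_compose C_class_const assms(2)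
        C_class_bounded_linear[OF bounded_linear_blinfun_scaleR_left])
  then show ?thesis
  proof (rule C_class_cong)
    fix x assume x: "x \<in> S"
    then have lin: "linear (F x)"
      using assms(1) bounded_linear.linear by blast
    show "(\<Sum>b\<in>Basis. blinfun_scaleR_left (F x b) o\<^sub>L blinfun_inner_left b) = Blinfun (F x)"
    proof (rule blinfun_eqI)
      fix v
      have "F x v = F x (\<Sum>b\<in>Basis. (v \<bullet> b) *\<^sub>R b)"
        by (simp add: euclidean_representation)
      also have "\<dots> = (\<Sum>b\<in>Basis. (v \<bullet> b) *\<^sub>R F x b)"
        using lin by (simp add: linear_sum linear_cmul)
      finally show "blinfun_apply (\<Sum>b\<in>Basis. blinfun_scaleR_left (F x b) o\<^sub>L blinfun_inner_left b) v
          = blinfun_apply (Blinfun (F x)) v"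
        using assms(1)[OF x] by (simp add: bounded_linear_Blinfun_apply blinfun.sum_left)
    qed
  qed
qed

text \<open>The derivative of \<open>B\<close> is - B A' B, so each induction step gains one order.
  Continuity, the base case, comes from the identity B y - B x = B y (A x - A y) B x.\<close>

lemma C_class_blinfun_inverse:
  fixes A B :: "'x::real_normed_vector \<Rightarrow> 'a::real_normed_vector \<Rightarrow>\<^sub>L 'a"
  assumes "C_class k S A"
    and inv: "\<And>x. x \<in> S \<Longrightarrow> A x o\<^sub>L B x = id_blinfun" "\<And>x. x \<in> S \<Longrightarrow> B x o\<^sub>L A x = id_blinfun"
  shows "C_class k S B"
  using assms(1)
proof (induction k)
  have apply_inv: "blinfun_apply (A x) (blinfun_apply (B x) v) = v"
    "blinfun_apply (B x) (blinfun_apply (A x) v) = v" if "x \<in> S" for x v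
    using arg_cong[OF inv(1)[OF that], of "\<lambda>T. blinfun_apply T v"]
      arg_cong[OF inv(2)[OF that], of "\<lambda>T. blinfun_apply T v"] by simp_all
  have diff: "B y - B x = B y o\<^sub>L (A x - A y) o\<^sub>L B x" if "x \<in> S" "y \<in> S" for x y
    by (rule blinfun_eqI) (simp add: that apply_inv blinfun.diff_left blinfun.diff_right)
  case 0
  have "(B \<longlongrightarrow> B x) (at x within S)" if x: "x \<in> S" for x
  proof -
    have A: "(A \<longlongrightarrow> A x) (at x within S)"
      using 0 x by (auto simp: continuous_on_def)
    define m where "m y = norm (A x - A y) * norm (B x)" for y
    have "((\<lambda>y. norm (A x - A y) * norm (B x)) \<longlongrightarrow> norm (A x - A x) * norm (B x)) (at x within S)"
      by (intro tendsto_intros A)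
    then have m: "(m \<longlongrightarrow> 0) (at x within S)"
      by (simp add: m_def[abs_def])
    \<comment> \<open>No local bound on \<open>B\<close> is known beforehand. Once
      \<open>m y < 1/2\<close>, the term with \<open>norm (B y)\<close> can be absorbed, which gives
      \<open>norm (B y) \<le> 2 * norm (B x)\<close> and then the estimate.\<close>
    have "\<forall>\<^sub>F y in at x within S. norm (B y - B x) \<le> 2 * norm (B x) * m y"
    proof -
      have "\<forall>\<^sub>F y in at x within S. m y < 1/2"
        by (rule order_tendstoD(2)[OF m]) simp
      moreover have "\<forall>\<^sub>F y in at x within S. y \<in> S"
        by (simp add: eventually_at_filter)
      ultimately show ?thesis
      proof eventually_elim
        case (elim y)
        have "norm (B y - B x) \<le> norm (B y o\<^sub>L (A x - A y)) * norm (B x)"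
          unfolding diff[OF x elim(2)] by (rule norm_blinfun_compose)
        also have "\<dots> \<le> norm (B y) * norm (A x - A y) * norm (B x)"
          by (intro mult_right_mono norm_blinfun_compose) simp
        finally have *: "norm (B y - B x) \<le> norm (B y) * m y"
          by (simp add: m_def mult.assoc)
        also have "\<dots> \<le> norm (B y) * (1/2)"
          using elim by (intro mult_left_mono) auto
        finally have "norm (B y) \<le> 2 * norm (B x)"
          using norm_triangle_ineq2[of "B y" "B x"] by simp
        moreover have "0 \<le> m y"
          by (simp add: m_def)
        ultimately show ?case
          using order_trans[OF * mult_right_mono] by blast
      qed
    qed
    moreover have "((\<lambda>y. 2 * norm (B x) * m y) \<longlongrightarrow> 0) (at x within S)"
      using tendsto_mult_left[OF m, of "2 * norm (B x)"] by simp
    ultimately have "((\<lambda>y. B y - B x) \<longlongrightarrow> 0) (at x within S)"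
      by (rule Lim_null_comparison)
    then show ?thesis
      by (rule LIM_zero_cancel)
  qed
  then show ?case
    by (simp add: continuous_on_def)
next
  have apply_inv: "blinfun_apply (A x) (blinfun_apply (B x) v) = v"
    "blinfun_apply (B x) (blinfun_apply (A x) v) = v" if "x \<in> S" for x v
    using arg_cong[OF inv(1)[OF that], of "\<lambda>T. blinfun_apply T v"]
      arg_cong[OF inv(2)[OF that], of "\<lambda>T. blinfun_apply T v"] by simp_all
  case (Suc k)
  have B: "C_class k S B"
    using Suc.IH Suc.prems C_class_SucD by blast
  obtain A' where A': "\<And>x. x \<in> S \<Longrightarrow> (A has_derivative A' x) (at x within S)"
      "\<And>v. C_class k S (\<lambda>x. A' x v)"
    using Suc.prems by (auto simp: C_class.simps(2))
  show ?case
  proof (rule C_class_SucI)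
    show "C_class k S (\<lambda>x. - (B x o\<^sub>L A' x v o\<^sub>L B x))" for v
      by (intro C_class_minus C_class_blinfun_compose B A'(2))
    fix x assume x: "x \<in> S"
    interpret A': bounded_linear "A' x"
      using A'(1)[OF x] by (rule has_derivative_bounded_linear)
    obtain K where K: "\<And>h. norm (A' x h) \<le> norm h * K"
      using A'.bounded by blast
    define rem where "rem y = norm (A y - A x - A' x (y - x)) / norm (y - x)" for y
    have rem: "(rem \<longlongrightarrow> 0) (at x within S)"
      using A'(1)[OF x] unfolding has_derivative_iff_norm rem_def[abs_def] by simp
    have contB: "(B \<longlongrightarrow> B x) (at x within S)"
      using C_class_continuous_on[OF B] x by (auto simp: continuous_on_def)
    have eq: "B y - B x - - (B x o\<^sub>L A' x (y - x) o\<^sub>L B x) =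
        ((B x - B y) o\<^sub>L A' x (y - x) o\<^sub>L B x) - (B y o\<^sub>L (A y - A x - A' x (y - x)) o\<^sub>L B x)"
      if "y \<in> S" for y
      by (rule blinfun_eqI)
         (simp add: that x apply_inv blinfun.diff_left blinfun.diff_right blinfun.add_left blinfun.minus_left)
    have "((\<lambda>y. norm (B x - B y) * K * norm (B x) + norm (B y) * rem y * norm (B x)) \<longlongrightarrow>
        norm (B x - B x) * K * norm (B x) + norm (B x) * 0 * norm (B x)) (at x within S)"
      by (intro tendsto_intros contB rem)
    then have lim: "((\<lambda>y. norm (B x - B y) * K * norm (B x) + norm (B y) * rem y * norm (B x)) \<longlongrightarrow> 0)
        (at x within S)"
      by simp
    show "(B has_derivative (\<lambda>v. - (B x o\<^sub>L A' x v o\<^sub>L B x))) (at x within S)"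
      unfolding has_derivative_iff_norm
    proof
      show "bounded_linear (\<lambda>v. - (B x o\<^sub>L A' x v o\<^sub>L B x))"
        by (intro bounded_linear_minus
            bounded_linear_compose[OF bounded_bilinear.bounded_linear_left[OF bounded_bilinear_blinfun_compose]]
            bounded_linear_compose[OF bounded_bilinear.bounded_linear_right[OF bounded_bilinear_blinfun_compose]]
            A'.bounded_linear_axioms)
      show "((\<lambda>y. norm (B y - B x - - (B x o\<^sub>L A' x (y - x) o\<^sub>L B x)) / norm (y - x)) \<longlongrightarrow> 0) (at x within S)"
      proof (rule Lim_null_comparison[OF _ lim])
        have "\<forall>\<^sub>F y in at x within S. y \<in> S \<and> y \<noteq> x"
          by (simp add: eventually_at_filter)
        then show "\<forall>\<^sub>F y in at x within S.
            norm (norm (B y - B x - - (B x o\<^sub>L A' x (y - x) o\<^sub>L B x)) / norm (y - x))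
            \<le> norm (B x - B y) * K * norm (B x) + norm (B y) * rem y * norm (B x)"
        proof eventually_elim
          case (elim y)
          have "norm (B y - B x - - (B x o\<^sub>L A' x (y - x) o\<^sub>L B x)) \<le>
              norm ((B x - B y) o\<^sub>L A' x (y - x) o\<^sub>L B x)
              + norm (B y o\<^sub>L (A y - A x - A' x (y - x)) o\<^sub>L B x)"
            using elim by (subst eq) (auto intro: norm_triangle_ineq4)
          also have "norm ((B x - B y) o\<^sub>L A' x (y - x) o\<^sub>L B x) \<le>
              norm (B x - B y) * (norm (y - x) * K) * norm (B x)"
            by (rule order_trans[OF norm_blinfun_compose] mult_right_mono mult_left_mono
                order_trans[OF norm_blinfun_compose] K norm_ge_zero)+
          also have "norm (B y o\<^sub>L (A y - A x - A' x (y - x)) o\<^sub>L B x) \<le>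
              norm (B y) * norm (A y - A x - A' x (y - x)) * norm (B x)"
            by (rule order_trans[OF norm_blinfun_compose] mult_right_mono norm_blinfun_compose norm_ge_zero)+
          finally show ?case
            using elim by (simp add: rem_def divide_simps) (simp add: algebra_simps)
        qed
      qed
    qed
  qed
qed

text \<open>A bootstrap: if \<open>g\<close> is of class \<open>k\<close>, then so is the derivative
  of \<open>T\<close> along \<open>g\<close>, hence its inverse, and that is the derivative of
  \<open>g\<close>. Existence and continuity of \<open>g\<close> are hypotheses because they will
  come from a global expansion estimate; in finite dimension injectivity of the derivative already
  makes it invertible.\<close>

lemma C_class_inverse_function:
  fixes T g :: "'a::euclidean_space \<Rightarrow> 'a"
  assumes "open U" "open V" "C_class k U T" and g: "g ` V \<subseteq> U" "\<And>y. y \<in> V \<Longrightarrow> T (g y) = y"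
    and cont: "continuous_on V g"
    and inj: "\<And>x D. x \<in> U \<Longrightarrow> (T has_derivative D) (at x) \<Longrightarrow> inj D"
  shows "C_class k V g"
  using assms(3)
proof (induction k)
  case 0
  then show ?case
    using cont by simp
next
  case (Suc k)
  have gk: "C_class k V g"
    using Suc.IH Suc.prems C_class_SucD by blast
  define T' where "T' x = frechet_derivative T (at x)" for x
  have T': "\<And>x. x \<in> U \<Longrightarrow> (T has_derivative T' x) (at x)" "\<And>v. C_class k U (\<lambda>x. T' x v)"
    using C_class_open_SucD[OF \<open>open U\<close> Suc.prems] by (auto simp: T'_def)
  define S where "S y = inv (T' (g y))" for y
  have S: "linear (S y)" "\<And>v. S y (T' (g y) v) = v" "\<And>v. T' (g y) (S y v) = v" if "y \<in> V" for y
  proof -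
    have "g y \<in> U"
      using that g by auto
    then have D: "(T has_derivative T' (g y)) (at (g y))"
      by (rule T'(1))
    have i: "inj (T' (g y))"
      by (rule inj[OF \<open>g y \<in> U\<close> D])
    obtain f' where f': "linear f'" "\<forall>v. f' (T' (g y) v) = v" "\<forall>v. T' (g y) (f' v) = v"
      using linear_injective_isomorphism[OF has_derivative_linear[OF D] i] by blast
    have "S y = f'"
      unfolding S_def by (rule inv_unique_comp) (use f' in \<open>auto simp: fun_eq_iff\<close>)
    with f' show "linear (S y)" "\<And>v. S y (T' (g y) v) = v" "\<And>v. T' (g y) (S y v) = v"
      by auto
  qed
  have blS: "bounded_linear (S y)" if "y \<in> V" for y
    using S(1)[OF that] by (simp add: linear_conv_bounded_linear)
  have blT: "bounded_linear (T' (g y))" if "y \<in> V" for y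
    using T'(1)[of "g y"] that g(1) by (intro has_derivative_bounded_linear) auto
  have "C_class k V (\<lambda>y. Blinfun (T' (g y)))"
    by (intro C_class_Blinfun blT C_class_compose[OF T'(2) gk g(1)])
  then have "C_class k V (\<lambda>y. Blinfun (S y))"
    by (rule C_class_blinfun_inverse)
       (auto intro!: blinfun_eqI simp: bounded_linear_Blinfun_apply blS blT S)
  then have CS: "C_class k V (\<lambda>y. blinfun_apply (Blinfun (S y)) v)" for v
    by (rule C_class_bounded_linear[OF bounded_bilinear.bounded_linear_left[OF bounded_bilinear_blinfun_apply]])
  show ?case
  proof (rule C_class_SucI)
    show "C_class k V (\<lambda>y. S y v)" for v
      by (rule C_class_cong[OF CS]) (simp add: bounded_linear_Blinfun_apply blS)
    fix y assume y: "y \<in> V"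
    have "(g has_derivative S y) (at y)"
    proof (rule has_derivative_inverse_basic[OF T'(1) blS[OF y] _ _ \<open>open V\<close> y g(2)])
      show "g y \<in> U"
        using y g by auto
      show "S y \<circ> T' (g y) = id"
        using S(2)[OF y] by auto
      show "continuous (at y) g"
        using cont \<open>open V\<close> y by (simp add: continuous_on_eq_continuous_at)
    qed
    then show "(g has_derivative S y) (at y within V)"
      by (rule has_derivative_at_withinI)
  qed
qed

section \<open>Uniform smallness, on compact sets, of maps that vanish at step size 0\<close>

lemma eventually_small_on_compact:
  fixes q :: "real \<times> 'b::metric_space \<times> 'a::metric_space \<Rightarrow> 'c::real_normed_vector"
  assumes q: "continuous_on ({0..e} \<times> UNIV \<times> UNIV) q" "\<And>\<tau> x. q (0, \<tau>, x) = 0"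
    and "e > 0" "c > 0" "compact T" "compact K"
  shows "\<exists>E>0. E \<le> e \<and> (\<forall>\<epsilon> \<tau> x. 0 \<le> \<epsilon> \<and> \<epsilon> \<le> E \<and> \<tau> \<in> T \<and> x \<in> K \<longrightarrow> norm (q (\<epsilon>, \<tau>, x)) \<le> c)"
proof -
  have "uniformly_continuous_on ({0..e} \<times> T \<times> K) q"
    using assms by (intro compact_uniformly_continuous continuous_on_subset[OF q(1)] compact_Times) auto
  then obtain d where d: "d > 0"
    "\<And>y z. y \<in> {0..e} \<times> T \<times> K \<Longrightarrow> z \<in> {0..e} \<times> T \<times> K \<Longrightarrow> dist z y < d \<Longrightarrow> dist (q z) (q y) < c"
    unfolding uniformly_continuous_on_def using \<open>c > 0\<close> by meson
  have "norm (q (\<epsilon>, \<tau>, x)) \<le> c" if "0 \<le> \<epsilon>" "\<epsilon> \<le> min e (d/2)" "\<tau> \<in> T" "x \<in> K" for \<epsilon> \<tau> x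
    using d(2)[of "(0, \<tau>, x)" "(\<epsilon>, \<tau>, x)"] that \<open>e > 0\<close> \<open>d > 0\<close> q(2)
    by (simp add: dist_Pair_Pair dist_norm)
  then show ?thesis
    using \<open>e > 0\<close> \<open>d > 0\<close> by (intro exI[of _ "min e (d/2)"]) auto
qed

text \<open>Since \<open>g\<close> vanishes identically at step size 0, so does its derivative in
  \<open>x\<close>. The derivatives along the finitely many basis directions are then uniformly
  small for small steps, and the mean value inequality on the convex set \<open>K\<close>
  concludes.\<close>

lemma eventually_small_Lipschitz:
  fixes g :: "real \<times> 'b::euclidean_space \<times> 'a::euclidean_space \<Rightarrow> 'c::real_normed_vector"
  assumes g: "C_class (Suc k) ({0..e} \<times> UNIV \<times> UNIV) g" "\<And>\<tau> x. g (0, \<tau>, x) = 0"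
    and "e > 0" "c > 0" "compact T" "compact K" "convex K"
  shows "\<exists>E>0. E \<le> e \<and> (\<forall>\<epsilon> \<tau> x y. 0 \<le> \<epsilon> \<and> \<epsilon> \<le> E \<and> \<tau> \<in> T \<and> x \<in> K \<and> y \<in> K \<longrightarrow>
            norm (g (\<epsilon>, \<tau>, x) - g (\<epsilon>, \<tau>, y)) \<le> c * norm (x - y))"
proof -
  let ?S = "{0..e} \<times> UNIV \<times> (UNIV :: 'a set)"
  obtain g' where g': "\<And>z. z \<in> ?S \<Longrightarrow> (g has_derivative g' z) (at z within ?S)"
      "\<And>v. C_class k ?S (\<lambda>z. g' z v)"
    using g(1) by (auto simp: C_class.simps(2))
  define D where "D z v = g' z (0, 0, v)" for z v
  have D: "((\<lambda>x. g (\<epsilon>, \<tau>, x)) has_derivative D (\<epsilon>, \<tau>, x)) (at x)" if "0 \<le> \<epsilon>" "\<epsilon> \<le> e" for \<epsilon> \<tau> x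
  proof -
    have "((\<lambda>x. g (\<epsilon>, \<tau>, x)) has_derivative (\<lambda>v. g' (\<epsilon>, \<tau>, x) (0, 0, v))) (at x)"
    proof (rule has_derivative_in_compose[where f = "\<lambda>x. (\<epsilon>, \<tau>, x)"])
      show "((\<lambda>x. (\<epsilon>, \<tau>, x)) has_derivative (\<lambda>v. (0, 0, v))) (at x)"
        by (intro derivative_intros)
      show "(g has_derivative g' (\<epsilon>, \<tau>, x)) (at (\<epsilon>, \<tau>, x) within range (\<lambda>x. (\<epsilon>, \<tau>, x)))"
        using that by (intro has_derivative_subset[OF g'(1)]) auto
    qed
    then show ?thesis
      by (simp add: D_def[abs_def])
  qed
  have D0: "D (0, \<tau>, x) v = 0" for \<tau> x v
  proof -
    have "((\<lambda>x. 0) has_derivative D (0, \<tau>, x)) (at x)"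
      using D[of 0 \<tau> x] g(2) \<open>e > 0\<close> by simp
    then have "D (0, \<tau>, x) = (\<lambda>v. 0)"
      using has_derivative_const has_derivative_unique by blast
    then show ?thesis
      by simp
  qed
  have "\<forall>b. \<exists>E>0. E \<le> e \<and> (\<forall>\<epsilon> \<tau> x. 0 \<le> \<epsilon> \<and> \<epsilon> \<le> E \<and> \<tau> \<in> T \<and> x \<in> K \<longrightarrow>
      norm (D (\<epsilon>, \<tau>, x) b) \<le> c / DIM('a))"
  proof
    fix b
    have "continuous_on ?S (\<lambda>z. D z b)"
      unfolding D_def by (rule C_class_continuous_on[OF g'(2)])
    then show "\<exists>E>0. E \<le> e \<and> (\<forall>\<epsilon> \<tau> x. 0 \<le> \<epsilon> \<and> \<epsilon> \<le> E \<and> \<tau> \<in> T \<and> x \<in> K \<longrightarrow>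
        norm (D (\<epsilon>, \<tau>, x) b) \<le> c / DIM('a))"
      by (rule eventually_small_on_compact) (use assms D0 in auto)
  qed
  from choice[OF this] obtain E where
    "\<forall>b. 0 < E b \<and> E b \<le> e \<and> (\<forall>\<epsilon> \<tau> x. 0 \<le> \<epsilon> \<and> \<epsilon> \<le> E b \<and> \<tau> \<in> T \<and> x \<in> K \<longrightarrow>
      norm (D (\<epsilon>, \<tau>, x) b) \<le> c / DIM('a))" ..
  then have E: "0 < E b" "E b \<le> e" "\<And>\<epsilon> \<tau> x. 0 \<le> \<epsilon> \<Longrightarrow> \<epsilon> \<le> E b \<Longrightarrow> \<tau> \<in> T \<Longrightarrow> x \<in> K \<Longrightarrow>
      norm (D (\<epsilon>, \<tau>, x) b) \<le> c / DIM('a)" for b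
    by auto
  define E0 where "E0 = Min (E ` (Basis :: 'a set))"
  have E0: "E0 > 0" "E0 \<le> E b" if "b \<in> Basis" for b
    using E(1) that by (auto simp: E0_def)
  have E0_pos: "E0 > 0" "E0 \<le> e"
    using E0 E(2) nonempty_Basis by (blast, metis SOME_Basis order_trans)
  have "norm (g (\<epsilon>, \<tau>, x) - g (\<epsilon>, \<tau>, y)) \<le> c * norm (x - y)"
    if "0 \<le> \<epsilon>" "\<epsilon> \<le> E0" "\<tau> \<in> T" "x \<in> K" "y \<in> K" for \<epsilon> \<tau> x y
  proof (rule differentiable_bound[OF \<open>convex K\<close> _ _ that(4,5)])
    fix z assume z: "z \<in> K"
    have der: "((\<lambda>x. g (\<epsilon>, \<tau>, x)) has_derivative D (\<epsilon>, \<tau>, z)) (at z)"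
      by (rule D) (use that E0_pos in auto)
    then show "((\<lambda>x. g (\<epsilon>, \<tau>, x)) has_derivative D (\<epsilon>, \<tau>, z)) (at z within K)"
      by (rule has_derivative_at_withinI)
    show "onorm (D (\<epsilon>, \<tau>, z)) \<le> c"
    proof (rule onorm_le)
      fix v
      have "norm (D (\<epsilon>, \<tau>, z) v) \<le> (\<Sum>b\<in>(Basis::'a set). c / DIM('a)) * norm v"
        by (rule norm_linear_le_Basis[OF has_derivative_linear[OF der]])
           (use E0(2) that z in \<open>auto intro!: E(3) intro: order_trans\<close>)
      then show "norm (D (\<epsilon>, \<tau>, z) v) \<le> c * norm v"
        by simp
    qed
  qed
  then show ?thesis
    using E0_pos by blast
qed

section \<open>Initial value problems\<close>

lemma vector_derivative_bound:
  fixes u :: "real \<Rightarrow> 'a::real_normed_vector"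
  assumes "convex S" "\<And>t. t \<in> S \<Longrightarrow> (u has_vector_derivative u' t) (at t within S)"
    "\<And>t. t \<in> S \<Longrightarrow> norm (u' t) \<le> B" "s \<in> S" "t \<in> S"
  shows "norm (u s - u t) \<le> B * \<bar>s - t\<bar>"
proof -
  have "norm (u s - u t) \<le> B * norm (s - t)"
  proof (rule differentiable_bound[OF assms(1)])
    show "(u has_derivative (\<lambda>r. r *\<^sub>R u' t)) (at t within S)" if "t \<in> S" for t
      using assms(2)[OF that] by (simp add: has_vector_derivative_def)
    show "onorm (\<lambda>r. r *\<^sub>R u' t) \<le> B" if "t \<in> S" for t
      using assms(3)[OF that] by (intro onorm_le) (simp add: mult.commute[of B] mult_left_mono)
  qed (use assms in auto)
  then show ?thesis
    by simp
qed

text \<open>On short time intervals the maximal distance can be absorbed, so that no exponential factor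
  as in Gronwall's inequality is needed.\<close>

lemma approximate_solutions_close:
  fixes x y :: "real \<Rightarrow> 'a::euclidean_space"
  assumes x: "\<And>t. t \<in> {a..b} \<Longrightarrow> (x has_vector_derivative x' t) (at t within {a..b})"
    and y: "\<And>t. t \<in> {a..b} \<Longrightarrow> (y has_vector_derivative y' t) (at t within {a..b})"
    and x': "\<And>t. t \<in> {a..b} \<Longrightarrow> norm (x' t - h (x t)) \<le> \<delta>"
    and y': "\<And>t. t \<in> {a..b} \<Longrightarrow> norm (y' t - h (y t)) \<le> \<delta>"
    and B: "\<And>t. t \<in> {a..b} \<Longrightarrow> x t \<in> B" "\<And>t. t \<in> {a..b} \<Longrightarrow> y t \<in> B"
    and h: "\<And>u v. u \<in> B \<Longrightarrow> v \<in> B \<Longrightarrow> norm (h u - h v) \<le> L * norm (u - v)"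
    and L: "0 \<le> L" "L * (b - a) \<le> 1/2"
    and st: "s \<in> {a..b}" "t \<in> {a..b}"
  shows "norm (x t - y t) \<le> 2 * norm (x s - y s) + 4 * \<delta> * (b - a)"
proof -
  define u where "u t = x t - y t" for t
  have u: "(u has_vector_derivative x' t - y' t) (at t within {a..b})" if "t \<in> {a..b}" for t
    unfolding u_def by (intro has_vector_derivative_diff x y that)
  have "continuous_on {a..b} (\<lambda>t. norm (u t))"
    by (intro continuous_on_norm)
       (auto simp: continuous_on_eq_continuous_within intro: has_vector_derivative_continuous u)
  \<comment> \<open>At the maximum the Lipschitz term contributes at most half of the maximum
    itself, because of \<open>L * (b - a) \<le> 1/2\<close>, and can be moved to the left.\<close>
  then obtain t0 where t0: "t0 \<in> {a..b}" "\<And>t. t \<in> {a..b} \<Longrightarrow> norm (u t) \<le> norm (u t0)"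
    using continuous_attains_sup[of "{a..b}" "\<lambda>t. norm (u t)"] st by auto
  have "0 \<le> \<delta>"
    using x'[OF st(1)] norm_ge_zero order_trans by blast
  have "norm (x' t - y' t) \<le> L * norm (u t0) + 2 * \<delta>" if t: "t \<in> {a..b}" for t
  proof -
    have "norm (x' t - y' t) = norm ((x' t - h (x t)) - (y' t - h (y t)) + (h (x t) - h (y t)))"
      by simp
    also have "\<dots> \<le> norm ((x' t - h (x t)) - (y' t - h (y t))) + norm (h (x t) - h (y t))"
      by (rule norm_triangle_ineq)
    also have "\<dots> \<le> norm (x' t - h (x t)) + norm (y' t - h (y t)) + norm (h (x t) - h (y t))"
      by (intro add_right_mono norm_triangle_ineq4)
    also have "norm (h (x t) - h (y t)) \<le> L * norm (u t)"
      unfolding u_def by (rule h[OF B[OF t]])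
    also have "L * norm (u t) \<le> L * norm (u t0)"
      by (rule mult_left_mono[OF t0(2)[OF t] L(1)])
    finally show ?thesis
      using x'[OF t] y'[OF t] by linarith
  qed
  from vector_derivative_bound[OF _ u this t0(1) st(1)]
  have "norm (u t0 - u s) \<le> (L * norm (u t0) + 2 * \<delta>) * \<bar>t0 - s\<bar>"
    by simp
  also have "\<dots> \<le> (L * norm (u t0) + 2 * \<delta>) * (b - a)"
    using t0(1) st(1) L(1) \<open>0 \<le> \<delta>\<close> by (intro mult_left_mono) auto
  also have "\<dots> = (L * (b - a)) * norm (u t0) + 2 * \<delta> * (b - a)"
    by (simp add: algebra_simps)
  also have "\<dots> \<le> 1/2 * norm (u t0) + 2 * \<delta> * (b - a)"
    by (intro add_mono mult_right_mono L(2) order_refl norm_ge_zero)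
  finally have "norm (u t0) \<le> 2 * norm (u s) + 4 * \<delta> * (b - a)"
    using norm_triangle_ineq2[of "u t0" "u s"] by simp
  then show ?thesis
    using t0(2)[OF st(2)] by (simp add: u_def)
qed

text \<open>The weighted square distance \<open>v\<close> is nonincreasing. In contrast to the
  preceding estimate, \<open>T\<close> is not restricted in terms of \<open>L\<close>: in the
  application \<open>L\<close> depends on the two solutions and so cannot be taken into account when
  the step size is fixed.\<close>

lemma solution_unique:
  fixes x y :: "real \<Rightarrow> 'a::euclidean_space"
  assumes x: "\<And>t. t \<in> {0..T} \<Longrightarrow> (x has_vector_derivative f t (x t)) (at t within {0..T})"
    and y: "\<And>t. t \<in> {0..T} \<Longrightarrow> (y has_vector_derivative f t (y t)) (at t within {0..T})"
    and B: "\<And>t. t \<in> {0..T} \<Longrightarrow> x t \<in> B" "\<And>t. t \<in> {0..T} \<Longrightarrow> y t \<in> B"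
    and f: "\<And>t u v. t \<in> {0..T} \<Longrightarrow> u \<in> B \<Longrightarrow> v \<in> B \<Longrightarrow> norm (f t u - f t v) \<le> L * norm (u - v)"
    and "0 \<le> T" "x 0 = y 0"
  shows "x T = y T"
proof -
  define u where "u t = x t - y t" for t
  define v where "v t = exp (- 2 * L * t) * (u t \<bullet> u t)" for t
  have u: "(u has_vector_derivative f t (x t) - f t (y t)) (at t within {0..T})" if "t \<in> {0..T}" for t
    unfolding u_def by (intro has_vector_derivative_diff x y that)
  have contu: "continuous_on {0..T} u"
    by (auto simp: continuous_on_eq_continuous_within intro: has_vector_derivative_continuous u)
  have "v T \<le> v 0"
  proof (rule DERIV_nonpos_imp_decreasing_open[OF \<open>0 \<le> T\<close>])
    show "continuous_on {0..T} v"
      unfolding v_def by (intro continuous_intros contu)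
    fix t assume t: "0 < t" "t < T"
    define w where "w = f t (x t) - f t (y t)"
    have "(u has_derivative (\<lambda>r. r *\<^sub>R w)) (at t)"
      using u[of t] t by (simp add: has_vector_derivative_def at_within_Icc_at w_def)
    then have "((\<lambda>t. u t \<bullet> u t) has_derivative (\<lambda>r. u t \<bullet> (r *\<^sub>R w) + (r *\<^sub>R w) \<bullet> u t)) (at t)"
      by (intro has_derivative_inner)
    then have "((\<lambda>t. u t \<bullet> u t) has_real_derivative 2 * (u t \<bullet> w)) (at t)"
      unfolding has_field_derivative_def
      by (rule has_derivative_eq_rhs) (simp add: fun_eq_iff inner_commute)
    then have der: "(v has_real_derivative exp (- 2 * L * t) * (2 * (u t \<bullet> w) - 2 * L * (u t \<bullet> u t))) (at t)"
      unfolding v_def by (auto intro!: derivative_eq_intros simp: algebra_simps)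
    have "u t \<bullet> w \<le> norm (u t) * norm w"
      by (rule norm_cauchy_schwarz)
    also have "\<dots> \<le> norm (u t) * (L * norm (u t))"
      using t by (intro mult_left_mono) (auto simp: w_def u_def intro!: f B)
    also have "\<dots> = L * (u t \<bullet> u t)"
      by (simp add: power2_norm_eq_inner[symmetric] power2_eq_square)
    finally show "\<exists>d. (v has_real_derivative d) (at t) \<and> d \<le> 0"
      using der by (intro exI[of _ "exp (- 2 * L * t) * (2 * (u t \<bullet> w) - 2 * L * (u t \<bullet> u t))"])
        (auto intro!: mult_nonneg_nonpos)
  qed
  then have "u T \<bullet> u T \<le> 0"
    using \<open>x 0 = y 0\<close> by (simp add: v_def u_def mult_le_0_iff)
  then have "u T = 0"
    using inner_ge_zero[of "u T"] by simp
  then show ?thesis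
    by (simp add: u_def)
qed

text \<open>Successive approximation. With \<open>L * T \<le> 1/2\<close> the increments decay like
  powers of 1/2, and differentiability of the limit follows from uniform convergence of the
  derivatives, so no integral equation has to be passed to the limit.\<close>

lemma solution_exists_Lipschitz:
  fixes g :: "'a::euclidean_space \<Rightarrow> 'a"
  assumes g: "\<And>u v. norm (g u - g v) \<le> L * norm (u - v)"
    and T: "0 \<le> T" "L * T \<le> 1/2" and L: "0 \<le> L"
  shows "\<exists>x. x 0 = \<xi> \<and> (\<forall>t\<in>{0..T}. (x has_vector_derivative g (x t)) (at t within {0..T}))"
proof -
  define X where "X = rec_nat (\<lambda>t::real. \<xi>) (\<lambda>n Y t. \<xi> + integral {0..t} (\<lambda>s. g (Y s)))"
  have X: "X 0 = (\<lambda>t. \<xi>)" "X (Suc n) = (\<lambda>t. \<xi> + integral {0..t} (\<lambda>s. g (X n s)))" for n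
    by (auto simp: X_def)
  have contg: "continuous_on UNIV g"
    by (rule lipschitz_on_continuous_on[of L], rule lipschitz_onI)
       (use g L in \<open>auto simp: dist_norm\<close>)
  have der_if: "(X (Suc n) has_vector_derivative g (X n t)) (at t within {0..T})"
    if "continuous_on {0..T} (X n)" "t \<in> {0..T}" for n t
  proof -
    have "continuous_on {0..T} (\<lambda>s. g (X n s))"
      by (rule continuous_on_compose2[OF contg that(1)]) auto
    from integral_has_vector_derivative[OF this that(2)]
    show ?thesis
      unfolding X by (auto intro!: derivative_eq_intros)
  qed
  have contX: "continuous_on {0..T} (X n)" for n
  proof (induction n)
    case (Suc n)
    show ?case
      using der_if[OF Suc] has_vector_derivative_continuous
      unfolding continuous_on_eq_continuous_within by blast
  qed (simp add: X)
  note der = der_if[OF contX]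
  have X0: "X n 0 = \<xi>" for n
    by (cases n) (auto simp: X)
  define M where "M = norm (g \<xi>) * T"
  have M: "0 \<le> M"
    using T by (simp add: M_def)
  have step: "norm (X (Suc n) t - X n t) \<le> M * (1/2) ^ n" if "t \<in> {0..T}" for n t
    using that
  proof (induction n arbitrary: t)
    case 0
    then show ?case
      using mult_right_mono[of t T "norm (g \<xi>)"] by (simp add: X M_def mult.commute)
  next
    case (Suc n)
    have d: "((\<lambda>t. X (Suc (Suc n)) t - X (Suc n) t) has_vector_derivative g (X (Suc n) t) - g (X n t))
        (at t within {0..T})" if "t \<in> {0..T}" for t
      using that by (intro has_vector_derivative_diff der)
    have b: "norm (g (X (Suc n) t) - g (X n t)) \<le> L * (M * (1/2) ^ n)" if "t \<in> {0..T}" for t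
      by (rule order_trans[OF g mult_left_mono[OF Suc.IH[OF that] L]])
    have "norm ((X (Suc (Suc n)) t - X (Suc n) t) - (X (Suc (Suc n)) 0 - X (Suc n) 0))
        \<le> L * (M * (1/2) ^ n) * \<bar>t - 0\<bar>"
      by (rule vector_derivative_bound[OF _ d b]) (use T Suc.prems in auto)
    also have "\<dots> \<le> L * (M * (1/2) ^ n) * T"
      using Suc.prems M L by (intro mult_left_mono) auto
    also have "\<dots> = (L * T) * (M * (1/2) ^ n)"
      by simp
    also have "\<dots> \<le> 1/2 * (M * (1/2) ^ n)"
      using M by (intro mult_right_mono T) auto
    finally show ?case
      by (simp add: X0)
  qed
  \<comment> \<open>The finite geometric sum is kept in closed form, since the induction on
    \<open>k\<close> would not close with the bound \<open>2 * M * (1/2) ^ n\<close> alone.\<close>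
  have far: "norm (X (n + k) t - X n t) \<le> 2 * M * (1/2) ^ n * (1 - (1/2) ^ k)" if "t \<in> {0..T}" for n k t
  proof (induction k)
    case (Suc k)
    have "norm (X (n + Suc k) t - X n t) \<le> norm (X (Suc (n + k)) t - X (n + k) t) + norm (X (n + k) t - X n t)"
      using norm_triangle_ineq[of "X (Suc (n + k)) t - X (n + k) t" "X (n + k) t - X n t"] by simp
    also have "\<dots> \<le> M * (1/2) ^ (n + k) + 2 * M * (1/2) ^ n * (1 - (1/2) ^ k)"
      by (intro add_mono step that Suc)
    finally show ?case
      by (simp add: power_add algebra_simps)
  qed simp
  have far': "norm (X m t - X n t) \<le> 2 * M * (1/2) ^ n" if "t \<in> {0..T}" "n \<le> m" for n m t
  proof -
    have "2 * M * (1/2) ^ n * (1 - (1/2) ^ (m - n)) \<le> 2 * M * (1/2) ^ n * 1"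
      using M by (intro mult_left_mono) auto
    then show ?thesis
      using far[OF that(1), of n "m - n"] that(2) by simp
  qed
  have small: "(\<lambda>n. c * (1/2) ^ n) \<longlonglongrightarrow> 0" for c :: real
    by (intro tendsto_mult_right_zero LIMSEQ_realpow_zero) auto
  have ex: "\<exists>l. (\<lambda>n. X n t) \<longlonglongrightarrow> l" if t: "t \<in> {0..T}" for t
  proof -
    have "Cauchy (\<lambda>n. X n t)"
      unfolding Cauchy_altdef
    proof (intro allI impI)
      fix e :: real assume "e > 0"
      then obtain N where N: "\<And>n. n \<ge> N \<Longrightarrow> 2 * M * (1/2) ^ n < e"
        using order_tendstoD(2)[OF small, of e "2 * M"] by (auto simp: eventually_sequentially)
      show "\<exists>N. \<forall>m\<ge>N. \<forall>n>m. dist (X m t) (X n t) < e"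
      proof (intro exI[of _ N] allI impI)
        fix m n assume mn: "N \<le> m" "m < n"
        have "dist (X m t) (X n t) \<le> 2 * M * (1/2) ^ m"
          using far'[OF t, of m n] mn by (simp add: dist_norm norm_minus_commute)
        also have "\<dots> < e"
          by (rule N[OF mn(1)])
        finally show "dist (X m t) (X n t) < e" .
      qed
    qed
    then show ?thesis
      using Cauchy_convergent_iff convergent_def by blast
  qed
  define Y where "Y t = lim (\<lambda>n. X n t)" for t
  have Y: "(\<lambda>n. X n t) \<longlonglongrightarrow> Y t" if "t \<in> {0..T}" for t
    using ex[OF that] unfolding Y_def by (simp add: convergent_def convergent_LIMSEQ_iff[symmetric])
  have YX: "norm (Y t - X n t) \<le> 2 * M * (1/2) ^ n" if t: "t \<in> {0..T}" for t n
  proof (rule LIMSEQ_le_const2)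
    show "(\<lambda>m. norm (X m t - X n t)) \<longlonglongrightarrow> norm (Y t - X n t)"
      by (intro tendsto_intros Y t)
    show "\<exists>N. \<forall>m\<ge>N. norm (X m t - X n t) \<le> 2 * M * (1/2) ^ n"
      using far'[OF t] by blast
  qed
  have "\<exists>G. \<forall>t\<in>{0..T}. (\<lambda>n. X (Suc n) t) \<longlonglongrightarrow> G t \<and>
      (G has_derivative (\<lambda>r. r *\<^sub>R g (Y t))) (at t within {0..T})"
  proof (rule has_derivative_sequence)
    show "(X (Suc n) has_derivative (\<lambda>r. r *\<^sub>R g (X n t))) (at t within {0..T})" if "t \<in> {0..T}" for n t
      using der[OF that] by (simp add: has_vector_derivative_def)
    show "(\<lambda>n. X (Suc n) 0) \<longlonglongrightarrow> \<xi>"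
      by (simp add: X0)
    fix e :: real assume "e > 0"
    have "\<forall>\<^sub>F n in sequentially. L * (2 * M) * (1/2) ^ n < e"
      using order_tendstoD(2)[OF small \<open>e > 0\<close>] .
    then show "\<forall>\<^sub>F n in sequentially. \<forall>t\<in>{0..T}. \<forall>r. norm (r *\<^sub>R g (X n t) - r *\<^sub>R g (Y t)) \<le> e * norm r"
    proof eventually_elim
      case (elim n)
      show ?case
      proof (intro ballI allI)
        fix t r assume t: "t \<in> {0..T}"
        have "norm (g (X n t) - g (Y t)) \<le> L * norm (Y t - X n t)"
          using g[of "X n t" "Y t"] by (simp add: norm_minus_commute)
        also have "\<dots> \<le> L * (2 * M * (1/2) ^ n)"
          by (rule mult_left_mono[OF YX[OF t] L])
        also have "\<dots> \<le> e"
          using elim by simp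
        finally have "\<bar>r\<bar> * norm (g (X n t) - g (Y t)) \<le> \<bar>r\<bar> * e"
          by (rule mult_left_mono) simp
        then show "norm (r *\<^sub>R g (X n t) - r *\<^sub>R g (Y t)) \<le> e * norm r"
          by (simp add: scaleR_diff_right[symmetric] mult.commute)
      qed
    qed
  qed (use T in auto)
  then obtain G where G: "\<And>t. t \<in> {0..T} \<Longrightarrow> (\<lambda>n. X (Suc n) t) \<longlonglongrightarrow> G t"
      "\<And>t. t \<in> {0..T} \<Longrightarrow> (G has_derivative (\<lambda>r. r *\<^sub>R g (Y t))) (at t within {0..T})"
    by blast
  have GY: "G t = Y t" if "t \<in> {0..T}" for t
    using LIMSEQ_unique[OF G(1)[OF that] LIMSEQ_Suc[OF Y[OF that]]] .
  have "G 0 = \<xi>"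
    using LIMSEQ_unique[OF G(1)[of 0]] T by (simp add: X0)
  moreover have "(G has_vector_derivative g (G t)) (at t within {0..T})" if "t \<in> {0..T}" for t
    using G(2)[OF that] GY[OF that] by (simp add: has_vector_derivative_def)
  ultimately show ?thesis
    by blast
qed

text \<open>Precomposition with the nearest-point map of the ball of radius \<rho> + 1 makes the
  field globally Lipschitz. For short times the solution moves by at most 1, so it stays in the
  ball, where the modified field is \<open>h\<close>.\<close>

lemma solution_exists_locally:
  fixes h :: "'a::euclidean_space \<Rightarrow> 'a"
  assumes h: "C_class (Suc k) UNIV h" and "0 \<le> \<rho>"
  shows "\<exists>E>0. \<forall>\<epsilon> \<xi>. 0 < \<epsilon> \<and> \<epsilon> \<le> E \<and> norm \<xi> \<le> \<rho> \<longrightarrow>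
    (\<exists>x. x 0 = \<xi> \<and> (\<forall>t\<in>{0..\<epsilon>}. (x has_vector_derivative h (x t)) (at t within {0..\<epsilon>}) \<and> norm (x t) \<le> \<rho> + 1))"
proof -
  define B :: "'a set" where "B = cball 0 (\<rho> + 1)"
  have B: "compact B" "convex B" "closed B" "B \<noteq> {}"
    using \<open>0 \<le> \<rho>\<close> by (auto simp: B_def)
  obtain L where L: "L > 0" "\<And>u v. u \<in> B \<Longrightarrow> v \<in> B \<Longrightarrow> norm (h u - h v) \<le> L * norm (u - v)"
    using C_class_Lipschitz[OF h B(1,2)] by blast
  have "compact (h ` B)"
    by (intro compact_continuous_image B continuous_on_subset[OF C_class_continuous_on[OF h]]) auto
  then obtain M where M: "M > 0" "\<And>u. u \<in> B \<Longrightarrow> norm (h u) \<le> M"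
    using compact_imp_bounded bounded_pos by (metis imageI)
  define g where "g u = h (closest_point B u)" for u
  have cp: "closest_point B u \<in> B" for u
    using closest_point_in_set B by blast
  have g: "norm (g u - g v) \<le> L * norm (u - v)" for u v
  proof -
    have "norm (g u - g v) \<le> L * norm (closest_point B u - closest_point B v)"
      unfolding g_def by (intro L cp)
    also have "\<dots> \<le> L * norm (u - v)"
      using closest_point_lipschitz[OF B(2-4), of u v] L(1) by (simp add: dist_norm)
    finally show ?thesis .
  qed
  have "\<exists>x. x 0 = \<xi> \<and> (\<forall>t\<in>{0..\<epsilon>}. (x has_vector_derivative h (x t)) (at t within {0..\<epsilon>}) \<and> norm (x t) \<le> \<rho> + 1)"
    \<comment> \<open>The bound 1 / (2 L) serves the contraction, and 1 / M limits the displacement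
      to 1.\<close>
    if \<epsilon>: "0 < \<epsilon>" "\<epsilon> \<le> min (1 / (2 * L)) (1 / M)" and \<xi>: "norm \<xi> \<le> \<rho>" for \<epsilon> \<xi>
  proof -
    have "L * \<epsilon> \<le> 1/2" "M * \<epsilon> \<le> 1"
      using \<epsilon> L(1) M(1) by (auto simp: field_simps)
    then obtain x where x: "x 0 = \<xi>" "\<And>t. t \<in> {0..\<epsilon>} \<Longrightarrow> (x has_vector_derivative g (x t)) (at t within {0..\<epsilon>})"
      using solution_exists_Lipschitz[of g L \<epsilon> \<xi>] g \<epsilon> L(1) by auto
    have inB: "x t \<in> B" if t: "t \<in> {0..\<epsilon>}" for t
    proof -
      have "norm (x t - x 0) \<le> M * \<bar>t - 0\<bar>"
        by (rule vector_derivative_bound[OF _ x(2)]) (use t in \<open>auto simp: g_def intro: M(2) cp\<close>)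
      also have "\<dots> \<le> M * \<epsilon>"
        using t M(1) by (intro mult_left_mono) auto
      finally have "norm (x t - \<xi>) \<le> 1"
        using \<open>M * \<epsilon> \<le> 1\<close> x(1) by simp
      then show ?thesis
        using norm_triangle_sub[of "x t" \<xi>] \<xi> by (simp add: B_def)
    qed
    then have "g (x t) = h (x t)" if "t \<in> {0..\<epsilon>}" for t
      using that by (simp add: g_def closest_point_self)
    then show ?thesis
      using x inB by (intro exI[of _ x]) (auto simp: B_def)
  qed
  moreover have "min (1 / (2 * L)) (1 / M) > 0"
    using L(1) M(1) by simp
  ultimately show ?thesis
    by blast
qed

text \<open>Inverts "for each radius, small steps are good" into a radius that depends on the step,
  tends to infinity and is of class C^k. The function \<open>R\<close> is a smoothed staircase: it
  counts the indices \<open>n\<close> with \<epsilon> < \<open>c n\<close>, each with a weight that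
  is switched on smoothly.\<close>

lemma obtain_admissible_radius:
  fixes good :: "real \<Rightarrow> real \<Rightarrow> bool"
  assumes ex: "\<And>\<rho>. \<exists>E>0. \<forall>\<epsilon>. 0 < \<epsilon> \<and> \<epsilon> \<le> E \<longrightarrow> good \<epsilon> \<rho>"
    and mono: "\<And>\<epsilon> \<rho> \<rho>'. good \<epsilon> \<rho> \<Longrightarrow> \<rho>' \<le> \<rho> \<Longrightarrow> good \<epsilon> \<rho>'"
  obtains R e where "C_class k {0<..} R" "e > 0" "\<And>\<epsilon>. 0 < \<epsilon> \<Longrightarrow> \<epsilon> \<le> e \<Longrightarrow> good \<epsilon> (R \<epsilon>)"
    "\<And>K. \<exists>E>0. \<forall>\<epsilon>. 0 < \<epsilon> \<and> \<epsilon> \<le> E \<longrightarrow> K \<le> R \<epsilon>"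
proof -
  \<comment> \<open>Index \<open>n\<close> stands for the radius n + 1: if \<open>n\<close> is the
    largest index counted in \<open>R\<close>, there are at most n + 1 summands, each at most
    1.\<close>
  have "\<forall>n. \<exists>E>0. \<forall>\<epsilon>. 0 < \<epsilon> \<and> \<epsilon> \<le> E \<longrightarrow> good \<epsilon> (real (Suc n))"
    using ex by blast
  from choice[OF this] obtain E where E: "\<And>n. E n > 0" "\<And>n \<epsilon>. 0 < \<epsilon> \<Longrightarrow> \<epsilon> \<le> E n \<Longrightarrow> good \<epsilon> (real (Suc n))"
    by blast
  \<comment> \<open>The minimum over all smaller indices makes the thresholds nonincreasing, and the
    terms 1 / (i + 1) force them to 0, so that only finitely many indices count for a given
    \<epsilon>.\<close>
  define c where "c n = Min ((\<lambda>i. min (E i) (1 / real (Suc i))) ` {..n})" for n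
  have c_pos: "c n > 0" for n
    unfolding c_def using E(1) by (subst Min_gr_iff) auto
  have c_le: "c n \<le> E i" "c n \<le> 1 / real (Suc i)" if "i \<le> n" for n i
  proof -
    have "c n \<le> min (E i) (1 / real (Suc i))"
      unfolding c_def using that by (intro Min_le) auto
    then show "c n \<le> E i" "c n \<le> 1 / real (Suc i)"
      by auto
  qed
  have c_anti: "c n \<le> c i" if "i \<le> n" for n i
    unfolding c_def using that by (intro Min_antimono) auto
  obtain f :: "real \<Rightarrow> real" where f: "C_class k UNIV f" "\<And>s. 0 \<le> f s" "\<And>s. f s \<le> 1"
      "\<And>s. s \<le> 0 \<Longrightarrow> f s = 1" "\<And>s. 1 \<le> s \<Longrightarrow> f s = 0"
    using obtain_cutoff[of k] by metis
  define q where "q n \<epsilon> = f (2 * \<epsilon> / c n - 1)" for n \<epsilon>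
  have q: "0 \<le> q n \<epsilon>" "q n \<epsilon> \<le> 1" for n \<epsilon>
    using f by (auto simp: q_def)
  have q1: "q n \<epsilon> = 1" if "\<epsilon> \<le> c n / 2" for n \<epsilon>
    unfolding q_def using that c_pos[of n] by (intro f(4)) (simp add: field_simps)
  have q0: "q n \<epsilon> = 0" if "c n \<le> \<epsilon>" for n \<epsilon>
    unfolding q_def using that c_pos[of n] by (intro f(5)) (simp add: field_simps)
  define R where "R \<epsilon> = (\<Sum>n | \<epsilon> < c n. q n \<epsilon>)" for \<epsilon>
  have bound: "\<exists>N. {n. \<epsilon> < c n} \<subseteq> {..<N}" if "\<epsilon> > 0" for \<epsilon>
  proof -
    obtain N where N: "inverse (real (Suc N)) < \<epsilon>"
      using reals_Archimedean[OF \<open>\<epsilon> > 0\<close>] by blast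
    have "c n \<le> \<epsilon>" if "N \<le> n" for n
      using c_le(2)[OF that] N by (simp add: inverse_eq_divide)
    then have "{n. \<epsilon> < c n} \<subseteq> {..<N}"
      by (auto simp: not_le[symmetric])
    then show ?thesis ..
  qed
  show thesis
  proof (rule that)
    show "C_class k {0<..} R"
    proof (rule C_class_local)
      fix \<epsilon>0 :: real assume "\<epsilon>0 \<in> {0<..}"
      then obtain N where N: "{n. \<epsilon>0 / 2 < c n} \<subseteq> {..<N}"
        using bound[of "\<epsilon>0 / 2"] by auto
      \<comment> \<open>Local finiteness: for all \<epsilon> above half of the given value the same
        finite range of indices contains every nonzero summand.\<close>
      have "C_class k {\<epsilon>0 / 2<..} (\<lambda>\<epsilon>. \<Sum>n<N. q n \<epsilon>)"
        unfolding q_def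
        by (intro C_class_sum C_class_compose[OF f(1)] C_class_diff C_class_const
            C_class_bounded_linear[OF bounded_linear_divide] C_class_mult C_class_id) auto
      then have "C_class k {\<epsilon>0 / 2<..} R"
      proof (rule C_class_cong)
        fix \<epsilon> assume "\<epsilon> \<in> {\<epsilon>0 / 2<..}"
        then have "{n. \<epsilon> < c n} \<subseteq> {..<N}"
          using N by force
        then show "(\<Sum>n<N. q n \<epsilon>) = R \<epsilon>"
          unfolding R_def by (intro sum.mono_neutral_right) (auto intro: q0)
      qed
      then show "\<exists>U. open U \<and> \<epsilon>0 \<in> U \<and> C_class k U R"
        using \<open>\<epsilon>0 \<in> {0<..}\<close> by (intro exI[of _ "{\<epsilon>0 / 2<..}"]) auto
    qed
    show "c 0 / 2 > 0"
      using c_pos by simp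
    show "good \<epsilon> (R \<epsilon>)" if \<epsilon>: "0 < \<epsilon>" "\<epsilon> \<le> c 0 / 2" for \<epsilon>
    proof -
      let ?A = "{n. \<epsilon> < c n}"
      have fin: "finite ?A"
        using bound[OF \<epsilon>(1)] finite_subset by blast
      have "0 \<in> ?A"
        using \<epsilon> by auto
      then have m: "Max ?A \<in> ?A"
        using fin by (intro Max_in) auto
      have "R \<epsilon> \<le> (\<Sum>n\<in>?A. 1)"
        unfolding R_def by (intro sum_mono q)
      also have "\<dots> \<le> real (Suc (Max ?A))"
      proof -
        have "card ?A \<le> card {..Max ?A}"
          using fin by (intro card_mono) auto
        then show ?thesis
          by simp
      qed
      finally have "R \<epsilon> \<le> real (Suc (Max ?A))" .
      moreover have "good \<epsilon> (real (Suc (Max ?A)))"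
        using m c_le(1)[of "Max ?A" "Max ?A"] \<epsilon>(1) by (intro E(2)) auto
      ultimately show ?thesis
        using mono by blast
    qed
    show "\<exists>E>0. \<forall>\<epsilon>. 0 < \<epsilon> \<and> \<epsilon> \<le> E \<longrightarrow> K \<le> R \<epsilon>" for K
    proof -
      obtain n where n: "K \<le> real n"
        using real_arch_simple by blast
      have "K \<le> R \<epsilon>" if \<epsilon>: "0 < \<epsilon>" "\<epsilon> \<le> c n / 2" for \<epsilon>
      proof -
        have small: "\<epsilon> \<le> c i / 2" if "i \<le> n" for i
          using c_anti[OF that] \<epsilon> by simp
        have "{..n} \<subseteq> {n. \<epsilon> < c n}"
          using small \<epsilon>(1) by force
        moreover have "finite {n. \<epsilon> < c n}"
          using bound[OF \<epsilon>(1)] finite_subset by blast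
        ultimately have "(\<Sum>i\<le>n. q i \<epsilon>) \<le> R \<epsilon>"
          unfolding R_def by (intro sum_mono2) (auto intro: q)
        moreover have "(\<Sum>i\<le>n. q i \<epsilon>) = (\<Sum>i\<le>n. 1)"
          by (intro sum.cong refl q1 small) auto
        ultimately show ?thesis
          using n by simp
      qed
      then show ?thesis
        using c_pos[of n] by (intro exI[of _ "c n / 2"]) auto
    qed
  qed
qed

section \<open>Picard iterates\<close>

text \<open>By the substitution u = s t the expression is the increment of an antiderivative from 0
  to t. The form over [0, 1] also makes sense for negative t, and the choice of \<open>M\<close>
  puts \<open>t\<close> in the interior of the interval.\<close>

lemma scaled_integral_has_vector_derivative:
  fixes g :: "real \<Rightarrow> 'a::banach"
  assumes g: "continuous_on UNIV g"
  shows "((\<lambda>t. t *\<^sub>R integral {0..1} (\<lambda>s. g (s * t))) has_vector_derivative g t) (at t)"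
proof -
  define M where "M = \<bar>t\<bar> + 1"
  obtain \<Phi> where \<Phi>: "\<And>u. u \<in> {-M..M} \<Longrightarrow> (\<Phi> has_vector_derivative g u) (at u within {-M..M})"
    using antiderivative_continuous[of "-M" M g] continuous_on_subset[OF g] by blast
  have eq: "u *\<^sub>R integral {0..1} (\<lambda>s. g (s * u)) = \<Phi> u - \<Phi> 0" if u: "u \<in> {-M<..<M}" for u
  proof -
    have inI: "s * u \<in> {-M..M}" if "s \<in> {0..1}" for s
    proof -
      have "\<bar>s * u\<bar> \<le> 1 * \<bar>u\<bar>"
        unfolding abs_mult using that by (intro mult_right_mono) auto
      then show ?thesis
        using u by auto
    qed
    have "((\<lambda>s. u *\<^sub>R g (s * u)) has_integral \<Phi> (1 * u) - \<Phi> (0 * u)) {0..1}"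
    proof (rule fundamental_theorem_of_calculus)
      fix s :: real assume s: "s \<in> {0..1}"
      have "((\<lambda>s. s * u) has_vector_derivative u) (at s within {0..1})"
        by (auto intro!: derivative_eq_intros)
      moreover have "(\<Phi> has_vector_derivative g (s * u)) (at (s * u) within (\<lambda>s. s * u) ` {0..1})"
        by (rule has_vector_derivative_within_subset[OF \<Phi>]) (use inI s in auto)
      ultimately show "((\<lambda>s. \<Phi> (s * u)) has_vector_derivative u *\<^sub>R g (s * u)) (at s within {0..1})"
        using vector_diff_chain_within[of "\<lambda>s. s * u" u s "{0..1}" \<Phi> "g (s * u)"] by (simp add: o_def)
    qed simp
    from integral_unique[OF this] show ?thesis
      by simp
  qed
  have "-M < t" "t < M"
    by (auto simp: M_def)
  then have "(\<Phi> has_vector_derivative g t) (at t)"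
    using \<Phi>[of t] at_within_Icc_at[of "-M" t M] by simp
  then have "((\<lambda>u. \<Phi> u - \<Phi> 0) has_vector_derivative g t) (at t)"
    by (auto intro!: derivative_eq_intros)
  then show ?thesis
    by (rule has_vector_derivative_transform_within_open[of _ _ _ "{-M<..<M}"])
       (auto simp: eq M_def)
qed

lemma continuous_bounded_on_compact:
  fixes f :: "'a::metric_space \<Rightarrow> 'b::real_normed_vector"
  assumes "continuous_on S f" "compact K" "K \<subseteq> S"
  obtains B where "0 < B" "\<And>x. x \<in> K \<Longrightarrow> norm (f x) \<le> B"
proof -
  have "compact (f ` K)"
    by (rule compact_continuous_image[OF continuous_on_subset[OF assms(1,3)] assms(2)])
  then obtain B where "0 < B" "\<forall>y\<in>f ` K. norm y \<le> B"
    using compact_imp_bounded bounded_pos by metis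
  then show thesis
    using that by simp
qed

lemma C_class_comp2:
  fixes f :: "'x::real_normed_vector \<Rightarrow> 'a::euclidean_space" and g :: "'x \<Rightarrow> 'b::euclidean_space"
  assumes "C_class k (S \<times> T) (\<lambda>(a, b). F a b)" "C_class k X f" "C_class k X g"
    "\<And>x. x \<in> X \<Longrightarrow> f x \<in> S" "\<And>x. x \<in> X \<Longrightarrow> g x \<in> T"
  shows "C_class k X (\<lambda>x. F (f x) (g x))"
  using C_class_compose[OF assms(1) C_class_Pair[OF assms(2,3)]] assms(4,5) by auto

lemma C_class_comp3:
  fixes f :: "'x::real_normed_vector \<Rightarrow> 'a::euclidean_space" and g :: "'x \<Rightarrow> 'b::euclidean_space"
    and h :: "'x \<Rightarrow> 'c::euclidean_space"
  assumes "C_class k (S \<times> T \<times> U) (\<lambda>(a, b, c). F a b c)" "C_class k X f" "C_class k X g" "C_class k X h"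
    "\<And>x. x \<in> X \<Longrightarrow> f x \<in> S" "\<And>x. x \<in> X \<Longrightarrow> g x \<in> T" "\<And>x. x \<in> X \<Longrightarrow> h x \<in> U"
  shows "C_class k X (\<lambda>x. F (f x) (g x) (h x))"
  using C_class_compose[OF assms(1) C_class_Pair[OF assms(2) C_class_Pair[OF assms(3,4)]]] assms(5-7)
  by auto

text \<open>The usual integral from 0 to t is rescaled to [0, 1]. Thus negative times are covered,
  which the branch running backwards from the end of the step needs, and the domain of integration
  is fixed, so parameters occur in the integrand only.\<close>

primrec picard :: "('a::euclidean_space \<Rightarrow> 'a) \<Rightarrow> nat \<Rightarrow> real \<Rightarrow> 'a \<Rightarrow> 'a" where
  "picard h 0 t x = x"
| "picard h (Suc j) t x = x + t *\<^sub>R integral {0..1} (\<lambda>s. h (picard h j (s * t) x))"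

lemma picard_0 [simp]: "picard h j 0 x = x"
  by (cases j) auto

lemma C_class_picard:
  assumes "C_class k UNIV h"
  shows "C_class k UNIV (\<lambda>(t, x). picard h j t x)"
proof (induction j)
  case 0
  show ?case
    unfolding case_prod_unfold picard.simps by (rule C_class_snd[OF C_class_id])
next
  case (Suc j)
  have "C_class k UNIV (\<lambda>z. h (picard h j (fst z * fst (snd z)) (snd (snd z))))"
    by (rule C_class_compose[OF assms]; (rule C_class_comp2[of k UNIV UNIV "picard h j"])?)
       (auto simp: Suc intro!: C_class_mult C_class_fst C_class_snd C_class_id)
  from C_class_integral_param[OF this]
  show ?case
    unfolding case_prod_unfold picard.simps
    by (intro C_class_add C_class_scaleR C_class_fst C_class_snd C_class_id) simp
qed

lemma continuous_on_picard:
  assumes "continuous_on UNIV h" "continuous_on X f" "continuous_on X g"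
  shows "continuous_on X (\<lambda>z. picard h j (f z) (g z))"
proof -
  have "continuous_on UNIV (\<lambda>(t, x). picard h j t x)"
    using C_class_picard[of 0 h j] assms(1) by simp
  from continuous_on_compose2[OF this continuous_on_Pair[OF assms(2,3)]] show ?thesis
    by simp
qed

lemma picard_has_vector_derivative:
  assumes "continuous_on UNIV h"
  shows "((\<lambda>t. picard h (Suc j) t x) has_vector_derivative h (picard h j t x)) (at t)"
proof -
  have "continuous_on UNIV (\<lambda>t. h (picard h j t x))"
    by (rule continuous_on_compose2[OF assms continuous_on_picard[OF assms]])
       (auto intro!: continuous_intros)
  from has_vector_derivative_add[OF has_vector_derivative_const scaled_integral_has_vector_derivative[OF this]]
  show ?thesis
    by simp
qed

lemma picard_bounded:
  assumes "continuous_on UNIV h"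
  obtains B where "0 < B" "\<And>j t x. j \<le> n \<Longrightarrow> \<bar>t\<bar> \<le> T \<Longrightarrow> norm x \<le> \<rho> \<Longrightarrow> norm (picard h j t x) \<le> B"
proof -
  have "\<forall>j. \<exists>B. 0 < B \<and> (\<forall>z\<in>{-T..T} \<times> cball 0 \<rho>. norm (picard h j (fst z) (snd z)) \<le> B)"
  proof
    fix j
    have "continuous_on UNIV (\<lambda>z. picard h j (fst z) (snd z))"
      by (rule continuous_on_picard[OF assms]) (auto intro!: continuous_intros)
    then obtain B where "0 < B" "\<And>z. z \<in> {-T..T} \<times> cball 0 \<rho> \<Longrightarrow> norm (picard h j (fst z) (snd z)) \<le> B"
      by (rule continuous_bounded_on_compact[of UNIV _ "{-T..T} \<times> cball 0 \<rho>"])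
         (auto intro!: compact_Times)
    then show "\<exists>B. 0 < B \<and> (\<forall>z\<in>{-T..T} \<times> cball 0 \<rho>. norm (picard h j (fst z) (snd z)) \<le> B)"
      by blast
  qed
  from choice[OF this] obtain B where
    B: "\<forall>j. 0 < B j \<and> (\<forall>z\<in>{-T..T} \<times> cball 0 \<rho>. norm (picard h j (fst z) (snd z)) \<le> B j)" ..
  have le: "B j \<le> (\<Sum>j\<le>n. B j)" if "j \<le> n" for j
    using that B by (intro member_le_sum) (auto intro: less_imp_le)
  show thesis
  proof (rule that)
    show "0 < (\<Sum>j\<le>n. B j)"
      using B by (intro sum_pos) auto
    fix j t and x :: 'a assume j: "j \<le> n" and "\<bar>t\<bar> \<le> T" "norm x \<le> \<rho>"
    then have "(t, x) \<in> {-T..T} \<times> cball 0 \<rho>"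
      by auto
    then have "norm (picard h j t x) \<le> B j"
      using B by fastforce
    then show "norm (picard h j t x) \<le> (\<Sum>j\<le>n. B j)"
      using le[OF j] by simp
  qed
qed

text \<open>Each further iterate gains a power of t: the Lipschitz bound of \<open>h\<close> on a
  ball containing the iterates involved passes on the previous power, and the factor t before the
  integral adds one.\<close>

lemma picard_step_bound:
  assumes h: "C_class (Suc k) UNIV h"
  shows "\<exists>C\<ge>0. \<forall>t x. \<bar>t\<bar> \<le> T \<and> norm x \<le> \<rho> \<longrightarrow>
    norm (picard h (Suc j) t x - picard h j t x) \<le> C * \<bar>t\<bar> ^ Suc j"
proof (induction j)
  case 0
  obtain B where B: "0 < B" "\<And>x. x \<in> cball 0 \<rho> \<Longrightarrow> norm (h x) \<le> B"
    by (rule continuous_bounded_on_compact[OF C_class_continuous_on[OF h] compact_cball[of 0 \<rho>]]) auto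
  have "norm (picard h (Suc 0) t x - picard h 0 t x) \<le> B * \<bar>t\<bar> ^ Suc 0" if "norm x \<le> \<rho>" for t x
    using mult_right_mono[OF B(2)[of x], of "\<bar>t\<bar>"] that by (simp add: mult.commute)
  then show ?case
    using B(1) by (intro exI[of _ B]) auto
next
  case (Suc j)
  then obtain C where C: "C \<ge> 0" "\<And>t x. \<bar>t\<bar> \<le> T \<Longrightarrow> norm x \<le> \<rho> \<Longrightarrow>
      norm (picard h (Suc j) t x - picard h j t x) \<le> C * \<bar>t\<bar> ^ Suc j"
    by blast
  have conth: "continuous_on UNIV h"
    by (rule C_class_continuous_on[OF h])
  obtain B where B: "0 < B" "\<And>i t x. i \<le> Suc j \<Longrightarrow> \<bar>t\<bar> \<le> T \<Longrightarrow> norm x \<le> \<rho> \<Longrightarrow> norm (picard h i t x) \<le> B"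
    using picard_bounded[OF conth] by metis
  obtain L where L: "L > 0" "\<And>x y. x \<in> cball 0 B \<Longrightarrow> y \<in> cball 0 B \<Longrightarrow> norm (h x - h y) \<le> L * norm (x - y)"
    using C_class_Lipschitz[OF h, of "cball 0 B"] by auto
  have "norm (picard h (Suc (Suc j)) t x - picard h (Suc j) t x) \<le> (L * C) * \<bar>t\<bar> ^ Suc (Suc j)"
    if t: "\<bar>t\<bar> \<le> T" and x: "norm x \<le> \<rho>" for t x
  proof -
    define D where "D s = h (picard h (Suc j) (s * t) x) - h (picard h j (s * t) x)" for s
    have cont: "continuous_on {0..1} (\<lambda>s. h (picard h i (s * t) x))" for i
      by (rule continuous_on_compose2[OF conth continuous_on_picard[OF conth]])
         (auto intro!: continuous_intros)
    have "norm (D s) \<le> L * C * \<bar>t\<bar> ^ Suc j" if s: "s \<in> {0..1}" for s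
    proof -
      have st: "\<bar>s * t\<bar> \<le> \<bar>t\<bar>"
        unfolding abs_mult using s by (intro mult_left_le_one_le) auto
      then have sT: "\<bar>s * t\<bar> \<le> T"
        using t by simp
      have "norm (D s) \<le> L * norm (picard h (Suc j) (s * t) x - picard h j (s * t) x)"
        unfolding D_def by (rule L(2)) (auto simp del: picard.simps intro!: B(2) sT x)
      also have "\<dots> \<le> L * (C * \<bar>s * t\<bar> ^ Suc j)"
        using L(1) by (intro mult_left_mono C(2) sT x) auto
      also have "\<dots> \<le> L * (C * \<bar>t\<bar> ^ Suc j)"
        using L(1) C(1) st by (intro mult_left_mono power_mono) auto
      finally show ?thesis
        by (simp add: mult.assoc)
    qed
    then have "norm (integral {0..1} D) \<le> L * C * \<bar>t\<bar> ^ Suc j * (1 - 0)"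
      by (intro integral_bound) (auto simp: D_def[abs_def] simp del: picard.simps intro!: continuous_on_diff cont)
    moreover have "picard h (Suc (Suc j)) t x - picard h (Suc j) t x = t *\<^sub>R integral {0..1} D"
    proof -
      have "integral {0..1} D = integral {0..1} (\<lambda>s. h (picard h (Suc j) (s * t) x))
          - integral {0..1} (\<lambda>s. h (picard h j (s * t) x))"
        unfolding D_def by (intro integral_diff integrable_continuous_real cont)
      then show ?thesis
        by (simp only: picard.simps(2)[of h "Suc j"] picard.simps(2)[of h j t x])
           (simp add: scaleR_diff_right)
    qed
    ultimately show ?thesis
      using mult_left_mono[of "norm (integral {0..1} D)" "L * C * \<bar>t\<bar> ^ Suc j" "\<bar>t\<bar>"]
      by (simp add: mult_ac)
  qed
  then show ?case
    using L(1) C(1) by (intro exI[of _ "L * C"]) auto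
qed

text \<open>The iterates move only along values of \<open>h\<close>, so whatever annihilates those
  annihilates the displacement. With the complement of a projection as \<open>T\<close> this
  expresses that iterates respect the constraints.\<close>

lemma linear_picard_diff_eq_0:
  fixes T :: "'a::euclidean_space \<Rightarrow> 'b::euclidean_space"
  assumes T: "linear T" "\<And>x. T (h x) = 0" and h: "continuous_on UNIV h"
  shows "T (picard h j t x - x) = 0"
proof (cases j)
  case 0
  then show ?thesis
    using T(1) by (simp add: linear_0)
next
  case (Suc i)
  have "continuous_on {0..1} (\<lambda>s. h (picard h i (s * t) x))"
    by (rule continuous_on_compose2[OF h continuous_on_picard[OF h]]) (auto intro!: continuous_intros)
  then have "(\<lambda>s. h (picard h i (s * t) x)) integrable_on {0..1}"
    by (rule integrable_continuous_real)
  from integral_linear[OF this linear_conv_bounded_linear[THEN iffD1, OF T(1)]]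
  have "T (integral {0..1} (\<lambda>s. h (picard h i (s * t) x))) = 0"
    by (simp add: o_def T(2))
  then show ?thesis
    using T(1) Suc by (simp add: linear_cmul)
qed

section \<open>Interpolation between the flow and the scheme\<close>

text \<open>The problem without constraints. The numbers are shifted: the class is
  \<open>Suc q\<close> and the order is \<open>Suc p\<close>, so both are at least 1 and the final
  iterate \<open>Q\<close> has a predecessor \<open>P\<close> that governs its velocity. The
  consistency constant may depend on the ball.\<close>

locale one_step_scheme =
  fixes h :: "'a::euclidean_space \<Rightarrow> 'a" and \<phi> :: "real \<Rightarrow> 'a \<Rightarrow> 'a" and e0 :: real and q p :: nat
  assumes h: "C_class (Suc q) UNIV h"
    and \<phi>: "C_class (Suc q) ({0..e0} \<times> UNIV) (\<lambda>(\<epsilon>, x). \<phi> \<epsilon> x)"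
    and e0: "e0 > 0"
    and consistent: "\<And>\<rho>. \<exists>C. \<forall>\<epsilon> \<xi> x. 0 < \<epsilon> \<and> \<epsilon> \<le> e0 \<and> norm \<xi> \<le> \<rho> \<and> x 0 = \<xi> \<and>
        (\<forall>t\<in>{0..\<epsilon>}. (x has_vector_derivative h (x t)) (at t within {0..\<epsilon>})) \<longrightarrow>
        norm (\<phi> \<epsilon> \<xi> - x \<epsilon>) \<le> C * \<epsilon> ^ (Suc p + 1)"
begin

abbreviation P where "P \<equiv> picard h p"
abbreviation Q where "Q \<equiv> picard h (Suc p)"

lemma cont_h: "continuous_on UNIV h"
  by (rule C_class_continuous_on[OF h])

lemma cont_\<phi>: "continuous_on ({0..e0} \<times> UNIV) (\<lambda>z. \<phi> (fst z) (snd z))"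
  using C_class_continuous_on[OF \<phi>] by (simp add: case_prod_unfold)

lemma Q_derivative: "((\<lambda>t. Q t x) has_vector_derivative h (P t x)) (at t)"
  by (rule picard_has_vector_derivative[OF cont_h])

lemma Q_shifted_derivative: "((\<lambda>t. Q (t - c) x) has_vector_derivative h (P (t - c) x)) (at t within S)"
proof -
  have "((\<lambda>t. t - c) has_vector_derivative 1) (at t within S)"
    by (auto intro!: derivative_eq_intros)
  from vector_diff_chain_within[OF this has_vector_derivative_at_within[OF Q_derivative]]
  show ?thesis
    by (simp add: o_def del: picard.simps)
qed

text \<open>Since the velocity of \<open>Q\<close> is \<open>h\<close> at \<open>P\<close>, the
  defect of \<open>Q\<close> as an approximate solution is the difference of \<open>h\<close> at
  \<open>P\<close> and at \<open>Q\<close>; this bound gives its order.\<close>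

lemma P_near_Q:
  obtains C where "C \<ge> 0" "\<And>t x. \<bar>t\<bar> \<le> e0 \<Longrightarrow> norm x \<le> \<rho> \<Longrightarrow> norm (P t x - Q t x) \<le> C * \<bar>t\<bar> ^ Suc p"
  using picard_step_bound[OF h, of e0 \<rho> p] by (metis norm_minus_commute)

text \<open>The comparison goes through an exact solution, which exists up to time \<epsilon> for
  small steps. It has defect 0 and \<open>Q\<close> has a defect of order \<open>Suc p\<close>; the
  length \<epsilon> of the interval contributes the remaining power.\<close>

lemma phi_near_Q:
  assumes "\<rho> \<ge> 0"
  shows "\<exists>C\<ge>0. \<exists>E>0. E \<le> e0 \<and>
    (\<forall>\<epsilon> \<xi>. 0 < \<epsilon> \<and> \<epsilon> \<le> E \<and> norm \<xi> \<le> \<rho> \<longrightarrow> norm (\<phi> \<epsilon> \<xi> - Q \<epsilon> \<xi>) \<le> C * \<epsilon> ^ Suc (Suc p))"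
proof -
  obtain C0 where C0: "\<And>\<epsilon> \<xi> x. 0 < \<epsilon> \<Longrightarrow> \<epsilon> \<le> e0 \<Longrightarrow> norm \<xi> \<le> \<rho> \<Longrightarrow> x 0 = \<xi> \<Longrightarrow>
      (\<And>t. t \<in> {0..\<epsilon>} \<Longrightarrow> (x has_vector_derivative h (x t)) (at t within {0..\<epsilon>})) \<Longrightarrow>
      norm (\<phi> \<epsilon> \<xi> - x \<epsilon>) \<le> C0 * \<epsilon> ^ (Suc p + 1)"
    using consistent[of \<rho>] by blast
  obtain E1 where E1: "E1 > 0" "\<And>\<epsilon> \<xi>. 0 < \<epsilon> \<Longrightarrow> \<epsilon> \<le> E1 \<Longrightarrow> norm \<xi> \<le> \<rho> \<Longrightarrow>
      \<exists>x. x 0 = \<xi> \<and> (\<forall>t\<in>{0..\<epsilon>}. (x has_vector_derivative h (x t)) (at t within {0..\<epsilon>}) \<and> norm (x t) \<le> \<rho> + 1)"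
    using solution_exists_locally[OF h assms] by blast
  obtain C1 where C1: "C1 \<ge> 0"
      "\<And>t x. \<bar>t\<bar> \<le> e0 \<Longrightarrow> norm x \<le> \<rho> \<Longrightarrow> norm (P t x - Q t x) \<le> C1 * \<bar>t\<bar> ^ Suc p"
    using P_near_Q by metis
  obtain B0 where B0: "0 < B0" "\<And>j t x. j \<le> Suc p \<Longrightarrow> \<bar>t\<bar> \<le> e0 \<Longrightarrow> norm x \<le> \<rho> \<Longrightarrow> norm (picard h j t x) \<le> B0"
    using picard_bounded[OF cont_h] by metis
  \<comment> \<open>The ball has to contain both the iterates, bounded by \<open>B0\<close>, and the
    exact solution, bounded by \<rho> + 1.\<close>
  define B :: "'a set" where "B = cball 0 (max B0 (\<rho> + 1))"
  obtain L where L: "L > 0" "\<And>u v. u \<in> B \<Longrightarrow> v \<in> B \<Longrightarrow> norm (h u - h v) \<le> L * norm (u - v)"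
    using C_class_Lipschitz[OF h, of B] by (auto simp: B_def)
  define E where "E = min (min E1 e0) (1 / (2 * L))"
  have E: "E > 0" "E \<le> E1" "E \<le> e0" "E \<le> 1 / (2 * L)"
    using E1(1) e0 L(1) by (auto simp: E_def)
  have "norm (\<phi> \<epsilon> \<xi> - Q \<epsilon> \<xi>) \<le> (\<bar>C0\<bar> + 4 * (L * C1)) * \<epsilon> ^ Suc (Suc p)"
    if \<epsilon>: "0 < \<epsilon>" "\<epsilon> \<le> E" and \<xi>: "norm \<xi> \<le> \<rho>" for \<epsilon> \<xi>
  proof -
    obtain x where x: "x 0 = \<xi>" "\<And>t. t \<in> {0..\<epsilon>} \<Longrightarrow> (x has_vector_derivative h (x t)) (at t within {0..\<epsilon>})"
        "\<And>t. t \<in> {0..\<epsilon>} \<Longrightarrow> norm (x t) \<le> \<rho> + 1"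
      using E1(2)[of \<epsilon> \<xi>] \<epsilon> \<xi> E by auto
    have QB: "picard h j t \<xi> \<in> B" if "j \<le> Suc p" "t \<in> {0..\<epsilon>}" for j t
      using B0(2)[of j t \<xi>] that \<epsilon> \<xi> E(3) by (auto simp: B_def)
    define \<delta> where "\<delta> = L * C1 * \<epsilon> ^ Suc p"
    have \<delta>: "0 \<le> \<delta>"
      using L(1) C1(1) \<epsilon> by (simp add: \<delta>_def)
    have "norm (x \<epsilon> - Q \<epsilon> \<xi>) \<le> 2 * norm (x 0 - Q 0 \<xi>) + 4 * \<delta> * (\<epsilon> - 0)"
    proof (rule approximate_solutions_close[where B = B and L = L and h = h])
      show "((\<lambda>t. Q t \<xi>) has_vector_derivative h (P t \<xi>)) (at t within {0..\<epsilon>})" for t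
        by (rule has_vector_derivative_at_within[OF Q_derivative])
      show "norm (h (P t \<xi>) - h (Q t \<xi>)) \<le> \<delta>" if t: "t \<in> {0..\<epsilon>}" for t
      proof -
        have "norm (h (P t \<xi>) - h (Q t \<xi>)) \<le> L * norm (P t \<xi> - Q t \<xi>)"
          by (intro L(2) QB t) auto
        also have "\<dots> \<le> L * (C1 * \<bar>t\<bar> ^ Suc p)"
          using L(1) t \<epsilon> E(3) \<xi> by (intro mult_left_mono C1(2)) auto
        also have "\<dots> \<le> \<delta>"
          unfolding \<delta>_def mult.assoc using L(1) C1(1) t by (intro mult_left_mono power_mono) auto
        finally show ?thesis .
      qed
      show "L * (\<epsilon> - 0) \<le> 1/2"
        using mult_left_mono[OF order_trans[OF \<epsilon>(2) E(4)], of L] L(1) by simp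
      show "x t \<in> B" if "t \<in> {0..\<epsilon>}" for t
        using x(3)[OF that] by (auto simp: B_def)
      show "norm (h (x t) - h (x t)) \<le> \<delta>" for t
        using \<delta> by simp
    qed (use x(2) L \<epsilon> QB[of "Suc p"] in \<open>auto simp del: picard.simps\<close>)
    then have "norm (x \<epsilon> - Q \<epsilon> \<xi>) \<le> 4 * \<delta> * \<epsilon>"
      by (simp add: x(1) del: picard.simps(2))
    moreover have "norm (\<phi> \<epsilon> \<xi> - x \<epsilon>) \<le> C0 * \<epsilon> ^ (Suc p + 1)"
      by (rule C0[OF _ _ _ x(1,2)]) (use \<epsilon> \<xi> E in auto)
    moreover have "C0 * \<epsilon> ^ (Suc p + 1) \<le> \<bar>C0\<bar> * \<epsilon> ^ Suc (Suc p)"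
      using \<epsilon> by (simp add: mult_right_mono)
    ultimately show ?thesis
      using norm_triangle_ineq[of "\<phi> \<epsilon> \<xi> - x \<epsilon>" "x \<epsilon> - Q \<epsilon> \<xi>"]
      by (simp add: \<delta>_def algebra_simps del: picard.simps)
  qed
  then show ?thesis
    using E C1(1) L(1) by (intro exI[of _ "\<bar>C0\<bar> + 4 * (L * C1)"] exI[of _ E] conjI) auto
qed

text \<open>Consistency concerns positive steps only; the value at step 0 is recovered by continuity
  of the scheme on the closed interval of steps.\<close>

lemma phi_0: "\<phi> 0 \<xi> = \<xi>"
proof -
  obtain C E where CE: "C \<ge> 0" "E > 0" "E \<le> e0"
      "\<And>\<epsilon>. 0 < \<epsilon> \<Longrightarrow> \<epsilon> \<le> E \<Longrightarrow> norm (\<phi> \<epsilon> \<xi> - Q \<epsilon> \<xi>) \<le> C * \<epsilon> ^ Suc (Suc p)"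
    using phi_near_Q[of "norm \<xi>"] by auto
  let ?F = "at 0 within {0..E}"
  have cont: "continuous_on {0..E} (\<lambda>\<epsilon>. \<phi> \<epsilon> \<xi> - Q \<epsilon> \<xi>)"
    by (intro continuous_intros continuous_on_picard cont_h
        continuous_on_compose2[OF cont_\<phi>, where f = "\<lambda>\<epsilon>. (\<epsilon>, \<xi>)", simplified])
       (use CE in auto)
  then have 1: "((\<lambda>\<epsilon>. \<phi> \<epsilon> \<xi> - Q \<epsilon> \<xi>) \<longlongrightarrow> \<phi> 0 \<xi> - Q 0 \<xi>) ?F"
    using CE(2) bspec[OF cont[unfolded continuous_on_def], of 0] by (simp del: picard.simps)
  have "((\<lambda>\<epsilon>::real. C * \<epsilon> ^ Suc (Suc p)) \<longlongrightarrow> C * 0 ^ Suc (Suc p)) ?F"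
    by (intro tendsto_intros)
  then have "((\<lambda>\<epsilon>::real. C * \<epsilon> ^ Suc (Suc p)) \<longlongrightarrow> 0) ?F"
    by simp
  note lim = this
  have "\<forall>\<^sub>F \<epsilon> in ?F. norm (\<phi> \<epsilon> \<xi> - Q \<epsilon> \<xi>) \<le> C * \<epsilon> ^ Suc (Suc p)"
    using CE(4) by (auto simp: eventually_at_filter simp del: picard.simps power_Suc intro!: always_eventually)
  from Lim_null_comparison[OF this lim]
  have 2: "((\<lambda>\<epsilon>. \<phi> \<epsilon> \<xi> - Q \<epsilon> \<xi>) \<longlongrightarrow> 0) ?F" .
  have "?F \<noteq> bot"
    using CE(2) by (simp add: at_within_Icc_at_right)
  from tendsto_unique[OF this 1 2] show ?thesis
    by simp
qed

end

text \<open>The derivative \<open>f'\<close> must also be of class \<open>Suc q\<close>, because it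
  enters the velocity of the interpolated path.\<close>

locale interpolated_scheme = one_step_scheme +
  fixes f f' :: "real \<Rightarrow> real" and Lf :: real
  assumes f: "C_class (Suc q) UNIV f" "\<And>s. 0 \<le> f s" "\<And>s. f s \<le> 1" "\<And>s. s \<le> 0 \<Longrightarrow> f s = 1"
      "\<And>s. 1 \<le> s \<Longrightarrow> f s = 0" "\<And>s. (f has_real_derivative f' s) (at s)" "C_class (Suc q) UNIV f'"
    and Lf: "Lf > 0" "\<And>s t. \<bar>f s - f t\<bar> \<le> Lf * \<bar>s - t\<bar>"
begin

text \<open>The transition takes place between 1/4 and 3/4. The margins of width 1/4 at both ends
  are where neighbouring periods will overlap.\<close>

definition \<theta> where "\<theta> \<tau> = 1 - f (2 * \<tau> - 1/2)"
definition \<theta>' where "\<theta>' \<tau> = - 2 * f' (2 * \<tau> - 1/2)"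

lemma \<theta>: "0 \<le> \<theta> \<tau>" "\<theta> \<tau> \<le> 1" "\<tau> \<le> 1/4 \<Longrightarrow> \<theta> \<tau> = 0" "3/4 \<le> \<tau> \<Longrightarrow> \<theta> \<tau> = 1"
  using f(2,3) by (auto simp: \<theta>_def f(4,5))

lemma \<theta>_derivative: "(\<theta> has_real_derivative \<theta>' \<tau>) (at \<tau>)"
  unfolding \<theta>_def[abs_def] \<theta>'_def
  by (auto intro!: derivative_eq_intros DERIV_chain2[OF f(6)])

lemma C_\<theta>: "C_class (Suc q) UNIV \<theta>" "C_class (Suc q) UNIV \<theta>'"
  unfolding \<theta>_def[abs_def] \<theta>'_def[abs_def]
  by (intro C_class_diff C_class_const C_class_mult C_class_id C_class_compose[OF f(1)] C_class_compose[OF f(7)]; simp)+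

lemma \<theta>'_eq_0: "\<tau> < 1/4 \<or> 3/4 < \<tau> \<Longrightarrow> \<theta>' \<tau> = 0"
proof -
  have *: "\<theta>' \<tau> = 0" if "open S" "\<tau> \<in> S" "\<And>s. s \<in> S \<Longrightarrow> \<theta> s = c" for S c
  proof -
    have "((\<lambda>s. c) has_real_derivative \<theta>' \<tau>) (at \<tau>)"
      by (rule has_field_derivative_transform_within_open[OF \<theta>_derivative that(1,2)]) (use that(3) in auto)
    then show ?thesis
      using DERIV_const DERIV_unique by blast
  qed
  assume "\<tau> < 1/4 \<or> 3/4 < \<tau>"
  then show ?thesis
    using *[of "{..<1/4}" 0] *[of "{3/4<..}" 1] \<theta>(3,4) by auto
qed

text \<open>\<open>W \<epsilon> \<tau>\<close> is \<open>\<Psi> (\<epsilon> \<tau>)\<close> and \<open>Z \<epsilon> \<tau>\<close> is its derivative in \<open>t = \<epsilon> \<tau>\<close>.\<close>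

definition W where
  "W \<epsilon> \<tau> x = (1 - \<theta> \<tau>) *\<^sub>R Q (\<epsilon> * \<tau>) x + \<theta> \<tau> *\<^sub>R Q (\<epsilon> * (\<tau> - 1)) (\<phi> \<epsilon> x)"

definition Z where
  "Z \<epsilon> \<tau> x = (1 - \<theta> \<tau>) *\<^sub>R h (P (\<epsilon> * \<tau>) x) + \<theta> \<tau> *\<^sub>R h (P (\<epsilon> * (\<tau> - 1)) (\<phi> \<epsilon> x))
     + (\<theta>' \<tau> / \<epsilon>) *\<^sub>R (Q (\<epsilon> * (\<tau> - 1)) (\<phi> \<epsilon> x) - Q (\<epsilon> * \<tau>) x)"

lemma C_picard_comp:
  assumes "C_class (Suc q) X u" "C_class (Suc q) X v"
  shows "C_class (Suc q) X (\<lambda>z. picard h j (u z) (v z))"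
  using C_class_comp2[of "Suc q" UNIV UNIV "picard h j" X u v] C_class_picard[OF h] assms by simp

lemma C_\<phi>_comp:
  assumes "C_class (Suc q) X u" "C_class (Suc q) X v" "\<And>z. z \<in> X \<Longrightarrow> u z \<in> {0..e0}"
  shows "C_class (Suc q) X (\<lambda>z. \<phi> (u z) (v z))"
  using C_class_comp2[OF \<phi> assms(1,2)] assms(3) by simp

lemma C_W: "C_class (Suc q) ({0..e0} \<times> UNIV \<times> UNIV) (\<lambda>(\<epsilon>, \<tau>, x). W \<epsilon> \<tau> x)"
  unfolding W_def case_prod_unfold
  by (intro C_class_add C_class_scaleR C_class_diff C_class_const C_class_compose[OF C_\<theta>(1)]
      C_picard_comp C_\<phi>_comp C_class_mult C_class_fst C_class_snd C_class_id) auto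

lemma C_Z: "C_class (Suc q) ({0<..e0} \<times> UNIV \<times> UNIV) (\<lambda>(\<epsilon>, \<tau>, x). Z \<epsilon> \<tau> x)"
  unfolding Z_def case_prod_unfold divide_inverse
  by (intro C_class_add C_class_scaleR C_class_diff C_class_const C_class_compose[OF C_\<theta>(1)]
      C_class_compose[OF C_\<theta>(2)] C_class_compose[OF C_class_real_inverse] C_class_compose[OF h]
      C_picard_comp C_\<phi>_comp C_class_mult C_class_fst C_class_snd C_class_id) auto

lemma W_0 [simp]: "W 0 \<tau> x = x"
  by (simp add: W_def phi_0 scaleR_left_diff_distrib del: picard.simps)

lemma W_1 [simp]: "W \<epsilon> 1 x = \<phi> \<epsilon> x"
  using \<theta>(4)[of 1] by (simp add: W_def del: picard.simps)

lemma W_initial [simp]: "W \<epsilon> 0 x = x"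
  using \<theta>(3)[of 0] by (simp add: W_def del: picard.simps)

text \<open>The weight \<theta> is 0 at \<tau> and 1 at \<tau> + 1, so both sides are the single
  term \<open>Q (\<epsilon> * \<tau>) (\<phi> \<epsilon> x)\<close>.\<close>

lemma W_glue:
  assumes "\<bar>\<tau>\<bar> < 1/4"
  shows "W \<epsilon> (\<tau> + 1) x = W \<epsilon> \<tau> (\<phi> \<epsilon> x)"
proof -
  have "\<tau> < 1/4" "- 1/4 < \<tau>"
    using assms by auto
  then show ?thesis
    using \<theta>(3)[of \<tau>] \<theta>(4)[of "\<tau> + 1"] by (simp add: W_def del: picard.simps)
qed

lemma Z_glue:
  assumes "\<bar>\<tau>\<bar> < 1/4"
  shows "Z \<epsilon> (\<tau> + 1) x = Z \<epsilon> \<tau> (\<phi> \<epsilon> x)"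
proof -
  have "\<tau> < 1/4" "- 1/4 < \<tau>"
    using assms by auto
  then show ?thesis
    using \<theta>(3)[of \<tau>] \<theta>(4)[of "\<tau> + 1"] \<theta>'_eq_0[of \<tau>] \<theta>'_eq_0[of "\<tau> + 1"]
    by (simp add: Z_def del: picard.simps)
qed

lemma W_derivative:
  assumes "0 < \<epsilon>"
  shows "((\<lambda>t. W \<epsilon> (t / \<epsilon>) x) has_vector_derivative Z \<epsilon> (t / \<epsilon>) x) (at t within S)"
proof -
  have \<theta>d: "((\<lambda>t. \<theta> (t / \<epsilon>)) has_real_derivative \<theta>' (t / \<epsilon>) / \<epsilon>) (at t within S)"
  proof -
    have "((\<lambda>t. t / \<epsilon>) has_real_derivative 1 / \<epsilon>) (at t within S)"
      using assms by (auto intro!: derivative_eq_intros)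
    from DERIV_chain2[OF \<theta>_derivative this] show ?thesis
      by simp
  qed
  have W: "(\<lambda>t. W \<epsilon> (t / \<epsilon>) x) =
      (\<lambda>t. (1 - \<theta> (t / \<epsilon>)) *\<^sub>R Q (t - 0) x + \<theta> (t / \<epsilon>) *\<^sub>R Q (t - \<epsilon>) (\<phi> \<epsilon> x))"
    using assms by (simp add: W_def fun_eq_iff right_diff_distrib del: picard.simps)
  have Z: "Z \<epsilon> (t / \<epsilon>) x = ((1 - \<theta> (t / \<epsilon>)) *\<^sub>R h (P (t - 0) x) + (0 - \<theta>' (t / \<epsilon>) / \<epsilon>) *\<^sub>R Q (t - 0) x)
      + (\<theta> (t / \<epsilon>) *\<^sub>R h (P (t - \<epsilon>) (\<phi> \<epsilon> x)) + (\<theta>' (t / \<epsilon>) / \<epsilon>) *\<^sub>R Q (t - \<epsilon>) (\<phi> \<epsilon> x))"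
    using assms by (simp add: Z_def algebra_simps del: picard.simps)
  show ?thesis
    unfolding W Z
    by (intro has_vector_derivative_add has_vector_derivative_scaleR Q_shifted_derivative
        DERIV_diff DERIV_const \<theta>d)
qed

text \<open>The error splits into two differences of \<open>h\<close> along the branches and the
  term with \<theta>' / \<epsilon>. That factor costs a power of \<epsilon>, so the branches
  \<open>y\<close> and \<open>z\<close> must agree to order \<open>Suc (Suc p)\<close>, one more
  than the order claimed.\<close>

lemma Z_near_h:
  assumes "\<rho> \<ge> 0"
  shows "\<exists>C\<ge>0. \<exists>E>0. E \<le> e0 \<and> (\<forall>\<epsilon> \<tau> x. 0 < \<epsilon> \<and> \<epsilon> \<le> E \<and> 0 \<le> \<tau> \<and> \<tau> \<le> 1 \<and> norm x \<le> \<rho> \<longrightarrow>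
      norm (Z \<epsilon> \<tau> x - h (W \<epsilon> \<tau> x)) \<le> C * \<epsilon> ^ Suc p)"
proof -
  obtain B1 where B1: "0 < B1" "\<And>z. z \<in> {0..e0} \<times> cball 0 \<rho> \<Longrightarrow> norm (\<phi> (fst z) (snd z)) \<le> B1"
    using continuous_bounded_on_compact[OF cont_\<phi>, OF compact_Times[OF compact_Icc compact_cball[of 0 \<rho>]]] by blast
  define \<rho>1 where "\<rho>1 = max \<rho> B1"
  obtain C1 where C1: "C1 \<ge> 0"
      "\<And>t x. \<bar>t\<bar> \<le> e0 \<Longrightarrow> norm x \<le> \<rho>1 \<Longrightarrow> norm (P t x - Q t x) \<le> C1 * \<bar>t\<bar> ^ Suc p"
    using P_near_Q by metis
  obtain B0 where B0: "0 < B0" "\<And>j t x. j \<le> Suc p \<Longrightarrow> \<bar>t\<bar> \<le> e0 \<Longrightarrow> norm x \<le> \<rho>1 \<Longrightarrow> norm (picard h j t x) \<le> B0"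
    using picard_bounded[OF cont_h] by metis
  define B :: "'a set" where "B = cball 0 B0"
  obtain L where L: "L > 0" "\<And>u v. u \<in> B \<Longrightarrow> v \<in> B \<Longrightarrow> norm (h u - h v) \<le> L * norm (u - v)"
    using C_class_Lipschitz[OF h, of B] by (auto simp: B_def)
  obtain C2 E2 where C2: "C2 \<ge> 0" "E2 > 0" "E2 \<le> e0"
      "\<And>\<epsilon> \<xi>. 0 < \<epsilon> \<Longrightarrow> \<epsilon> \<le> E2 \<Longrightarrow> norm \<xi> \<le> \<rho> \<Longrightarrow> norm (\<phi> \<epsilon> \<xi> - Q \<epsilon> \<xi>) \<le> C2 * \<epsilon> ^ Suc (Suc p)"
    using phi_near_Q[OF assms] by blast
  obtain M where M: "0 < M" "\<And>\<tau>. \<tau> \<in> {0..1} \<Longrightarrow> norm (\<theta>' \<tau>) \<le> M"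
    using continuous_bounded_on_compact[OF C_class_continuous_on[OF C_\<theta>(2)], of "{0..1}"] by auto
  define E where "E = min E2 (1 / (2 * L))"
  have E: "E > 0" "E \<le> E2" "E \<le> e0" "E \<le> 1 / (2 * L)"
    using C2(2,3) L(1) by (auto simp: E_def)
  define C3 where "C3 = 2 * C2 + 4 * (L * C1)"
  have C3: "C3 \<ge> 0"
    using C2(1) L(1) C1(1) by (simp add: C3_def)
  \<comment> \<open>One summand \<open>L * (C1 + C3 * e0)\<close> for each branch, and
    \<open>M * C3\<close> for the derivative of the weight.\<close>
  define C4 where "C4 = 2 * L * (C1 + C3 * e0) + M * C3"
  have "norm (Z \<epsilon> \<tau> x - h (W \<epsilon> \<tau> x)) \<le> C4 * \<epsilon> ^ Suc p"
    if \<epsilon>: "0 < \<epsilon>" "\<epsilon> \<le> E" and \<tau>: "0 \<le> \<tau>" "\<tau> \<le> 1" and x: "norm x \<le> \<rho>" for \<epsilon> \<tau> x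
  proof -
    define \<xi> where "\<xi> = \<phi> \<epsilon> x"
    have x1: "norm x \<le> \<rho>1" "norm \<xi> \<le> \<rho>1"
      using x B1(2)[of "(\<epsilon>, x)"] \<epsilon> E(3) by (auto simp: \<rho>1_def \<xi>_def)
    define \<delta> where "\<delta> = L * C1 * \<epsilon> ^ Suc p"
    have PQ: "norm (P t y - Q t y) \<le> C1 * \<epsilon> ^ Suc p" "norm (h (P t y) - h (Q t y)) \<le> \<delta>"
      "P t y \<in> B" "Q t y \<in> B" if "\<bar>t\<bar> \<le> \<epsilon>" "norm y \<le> \<rho>1" for t y
    proof -
      have t: "\<bar>t\<bar> \<le> e0"
        using that(1) \<epsilon> E(3) by simp
      show PB: "P t y \<in> B" "Q t y \<in> B"
        using B0(2)[of p t y] B0(2)[of "Suc p" t y] t that(2) by (auto simp: B_def simp del: picard.simps)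
      have "C1 * \<bar>t\<bar> ^ Suc p \<le> C1 * \<epsilon> ^ Suc p"
        using that(1) C1(1) by (intro mult_left_mono power_mono) auto
      then show *: "norm (P t y - Q t y) \<le> C1 * \<epsilon> ^ Suc p"
        using C1(2)[OF t that(2)] by linarith
      show "norm (h (P t y) - h (Q t y)) \<le> \<delta>"
        using order_trans[OF L(2)[OF PB] mult_left_mono[OF *]] L(1) by (simp add: \<delta>_def mult.assoc)
    qed
    \<comment> \<open>The comparison is anchored at the right end t = \<epsilon>, where the branches
      take the values \<xi> and \<open>Q \<epsilon> x\<close>, whose distance is the local error of
      the scheme; from there it spreads over the whole interval.\<close>
    have close: "norm (Q (t - \<epsilon>) \<xi> - Q (t - 0) x) \<le> 2 * norm (Q (\<epsilon> - \<epsilon>) \<xi> - Q (\<epsilon> - 0) x) + 4 * \<delta> * (\<epsilon> - 0)"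
      if t: "t \<in> {0..\<epsilon>}" for t
    proof (rule approximate_solutions_close[where B = B and L = L and h = h and b = \<epsilon> and a = 0])
      show "((\<lambda>t. Q (t - \<epsilon>) \<xi>) has_vector_derivative h (P (t - \<epsilon>) \<xi>)) (at t within {0..\<epsilon>})"
        "((\<lambda>t. Q (t - 0) x) has_vector_derivative h (P (t - 0) x)) (at t within {0..\<epsilon>})" for t
        by (rule Q_shifted_derivative)+
      show "L * (\<epsilon> - 0) \<le> 1/2"
        using mult_left_mono[OF order_trans[OF \<epsilon>(2) E(4)], of L] L(1) by simp
      show "norm (h (P (t - \<epsilon>) \<xi>) - h (Q (t - \<epsilon>) \<xi>)) \<le> \<delta>" "Q (t - \<epsilon>) \<xi> \<in> B"
        "norm (h (P (t - 0) x) - h (Q (t - 0) x)) \<le> \<delta>" "Q (t - 0) x \<in> B" if "t \<in> {0..\<epsilon>}" for t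
        using that by (intro PQ x1; simp)+
    qed (use L t \<epsilon> in auto)
    have "norm (Q (\<epsilon> - \<epsilon>) \<xi> - Q (\<epsilon> - 0) x) \<le> C2 * \<epsilon> ^ Suc (Suc p)"
      using C2(4)[of \<epsilon> x] \<epsilon> E(2) x by (simp add: \<xi>_def del: picard.simps(2))
    then have close': "norm (Q (t - \<epsilon>) \<xi> - Q t x) \<le> C3 * \<epsilon> ^ Suc (Suc p)" if "t \<in> {0..\<epsilon>}" for t
      using close[OF that] by (simp add: C3_def \<delta>_def algebra_simps del: picard.simps)
    define y z w where "y = Q (\<epsilon> * (\<tau> - 1)) \<xi>" and "z = Q (\<epsilon> * \<tau>) x" and "w = W \<epsilon> \<tau> x"
    have \<epsilon>\<tau>: "\<epsilon> * \<tau> \<in> {0..\<epsilon>}" "\<bar>\<epsilon> * \<tau>\<bar> \<le> \<epsilon>" "\<bar>\<epsilon> * (\<tau> - 1)\<bar> \<le> \<epsilon>"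
      using \<epsilon> \<tau> by (auto simp: abs_mult mult_left_le)
    have yz: "norm (y - z) \<le> C3 * \<epsilon> ^ Suc (Suc p)"
      using close'[OF \<epsilon>\<tau>(1)] by (simp add: y_def z_def right_diff_distrib del: picard.simps)
    have B: "y \<in> B" "z \<in> B" "P (\<epsilon> * (\<tau> - 1)) \<xi> \<in> B" "P (\<epsilon> * \<tau>) x \<in> B"
      unfolding y_def z_def by (intro PQ x1 \<epsilon>\<tau>)+
    \<comment> \<open>As a convex combination, \<open>w\<close> lies in the ball \<open>B\<close>
      and is no farther from \<open>y\<close> or \<open>z\<close> than these are from each
      other.\<close>
    have w: "w = (1 - \<theta> \<tau>) *\<^sub>R z + \<theta> \<tau> *\<^sub>R y"
      by (simp only: w_def W_def y_def z_def \<xi>_def)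
    have "w \<in> B"
      unfolding w using B \<theta>(1,2)[of \<tau>] by (intro convexD) (auto simp: B_def)
    have wz: "norm (z - w) \<le> norm (y - z)"
    proof -
      have "z - w = \<theta> \<tau> *\<^sub>R (z - y)"
        by (simp add: w algebra_simps)
      then show ?thesis
        using \<theta>(1,2)[of \<tau>] by (simp add: norm_minus_commute mult_left_le_one_le)
    qed
    have wy: "norm (y - w) \<le> norm (y - z)"
    proof -
      have "y - w = (1 - \<theta> \<tau>) *\<^sub>R (y - z)"
        by (simp add: w algebra_simps)
      then show ?thesis
        using \<theta>(1,2)[of \<tau>] by (simp add: mult_left_le_one_le)
    qed
    have \<epsilon>p: "0 \<le> \<epsilon> ^ Suc p"
      using \<epsilon> by simp
    have C3e: "C3 * \<epsilon> ^ Suc (Suc p) \<le> C3 * e0 * \<epsilon> ^ Suc p"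
      using mult_right_mono[of \<epsilon> e0 "\<epsilon> ^ Suc p"] mult_left_mono[of "\<epsilon> * \<epsilon> ^ Suc p" "e0 * \<epsilon> ^ Suc p" C3]
        C3 \<epsilon> E(3) \<epsilon>p by (simp add: mult.assoc)
    have hw: "norm (h u - h w) \<le> L * (C1 + C3 * e0) * \<epsilon> ^ Suc p"
      if "u \<in> B" "norm (u - v) \<le> C1 * \<epsilon> ^ Suc p" "norm (v - w) \<le> norm (y - z)" for u v
    proof -
      have "norm (u - w) \<le> norm (u - v) + norm (v - w)"
        using norm_triangle_ineq[of "u - v" "v - w"] by simp
      also have "\<dots> \<le> (C1 + C3 * e0) * \<epsilon> ^ Suc p"
        using that yz C3e by (simp add: algebra_simps)
      finally show ?thesis
        using order_trans[OF L(2)[OF that(1) \<open>w \<in> B\<close>] mult_left_mono] L(1) by (simp add: mult.assoc)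
    qed
    have 1: "norm (h (P (\<epsilon> * \<tau>) x) - h w) \<le> L * (C1 + C3 * e0) * \<epsilon> ^ Suc p"
      by (rule hw[OF B(4) _ wz]) (use PQ(1)[OF \<epsilon>\<tau>(2) x1(1)] in \<open>simp add: z_def del: picard.simps\<close>)
    have 2: "norm (h (P (\<epsilon> * (\<tau> - 1)) \<xi>) - h w) \<le> L * (C1 + C3 * e0) * \<epsilon> ^ Suc p"
      by (rule hw[OF B(3) _ wy]) (use PQ(1)[OF \<epsilon>\<tau>(3) x1(2)] in \<open>simp add: y_def del: picard.simps\<close>)
    have 3: "norm ((\<theta>' \<tau> / \<epsilon>) *\<^sub>R (y - z)) \<le> M * C3 * \<epsilon> ^ Suc p"
    proof -
      have "norm ((\<theta>' \<tau> / \<epsilon>) *\<^sub>R (y - z)) = \<bar>\<theta>' \<tau>\<bar> * (norm (y - z) / \<epsilon>)"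
        using \<epsilon> by simp
      also have "\<dots> \<le> M * (C3 * \<epsilon> ^ Suc p)"
        using M(2)[of \<tau>] \<tau> yz \<epsilon> C3 \<epsilon>p M(1) by (intro mult_mono) (auto simp: field_simps)
      finally show ?thesis
        by (simp add: mult.assoc)
    qed
    have "Z \<epsilon> \<tau> x - h w = (1 - \<theta> \<tau>) *\<^sub>R (h (P (\<epsilon> * \<tau>) x) - h w)
        + \<theta> \<tau> *\<^sub>R (h (P (\<epsilon> * (\<tau> - 1)) \<xi>) - h w) + (\<theta>' \<tau> / \<epsilon>) *\<^sub>R (y - z)"
      by (simp add: Z_def y_def z_def \<xi>_def algebra_simps del: picard.simps)
    also have "norm \<dots> \<le> norm ((1 - \<theta> \<tau>) *\<^sub>R (h (P (\<epsilon> * \<tau>) x) - h w))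
        + norm (\<theta> \<tau> *\<^sub>R (h (P (\<epsilon> * (\<tau> - 1)) \<xi>) - h w)) + norm ((\<theta>' \<tau> / \<epsilon>) *\<^sub>R (y - z))"
      by (intro order_trans[OF norm_triangle_ineq] add_mono norm_triangle_ineq order_refl)
    also have "\<dots> \<le> norm (h (P (\<epsilon> * \<tau>) x) - h w) + norm (h (P (\<epsilon> * (\<tau> - 1)) \<xi>) - h w)
        + norm ((\<theta>' \<tau> / \<epsilon>) *\<^sub>R (y - z))"
      using \<theta>(1,2)[of \<tau>] by (intro add_mono order_refl) (auto simp: mult_left_le_one_le)
    also have "\<dots> \<le> C4 * \<epsilon> ^ Suc p"
      using 1 2 3 by (simp add: C4_def algebra_simps)
    finally show ?thesis
      by (simp add: w_def)
  qed
  note main = this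
  show ?thesis
  proof (rule exI[of _ C4], rule conjI)
    show "0 \<le> C4"
      unfolding C4_def using L(1) C1(1) C3 e0 M(1) by simp
    show "\<exists>E>0. E \<le> e0 \<and> (\<forall>\<epsilon> \<tau> x. 0 < \<epsilon> \<and> \<epsilon> \<le> E \<and> 0 \<le> \<tau> \<and> \<tau> \<le> 1 \<and> norm x \<le> \<rho> \<longrightarrow>
        norm (Z \<epsilon> \<tau> x - h (W \<epsilon> \<tau> x)) \<le> C4 * \<epsilon> ^ Suc p)"
    proof (rule exI[of _ E], intro conjI E allI impI, elim conjE)
      show "norm (Z \<epsilon> \<tau> x - h (W \<epsilon> \<tau> x)) \<le> C4 * \<epsilon> ^ Suc p"
        if "0 < \<epsilon>" "\<epsilon> \<le> E" "0 \<le> \<tau>" "\<tau> \<le> 1" "norm x \<le> \<rho>" for \<epsilon> \<tau> x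
        using that by (rule main)
    qed
  qed
qed

end

section \<open>Truncation and the periodic perturbation\<close>

text \<open>The solutions are the fixed points of the contraction that sends \<open>x\<close> to
  \<open>y - u x\<close>.\<close>

lemma contraction_perturbation_bij:
  fixes u :: "'a::euclidean_space \<Rightarrow> 'a"
  assumes "\<And>x y. norm (u x - u y) \<le> 1/2 * norm (x - y)"
  shows "\<exists>!x. x + u x = y"
proof -
  have "\<exists>!x. y - u x = x"
    by (rule banach_fix_type[of "1/2"]) (use assms in \<open>auto simp: dist_norm norm_minus_commute\<close>)
  then show ?thesis
    by (metis add_diff_cancel diff_add_cancel)
qed

text \<open>A growth bound on increments passes to the derivative. It will give injectivity of a
  derivative from metric expansion, without computing that derivative.\<close>

lemma norm_derivative_ge:
  fixes T :: "'a::real_normed_vector \<Rightarrow> 'b::real_normed_vector"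
  assumes D: "(T has_derivative D) (at x)"
    and c: "\<And>t. 0 < t \<Longrightarrow> c * t \<le> norm (T (x + t *\<^sub>R v) - T x)"
  shows "c \<le> norm (D v)"
proof (rule field_le_epsilon)
  fix r :: real assume "r > 0"
  define e where "e = r / (norm v + 1)"
  have e: "e > 0" "e * norm v \<le> r"
    using \<open>r > 0\<close> by (auto simp: e_def field_simps add_pos_nonneg)
  obtain s where s: "s > 0" "\<And>y. norm (y - x) < s \<Longrightarrow> norm (T y - T x - D (y - x)) \<le> e * norm (y - x)"
    using D \<open>e > 0\<close> unfolding has_derivative_at_alt by blast
  define t where "t = s / (norm v + 1)"
  have t: "t > 0" "t * norm v < s"
    using s(1) by (auto simp: t_def field_simps add_pos_nonneg)
  have "c * t \<le> norm (T (x + t *\<^sub>R v) - T x)"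
    by (rule c[OF t(1)])
  also have "\<dots> \<le> norm (D (t *\<^sub>R v)) + norm (T (x + t *\<^sub>R v) - T x - D (t *\<^sub>R v))"
    by (rule norm_triangle_sub)
  also have "\<dots> \<le> t * norm (D v) + e * (t * norm v)"
    using s(2)[of "x + t *\<^sub>R v"] t has_derivative_linear[OF D] by (simp add: linear_cmul)
  also have "\<dots> \<le> (norm (D v) + r) * t"
    using mult_left_mono[OF e(2), of t] t(1) by (simp add: algebra_simps)
  finally show "c \<le> norm (D v) + r"
    using t(1) by simp
qed

lemma norm_fst_le': "norm (fst x) \<le> norm x" and norm_snd_le': "norm (snd x) \<le> norm x"
  by (cases x; simp add: norm_fst_le norm_snd_le)+

lemma inner_self_le:
  fixes x y :: "'a::real_inner"
  assumes "norm x \<le> norm y + c" "0 \<le> c"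
  shows "x \<bullet> x \<le> 2 * (y \<bullet> y) + 2 * c\<^sup>2"
proof -
  have "(norm x)\<^sup>2 \<le> (norm y + c)\<^sup>2"
    using assms by (intro power_mono) auto
  also have "\<dots> \<le> 2 * (norm y)\<^sup>2 + 2 * c\<^sup>2"
    using zero_le_power2[of "norm y - c"] by (simp add: power2_eq_square algebra_simps)
  finally show ?thesis
    by (simp add: power2_norm_eq_inner)
qed

section \<open>Step sizes admissible for a given radius\<close>

context interpolated_scheme
begin

text \<open>The bound \<open>margin \<rho>\<close> compensates the derivative of the cutoff function on the ball of
  squared radius \<open>\<rho> + 1\<close>.\<close>

definition margin where "margin \<rho> = min 1 (1 / (8 * Lf * (max 0 \<rho> + 2)))"

text \<open>The number \<rho> is a squared radius, and \<rho> + 1 is where the cutoff ends. The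
  Lipschitz constant 1/4 is half of the contraction budget 1/2; the other half goes to the slope of
  the cutoff. The range of \<tau> is a period with margins of width 1/4.\<close>

definition good where
  "good \<epsilon> \<rho> \<longleftrightarrow> \<epsilon> \<le> e0 / 2 \<and>
     (\<forall>\<tau> x y. \<tau> \<in> {-1/4..5/4} \<and> x \<bullet> x \<le> \<rho> + 1 \<and> y \<bullet> y \<le> \<rho> + 1 \<longrightarrow>
        norm (W \<epsilon> \<tau> x - x) \<le> margin \<rho> \<and>
        norm ((W \<epsilon> \<tau> x - x) - (W \<epsilon> \<tau> y - y)) \<le> 1/4 * norm (x - y))"

lemma margin: "0 < margin \<rho>" "margin \<rho> \<le> 1"
  using Lf(1) by (auto simp: margin_def intro!: mult_pos_pos)

lemma margin_antimono:
  assumes "\<rho>' \<le> \<rho>"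
  shows "margin \<rho> \<le> margin \<rho>'"
proof -
  have "1 / (8 * Lf * (max 0 \<rho> + 2)) \<le> 1 / (8 * Lf * (max 0 \<rho>' + 2))"
    using assms Lf(1) by (intro divide_left_mono mult_left_mono mult_pos_pos) auto
  then show ?thesis
    unfolding margin_def by (intro min.mono order_refl)
qed

lemma good_mono: "good \<epsilon> \<rho> \<Longrightarrow> \<rho>' \<le> \<rho> \<Longrightarrow> good \<epsilon> \<rho>'"
  unfolding good_def using margin_antimono[of \<rho>' \<rho>]
  by (meson add_right_mono order_trans)

text \<open>At step size 0 the map \<open>W\<close> is the identity, so its displacement
  \<open>u\<close> vanishes there, and the uniform smallness results apply to \<open>u\<close> and
  to its Lipschitz constant.\<close>

lemma good_ex: "\<exists>E>0. \<forall>\<epsilon>. 0 < \<epsilon> \<and> \<epsilon> \<le> E \<longrightarrow> good \<epsilon> \<rho>"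
proof -
  define K :: "'a set" where "K = cball 0 (\<bar>\<rho>\<bar> + 2)"
  have K: "x \<in> K" if "x \<bullet> x \<le> \<rho> + 1" for x
  proof -
    have "(\<bar>\<rho>\<bar> + 2)\<^sup>2 = \<rho>\<^sup>2 + 4 * \<bar>\<rho>\<bar> + 4"
      by (simp add: power2_sum)
    then have "(norm x)\<^sup>2 \<le> (\<bar>\<rho>\<bar> + 2)\<^sup>2"
      using that zero_le_power2[of \<rho>] abs_ge_self[of \<rho>] abs_ge_zero[of \<rho>]
      unfolding power2_norm_eq_inner by linarith
    then have "norm x \<le> \<bar>\<rho>\<bar> + 2"
      by (rule power2_le_imp_le) simp
    then show ?thesis
      by (simp add: K_def)
  qed
  define u where "u = (\<lambda>(\<epsilon>, \<tau>, x). W \<epsilon> \<tau> x - x)"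
  have u0: "u (0, \<tau>, x) = 0" for \<tau> x
    by (simp add: u_def)
  have Cu: "C_class (Suc q) ({0..e0} \<times> UNIV \<times> UNIV) u"
    unfolding u_def case_prod_unfold
    by (intro C_class_diff C_W[unfolded case_prod_unfold] C_class_snd C_class_id)
  obtain E1 where E1: "E1 > 0" "E1 \<le> e0" "\<And>\<epsilon> \<tau> x. 0 \<le> \<epsilon> \<Longrightarrow> \<epsilon> \<le> E1 \<Longrightarrow> \<tau> \<in> {-1/4..5/4} \<Longrightarrow> x \<in> K \<Longrightarrow>
      norm (u (\<epsilon>, \<tau>, x)) \<le> margin \<rho>"
    using eventually_small_on_compact[OF C_class_continuous_on[OF Cu] u0 e0 margin(1), of "{-1/4..5/4}" K \<rho>]
    by (auto simp: K_def)
  obtain E2 where E2: "E2 > 0" "\<And>\<epsilon> \<tau> x y. 0 \<le> \<epsilon> \<Longrightarrow> \<epsilon> \<le> E2 \<Longrightarrow> \<tau> \<in> {-1/4..5/4} \<Longrightarrow> x \<in> K \<Longrightarrow> y \<in> K \<Longrightarrow>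
      norm (u (\<epsilon>, \<tau>, x) - u (\<epsilon>, \<tau>, y)) \<le> 1/4 * norm (x - y)"
    using eventually_small_Lipschitz[OF Cu u0 e0, of "1/4" "{-1/4..5/4}" K]
    by (auto simp: K_def)
  have "good \<epsilon> \<rho>" if "0 < \<epsilon>" "\<epsilon> \<le> min (min E1 E2) (e0 / 2)" for \<epsilon>
    unfolding good_def using that E1(3)[of \<epsilon>] E2(2)[of \<epsilon>] K by (auto simp: u_def)
  then show ?thesis
    using E1(1) E2(1) e0 by (intro exI[of _ "min (min E1 E2) (e0 / 2)"]) auto
qed

end

locale cutoff_scheme = interpolated_scheme +
  fixes R :: "real \<Rightarrow> real" and e1 :: real
  assumes R: "C_class (Suc q) {0<..} R" "\<And>\<epsilon>. 0 < \<epsilon> \<Longrightarrow> \<epsilon> \<le> e1 \<Longrightarrow> good \<epsilon> (R \<epsilon>)"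
      "\<And>K. \<exists>E>0. \<forall>\<epsilon>. 0 < \<epsilon> \<and> \<epsilon> \<le> E \<longrightarrow> K \<le> R \<epsilon>"
    and e1: "e1 > 0"
begin

text \<open>The cutoff uses \<open>x \<bullet> x\<close>, which is smooth also at the origin, so
  \<open>R \<epsilon>\<close> bounds a squared norm. It multiplies the displacement of
  \<open>W\<close>, so \<open>Wc\<close> is \<open>W\<close> on the inner ball and the identity far
  out.\<close>

definition \<eta> where "\<eta> \<epsilon> x = f (x \<bullet> x - R \<epsilon>)" for x :: 'a
definition Wc where "Wc \<epsilon> \<tau> x = x + \<eta> \<epsilon> x *\<^sub>R (W \<epsilon> \<tau> x - x)"

lemma e1_le: "e1 \<le> e0 / 2"
  using R(2)[of e1] e1 by (simp add: good_def)

lemma \<eta>_1: "x \<bullet> x \<le> R \<epsilon> \<Longrightarrow> \<eta> \<epsilon> x = 1"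
  by (simp add: \<eta>_def f(4))

lemma \<eta>_0: "R \<epsilon> + 1 < x \<bullet> x \<Longrightarrow> \<eta> \<epsilon> x = 0"
  by (simp add: \<eta>_def f(5))

lemma \<eta>_range: "0 \<le> \<eta> \<epsilon> x" "\<eta> \<epsilon> x \<le> 1"
  by (auto simp: \<eta>_def f)

lemma Wc_eq_W: "x \<bullet> x \<le> R \<epsilon> \<Longrightarrow> Wc \<epsilon> \<tau> x = W \<epsilon> \<tau> x"
  by (simp add: Wc_def \<eta>_1)

text \<open>The square of the norm is not globally Lipschitz, but \<eta> vanishes beyond the radius
  \<open>s\<close>. The norm may therefore be clamped at \<open>s\<close>, and on [0, s] squaring
  has Lipschitz constant 2 s.\<close>

lemma \<eta>_Lipschitz:
  assumes "0 \<le> R \<epsilon> + 1"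
  shows "\<bar>\<eta> \<epsilon> x - \<eta> \<epsilon> y\<bar> \<le> Lf * (2 * sqrt (R \<epsilon> + 1)) * norm (x - y)"
proof -
  define s where "s = sqrt (R \<epsilon> + 1)"
  have s: "0 \<le> s" "s\<^sup>2 = R \<epsilon> + 1"
    using assms by (auto simp: s_def)
  define a where "a x = min (norm x) s" for x :: 'a
  have a: "0 \<le> a x" "a x \<le> s" for x
    using s(1) by (auto simp: a_def)
  have \<eta>a: "\<eta> \<epsilon> x = f ((a x)\<^sup>2 - R \<epsilon>)" for x
  proof (cases "norm x \<le> s")
    case True
    then show ?thesis
      by (simp add: \<eta>_def a_def power2_norm_eq_inner)
  next
    case False
    then have "s\<^sup>2 < (norm x)\<^sup>2"
      using s(1) by (intro power_strict_mono) auto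
    then have "\<eta> \<epsilon> x = 0"
      using \<eta>_0[of \<epsilon> x] s(2) by (simp add: power2_norm_eq_inner)
    moreover have "a x = s"
      using False by (simp add: a_def)
    ultimately show ?thesis
      using s(2) f(5)[of 1] by simp
  qed
  have "\<bar>\<eta> \<epsilon> x - \<eta> \<epsilon> y\<bar> \<le> Lf * \<bar>(a x)\<^sup>2 - (a y)\<^sup>2\<bar>"
    unfolding \<eta>a using Lf(2)[of "(a x)\<^sup>2 - R \<epsilon>" "(a y)\<^sup>2 - R \<epsilon>"] by simp
  also have "\<bar>(a x)\<^sup>2 - (a y)\<^sup>2\<bar> = \<bar>a x + a y\<bar> * \<bar>a x - a y\<bar>"
    by (simp add: power2_eq_square square_diff_square_factored abs_mult)
  also have "\<dots> \<le> (2 * s) * norm (x - y)"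
  proof (intro mult_mono)
    show "\<bar>a x - a y\<bar> \<le> norm (x - y)"
      using norm_triangle_ineq3[of x y] by (simp add: a_def)
  qed (use a[of x] a[of y] s(1) in auto)
  finally show ?thesis
    using Lf(1) by (simp add: s_def mult.assoc)
qed

text \<open>The number \<open>m\<close> dominates the square root of the squared radius, and the 8
  in \<open>margin\<close> then leaves exactly 1/4.\<close>

lemma margin_\<eta>:
  assumes "0 \<le> R \<epsilon> + 1"
  shows "Lf * (2 * sqrt (R \<epsilon> + 1)) * margin (R \<epsilon>) \<le> 1/4"
proof -
  define m where "m = max 0 (R \<epsilon>) + 2"
  have "m \<ge> 2" "R \<epsilon> + 2 \<le> m"
    by (auto simp: m_def)
  moreover have "2 * m \<le> m\<^sup>2"
    using \<open>m \<ge> 2\<close> by (simp add: power2_eq_square)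
  ultimately have m: "m > 0" "R \<epsilon> + 1 \<le> m\<^sup>2"
    by auto
  have "sqrt (R \<epsilon> + 1) \<le> m"
    using m real_le_lsqrt[of m "R \<epsilon> + 1"] assms by (simp add: real_sqrt_le_iff real_le_lsqrt)
  moreover have "margin (R \<epsilon>) \<le> 1 / (8 * Lf * m)"
    by (simp add: margin_def m_def)
  ultimately have "Lf * (2 * sqrt (R \<epsilon> + 1)) * margin (R \<epsilon>) \<le> Lf * (2 * m) * (1 / (8 * Lf * m))"
    using Lf(1) assms margin(1)[of "R \<epsilon>"] m(1) by (intro mult_mono) auto
  also have "\<dots> = 1/4"
    using Lf(1) m(1) by (simp add: field_simps)
  finally show ?thesis .
qed

text \<open>The contraction constant is the sum of 1/4 from the displacement of \<open>W\<close> and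
  1/4 from the slope of \<eta>. If one point is outside the ball its term is 0, so only the slope
  part remains, with the displacement taken at the inner point.\<close>

lemma cutoff_displacement:
  assumes \<epsilon>: "0 < \<epsilon>" "\<epsilon> \<le> e1" and \<tau>: "\<tau> \<in> {-1/4..5/4}"
  defines "u \<equiv> \<lambda>x. \<eta> \<epsilon> x *\<^sub>R (W \<epsilon> \<tau> x - x)"
  shows "norm (u x - u y) \<le> 1/2 * norm (x - y)" "norm (u x) \<le> 1"
proof -
  define g where "g x = W \<epsilon> \<tau> x - x" for x
  define B where "B = {x :: 'a. x \<bullet> x \<le> R \<epsilon> + 1}"
  have u: "u x = \<eta> \<epsilon> x *\<^sub>R g x" for x
    by (simp add: u_def g_def)
  have g: "norm (g x) \<le> margin (R \<epsilon>)" "norm (g x - g y) \<le> 1/4 * norm (x - y)" if "x \<in> B" "y \<in> B" for x y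
    using R(2)[OF \<epsilon>] \<tau> that unfolding good_def B_def g_def by auto
  have out: "\<eta> \<epsilon> x = 0" if "x \<notin> B" for x
    using that by (intro \<eta>_0) (simp add: B_def)
  show "norm (u x) \<le> 1"
  proof (cases "x \<in> B")
    case True
    then have "\<eta> \<epsilon> x * norm (g x) \<le> 1 * margin (R \<epsilon>)"
      using g(1)[of x x] \<eta>_range[of \<epsilon> x] by (intro mult_mono) auto
    then show ?thesis
      using margin(2)[of "R \<epsilon>"] \<eta>_range(1)[of \<epsilon> x] by (simp add: u)
  qed (simp add: u out)
  have diff: "\<bar>\<eta> \<epsilon> x - \<eta> \<epsilon> y\<bar> * norm (g z) \<le> 1/4 * norm (x - y)" if "z \<in> B" for x y z
  proof -
    have nn: "0 \<le> R \<epsilon> + 1"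
      using that order_trans[OF inner_ge_zero[of z]] by (simp add: B_def)
    have "\<bar>\<eta> \<epsilon> x - \<eta> \<epsilon> y\<bar> * norm (g z) \<le> (Lf * (2 * sqrt (R \<epsilon> + 1)) * norm (x - y)) * margin (R \<epsilon>)"
      using \<eta>_Lipschitz[OF nn, of x y] g(1)[OF that that] margin(1)[of "R \<epsilon>"] Lf(1) nn
      by (intro mult_mono) auto
    also have "\<dots> = (Lf * (2 * sqrt (R \<epsilon> + 1)) * margin (R \<epsilon>)) * norm (x - y)"
      by simp
    also have "\<dots> \<le> 1/4 * norm (x - y)"
      by (intro mult_right_mono margin_\<eta> nn norm_ge_zero)
    finally show ?thesis .
  qed
  show "norm (u x - u y) \<le> 1/2 * norm (x - y)"
  proof (cases "y \<in> B")
    case y: True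
    show ?thesis
    proof (cases "x \<in> B")
      case True
      have "u x - u y = \<eta> \<epsilon> x *\<^sub>R (g x - g y) + (\<eta> \<epsilon> x - \<eta> \<epsilon> y) *\<^sub>R g y"
        by (simp add: u algebra_simps)
      also have "norm \<dots> \<le> \<eta> \<epsilon> x * norm (g x - g y) + \<bar>\<eta> \<epsilon> x - \<eta> \<epsilon> y\<bar> * norm (g y)"
        using \<eta>_range(1)[of \<epsilon> x] by (intro order_trans[OF norm_triangle_ineq]) simp
      also have "\<eta> \<epsilon> x * norm (g x - g y) \<le> 1 * (1/4 * norm (x - y))"
        using \<eta>_range[of \<epsilon> x] g(2)[OF True y] by (intro mult_mono) auto
      finally show ?thesis
        using diff[OF y, of x y] by simp
    next
      case False
      then have "norm (u x - u y) \<le> 1/4 * norm (x - y)"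
        using diff[OF y, of x y] \<eta>_range(1)[of \<epsilon> y] by (simp add: u out)
      then show ?thesis
        using norm_ge_zero[of "x - y"] by linarith
    qed
  next
    case y: False
    show ?thesis
    proof (cases "x \<in> B")
      case True
      then have "norm (u x - u y) \<le> 1/4 * norm (x - y)"
        using diff[OF True, of x y] \<eta>_range(1)[of \<epsilon> x] by (simp add: u out[OF y])
      then show ?thesis
        using norm_ge_zero[of "x - y"] by linarith
    qed (simp add: u out y)
  qed
qed

lemma Wc_bij:
  assumes "0 < \<epsilon>" "\<epsilon> \<le> e1" "\<tau> \<in> {-1/4..5/4}"
  shows "\<exists>!x. Wc \<epsilon> \<tau> x = y"
  unfolding Wc_def by (rule contraction_perturbation_bij[OF cutoff_displacement(1)[OF assms]])

text \<open>Serves both halves of the regularity of the inverse: its continuity in all variables and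
  the injectivity of the derivative.\<close>

lemma Wc_expanding:
  assumes "0 < \<epsilon>" "\<epsilon> \<le> e1" "\<tau> \<in> {-1/4..5/4}"
  shows "norm (x - y) \<le> 2 * norm (Wc \<epsilon> \<tau> x - Wc \<epsilon> \<tau> y)"
proof -
  define u where "u x = \<eta> \<epsilon> x *\<^sub>R (W \<epsilon> \<tau> x - x)" for x
  have "norm (u y - u x) \<le> 1/2 * norm (x - y)"
    using cutoff_displacement(1)[OF assms, of y x] by (simp add: u_def norm_minus_commute)
  moreover have "x - y = (Wc \<epsilon> \<tau> x - Wc \<epsilon> \<tau> y) + (u y - u x)"
    by (simp add: Wc_def u_def)
  then have "norm (x - y) \<le> norm (Wc \<epsilon> \<tau> x - Wc \<epsilon> \<tau> y) + norm (u y - u x)"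
    by (metis norm_triangle_ineq)
  ultimately show ?thesis
    by simp
qed

lemma Wc_near: "0 < \<epsilon> \<Longrightarrow> \<epsilon> \<le> e1 \<Longrightarrow> \<tau> \<in> {-1/4..5/4} \<Longrightarrow> norm (Wc \<epsilon> \<tau> x - x) \<le> 1"
  using cutoff_displacement(2)[of \<epsilon> \<tau> x] by (simp add: Wc_def)

section \<open>The inverse of the truncated path of maps\<close>

definition g where "g \<epsilon> \<tau> y = (THE x. Wc \<epsilon> \<tau> x = y)"

lemma Wc_g: "0 < \<epsilon> \<Longrightarrow> \<epsilon> \<le> e1 \<Longrightarrow> \<tau> \<in> {-1/4..5/4} \<Longrightarrow> Wc \<epsilon> \<tau> (g \<epsilon> \<tau> y) = y"
  unfolding g_def by (rule theI'[OF Wc_bij])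

lemma g_eqI: "0 < \<epsilon> \<Longrightarrow> \<epsilon> \<le> e1 \<Longrightarrow> \<tau> \<in> {-1/4..5/4} \<Longrightarrow> Wc \<epsilon> \<tau> x = y \<Longrightarrow> g \<epsilon> \<tau> y = x"
  using Wc_bij Wc_g by blast

lemma g_near: "0 < \<epsilon> \<Longrightarrow> \<epsilon> \<le> e1 \<Longrightarrow> \<tau> \<in> {-1/4..5/4} \<Longrightarrow> norm (y - g \<epsilon> \<tau> y) \<le> 1"
  using Wc_near[of \<epsilon> \<tau> "g \<epsilon> \<tau> y"] by (simp add: Wc_g)

text \<open>An open parameter domain on which differentiation is unrestricted; in \<tau> it exceeds
  a period on both sides, so that it covers neighbourhoods of the junctions 0 and 1.\<close>

definition \<Omega> :: "(real \<times> real \<times> 'a) set" where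
  "\<Omega> = {0<..<e1} \<times> {-1/4<..<5/4} \<times> UNIV"

lemma open_\<Omega>: "open \<Omega>"
  unfolding \<Omega>_def by (intro open_Times open_greaterThanLessThan open_UNIV)

lemma \<Omega>D: "z \<in> \<Omega> \<Longrightarrow> 0 < fst z \<and> fst z < e1 \<and> fst z \<le> e1 \<and> fst z \<le> e0 \<and> fst (snd z) \<in> {-1/4..5/4}"
  using e1_le e0 by (auto simp: \<Omega>_def)

lemma C_Wc: "C_class (Suc q) \<Omega> (\<lambda>z. Wc (fst z) (fst (snd z)) (snd (snd z)))"
  unfolding Wc_def \<eta>_def
  by (intro C_class_add C_class_scaleR C_class_diff C_class_inner C_class_compose[OF f(1)]
      C_class_compose[OF R(1)] C_class_comp3[OF C_W] C_class_fst C_class_snd C_class_id)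
     (auto dest: \<Omega>D)

text \<open>The parameters are carried along as components of the map \<open>T\<close>, so inverting
  \<open>T\<close> gives joint regularity of \<open>g\<close> in step, time and point.\<close>

lemma C_g: "C_class (Suc q) \<Omega> (\<lambda>z. g (fst z) (fst (snd z)) (snd (snd z)))"
proof -
  let ?g = "\<lambda>z. g (fst z) (fst (snd z)) (snd (snd z))"
  define T where "T z = (fst z, fst (snd z), Wc (fst z) (fst (snd z)) (snd (snd z)))" for z :: "real \<times> real \<times> 'a"
  define G where "G z = (fst z, fst (snd z), ?g z)" for z :: "real \<times> real \<times> 'a"
  have "continuous_on \<Omega> ?g"
    unfolding continuous_on_def
  proof
    fix z0 assume z0: "z0 \<in> \<Omega>"
    define x0 where "x0 = ?g z0"
    \<comment> \<open>With the preimage \<open>x0\<close> frozen, continuity of \<open>Wc\<close> in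
      the parameters suffices: by expansion \<open>?g z\<close> is within twice the distance from
      the target to the image of \<open>x0\<close>.\<close>
    have "continuous_on \<Omega> (\<lambda>z. Wc (fst z) (fst (snd z)) x0)"
    proof -
      have "continuous_on \<Omega> (\<lambda>z. Wc (fst (fst z, fst (snd z), x0)) (fst (snd (fst z, fst (snd z), x0)))
          (snd (snd (fst z, fst (snd z), x0))))"
        by (rule continuous_on_compose2[OF C_class_continuous_on[OF C_Wc]])
           (auto simp: \<Omega>_def intro!: continuous_intros)
      then show ?thesis
        by simp
    qed
    then have "((\<lambda>z. 2 * norm (snd (snd z) - Wc (fst z) (fst (snd z)) x0)) \<longlongrightarrow>
        2 * norm (snd (snd z0) - Wc (fst z0) (fst (snd z0)) x0)) (at z0 within \<Omega>)"
      using z0 by (intro tendsto_intros) (auto simp: continuous_on_def)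
    moreover have "Wc (fst z0) (fst (snd z0)) x0 = snd (snd z0)"
      unfolding x0_def using \<Omega>D[OF z0] by (intro Wc_g) auto
    ultimately have lim: "((\<lambda>z. 2 * norm (snd (snd z) - Wc (fst z) (fst (snd z)) x0)) \<longlongrightarrow> 0) (at z0 within \<Omega>)"
      by simp
    have "\<forall>\<^sub>F z in at z0 within \<Omega>. norm (?g z - x0)
        \<le> 2 * norm (snd (snd z) - Wc (fst z) (fst (snd z)) x0)"
    proof (rule eventually_mono)
      show "\<forall>\<^sub>F z in at z0 within \<Omega>. z \<in> \<Omega>"
        by (simp add: eventually_at_filter)
      fix z assume z: "z \<in> \<Omega>"
      then show "norm (?g z - x0)
        \<le> 2 * norm (snd (snd z) - Wc (fst z) (fst (snd z)) x0)"
        using Wc_expanding[of "fst z" "fst (snd z)" "?g z" x0]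
          Wc_g[of "fst z" "fst (snd z)" "snd (snd z)"] \<Omega>D[OF z] by simp
    qed
    from LIM_zero_cancel[OF Lim_null_comparison[OF this lim]]
    show "(?g \<longlongrightarrow> ?g z0)
        (at z0 within \<Omega>)"
      unfolding x0_def .
  qed
  then have contG: "continuous_on \<Omega> G"
    unfolding G_def[abs_def] by (intro continuous_intros)
  have "C_class (Suc q) \<Omega> G"
  proof (rule C_class_inverse_function[OF open_\<Omega> open_\<Omega> _ _ _ contG])
    show "C_class (Suc q) \<Omega> T"
      unfolding T_def[abs_def] by (intro C_class_Pair C_class_fst C_class_snd C_class_id C_Wc)
    show "G ` \<Omega> \<subseteq> \<Omega>"
      by (auto simp: G_def \<Omega>_def)
    show "T (G z) = z" if "z \<in> \<Omega>" for z
      using \<Omega>D[OF that] by (simp add: T_def G_def Wc_g)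
    fix z D assume z: "z \<in> \<Omega>" and D: "(T has_derivative D) (at z)"
    \<comment> \<open>The parameter components of \<open>T\<close> are preserved, so they must
      vanish in a kernel vector. The remaining motion is in \<open>x\<close> alone, where the
      expansion estimate gives the lower bound 1/2.\<close>
    have "v = 0" if v: "D v = 0" for v
    proof -
      have "\<bar>fst v\<bar> \<le> norm (D v)"
      proof (rule norm_derivative_ge[OF D])
        fix t :: real assume "0 < t"
        then show "\<bar>fst v\<bar> * t \<le> norm (T (z + t *\<^sub>R v) - T z)"
          using norm_fst_le'[of "T (z + t *\<^sub>R v) - T z"] by (simp add: T_def abs_mult mult.commute)
      qed
      moreover have "\<bar>fst (snd v)\<bar> \<le> norm (D v)"
      proof (rule norm_derivative_ge[OF D])
        fix t :: real assume "0 < t"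
        then show "\<bar>fst (snd v)\<bar> * t \<le> norm (T (z + t *\<^sub>R v) - T z)"
          using norm_snd_le'[of "T (z + t *\<^sub>R v) - T z"] norm_fst_le'[of "snd (T (z + t *\<^sub>R v) - T z)"]
          by (simp add: T_def abs_mult mult.commute)
      qed
      ultimately have v0: "fst v = 0" "fst (snd v) = 0"
        using v by auto
      have "norm (snd (snd v)) / 2 \<le> norm (D v)"
      proof (rule norm_derivative_ge[OF D])
        fix t :: real assume "0 < t"
        then show "norm (snd (snd v)) / 2 * t \<le> norm (T (z + t *\<^sub>R v) - T z)"
          using norm_snd_le'[of "T (z + t *\<^sub>R v) - T z"] norm_snd_le'[of "snd (T (z + t *\<^sub>R v) - T z)"]
            Wc_expanding[of "fst z" "fst (snd z)" "snd (snd z) + t *\<^sub>R snd (snd v)" "snd (snd z)"] \<Omega>D[OF z]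
          by (simp add: T_def v0 mult.commute)
      qed
      then have "snd (snd v) = 0"
        using v by simp
      with v0 show "v = 0"
        by (simp add: prod_eq_iff)
    qed
    then show "inj D"
      using linear_injective_0[OF has_derivative_linear[OF D]] by blast
  qed
  then have "C_class (Suc q) \<Omega> (\<lambda>z. snd (snd (G z)))"
    by (intro C_class_snd)
  then show ?thesis
    by (simp add: G_def)
qed

section \<open>The periodic perturbation\<close>

definition \<kappa> where "\<kappa> \<epsilon> = f (4 * \<epsilon> / e1 - 1)"
text \<open>While \<kappa> switches the perturbation off for large steps, \<beta> does so for large
  \<open>y\<close>. The factor 4 and the constant 100 leave room for the preimage of
  \<open>y\<close> and its image under \<phi> to stay in the ball where \<open>Wc\<close> is
  \<open>W\<close>.\<close>

definition \<beta> where "\<beta> \<epsilon> y = f (4 * (y \<bullet> y) + 100 - R \<epsilon>)" for y :: 'a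
definition E where
  "E \<epsilon> \<tau> y = (\<kappa> \<epsilon> * \<beta> \<epsilon> y * inverse \<epsilon> ^ Suc p) *\<^sub>R (Z \<epsilon> \<tau> (g \<epsilon> \<tau> y) - h y)"
text \<open>Periodic by construction; regularity at the integers is the question, and the overlap of
  neighbouring periods settles it.\<close>

definition d where "d \<epsilon> \<tau> y = E \<epsilon> (frac \<tau>) y"

lemma \<kappa>_0: "e1 / 2 \<le> \<epsilon> \<Longrightarrow> \<kappa> \<epsilon> = 0"
  unfolding \<kappa>_def using e1 by (intro f(5)) (simp add: field_simps)

lemma \<kappa>_1: "\<epsilon> \<le> e1 / 4 \<Longrightarrow> \<kappa> \<epsilon> = 1"
  unfolding \<kappa>_def using e1 by (intro f(4)) (simp add: field_simps)

lemma \<beta>_0: "R \<epsilon> < 4 * (y \<bullet> y) + 99 \<Longrightarrow> \<beta> \<epsilon> y = 0"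
  unfolding \<beta>_def by (intro f(5)) simp

lemma \<beta>_1: "4 * (y \<bullet> y) + 100 \<le> R \<epsilon> \<Longrightarrow> \<beta> \<epsilon> y = 1"
  unfolding \<beta>_def by (intro f(4)) simp

lemma C_E: "C_class (Suc q) \<Omega> (\<lambda>z. E (fst z) (fst (snd z)) (snd (snd z)))"
  unfolding E_def \<kappa>_def \<beta>_def divide_inverse
  by (intro C_class_scaleR C_class_diff C_class_add C_class_mult C_class_power C_class_inner C_class_const
      C_class_compose[OF f(1)] C_class_compose[OF R(1)] C_class_compose[OF C_class_real_inverse]
      C_class_compose[OF h] C_class_comp3[OF C_Z] C_g C_class_fst C_class_snd C_class_id)
     (auto dest: \<Omega>D)

lemma phi_near:
  assumes "0 < \<epsilon>" "\<epsilon> \<le> e1" "x \<bullet> x \<le> R \<epsilon>"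
  shows "norm (\<phi> \<epsilon> x - x) \<le> 1"
proof -
  have "norm (W \<epsilon> 1 x - x) \<le> margin (R \<epsilon>)"
  proof -
    have "x \<bullet> x \<le> R \<epsilon> + 1"
      using assms(3) by simp
    then show ?thesis
      using R(2)[OF assms(1,2), unfolded good_def, THEN conjunct2, rule_format, of 1 x x] by simp
  qed
  then show ?thesis
    using margin(2)[of "R \<epsilon>"] by simp
qed

text \<open>Either \<beta> annihilates both sides, or the truncation is inactive at
  \<open>x = g \<epsilon> (\<tau> + 1) y\<close> and at \<open>\<phi> \<epsilon> x\<close>. In the
  second case \<open>W_glue\<close> identifies \<open>\<phi> \<epsilon> x\<close> as the preimage of
  \<open>y\<close> at time \<tau>, and \<open>Z_glue\<close> equates the velocities.\<close>

lemma E_glue: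
  assumes \<epsilon>: "0 < \<epsilon>" "\<epsilon> \<le> e1" and \<tau>: "\<bar>\<tau>\<bar> < 1/4"
  shows "E \<epsilon> (\<tau> + 1) y = E \<epsilon> \<tau> y"
proof (cases "R \<epsilon> < 4 * (y \<bullet> y) + 99")
  case True
  then show ?thesis
    by (simp add: E_def \<beta>_0)
next
  case False
  have y: "0 \<le> y \<bullet> y"
    by simp
  have "-1/4 < \<tau>" "\<tau> < 1/4"
    using \<tau> by auto
  then have \<tau>': "\<tau> \<in> {-1/4..5/4}" "\<tau> + 1 \<in> {-1/4..5/4}"
    by auto
  define x where "x = g \<epsilon> (\<tau> + 1) y"
  have "norm (y - x) \<le> 1"
    unfolding x_def by (rule g_near[OF \<epsilon> \<tau>'(2)])
  then have nx: "norm x \<le> norm y + 1"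
    using norm_triangle_ineq2[of x y] by (simp add: norm_minus_commute)
  have "x \<bullet> x \<le> 2 * (y \<bullet> y) + 2"
    using inner_self_le[OF nx] by simp
  then have xR: "x \<bullet> x \<le> R \<epsilon>"
    using False y by linarith
  \<comment> \<open>One unit of displacement comes from passing to the preimage, and another from
    \<phi>; the constant 8 below is twice the square of 2.\<close>
  have nx': "norm (\<phi> \<epsilon> x) \<le> norm y + 2"
    using phi_near[OF \<epsilon> xR] norm_triangle_ineq2[of "\<phi> \<epsilon> x" x] nx by simp
  have "\<phi> \<epsilon> x \<bullet> \<phi> \<epsilon> x \<le> 2 * (y \<bullet> y) + 8"
    using inner_self_le[OF nx'] by simp
  then have xR': "\<phi> \<epsilon> x \<bullet> \<phi> \<epsilon> x \<le> R \<epsilon>"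
    using False y by linarith
  have "W \<epsilon> (\<tau> + 1) x = y"
    using Wc_g[OF \<epsilon> \<tau>'(2), of y] Wc_eq_W[OF xR, of "\<tau> + 1"] by (simp add: x_def)
  then have "Wc \<epsilon> \<tau> (\<phi> \<epsilon> x) = y"
    using Wc_eq_W[OF xR', of \<tau>] W_glue[OF \<tau>] by simp
  then have "g \<epsilon> \<tau> y = \<phi> \<epsilon> x"
    by (rule g_eqI[OF \<epsilon> \<tau>'(1)])
  then have "Z \<epsilon> (\<tau> + 1) (g \<epsilon> (\<tau> + 1) y) = Z \<epsilon> \<tau> (g \<epsilon> \<tau> y)"
    using Z_glue[OF \<tau>, of \<epsilon> x] by (simp add: x_def)
  then show ?thesis
    by (simp add: E_def)
qed

text \<open>The shift \<open>n\<close> need not be the floor of \<tau>: within the enlarged period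
  it is off by at most one, and \<open>E_glue\<close> absorbs that difference. A shift can thus stay
  fixed in a neighbourhood of an integer.\<close>

lemma d_eq_E:
  assumes \<epsilon>: "0 < \<epsilon>" "\<epsilon> \<le> e1" and \<tau>: "\<tau> - of_int n \<in> {-1/4<..<5/4}"
  shows "d \<epsilon> \<tau> y = E \<epsilon> (\<tau> - of_int n) y"
proof -
  have "\<lfloor>\<tau>\<rfloor> = n - 1 \<or> \<lfloor>\<tau>\<rfloor> = n \<or> \<lfloor>\<tau>\<rfloor> = n + 1"
    using \<tau> by (auto simp: floor_eq_iff)
  then consider "frac \<tau> = (\<tau> - of_int n) + 1" "\<bar>\<tau> - of_int n\<bar> < 1/4" | "frac \<tau> = \<tau> - of_int n"
    | "frac \<tau> + 1 = \<tau> - of_int n" "\<bar>frac \<tau>\<bar> < 1/4"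
    using \<tau> frac_lt_1[of \<tau>] frac_ge_0[of \<tau>] unfolding frac_def by auto
  then show ?thesis
    using E_glue[OF \<epsilon>, of "\<tau> - of_int n" y] E_glue[OF \<epsilon>, of "frac \<tau>" y] unfolding d_def by cases auto
qed

text \<open>Locally \<open>d\<close> is \<open>E\<close> with a constant shift of \<tau>. For steps
  above e1 / 2 it is 0, which extends it to all positive steps.\<close>

lemma C_d: "C_class (Suc q) ({0<..} \<times> UNIV \<times> UNIV) (\<lambda>(\<epsilon>, \<tau>, y). d \<epsilon> \<tau> y)"
proof (rule C_class_local)
  fix z :: "real \<times> real \<times> 'a" assume "z \<in> {0<..} \<times> UNIV \<times> UNIV"
  then have z: "0 < fst z"
    by auto
  show "\<exists>U. open U \<and> z \<in> U \<and> C_class (Suc q) U (\<lambda>(\<epsilon>, \<tau>, y). d \<epsilon> \<tau> y)"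
  proof (cases "fst z < e1")
    case True
    define n where "n = \<lfloor>fst (snd z)\<rfloor>"
    define U where "U = {0<..<e1} \<times> {real_of_int n - 1/4<..<real_of_int n + 5/4} \<times> (UNIV :: 'a set)"
    have "C_class (Suc q) U (\<lambda>z. E (fst z) (fst (snd z) - of_int n) (snd (snd z)))"
      by (rule C_class_comp3[where F = E and S = "{0<..<e1}" and T = "{-1/4<..<5/4}" and U = UNIV])
         (use C_E in \<open>auto simp: U_def \<Omega>_def case_prod_unfold
            intro!: C_class_diff C_class_const C_class_fst C_class_snd C_class_id\<close>)
    then have "C_class (Suc q) U (\<lambda>(\<epsilon>, \<tau>, y). d \<epsilon> \<tau> y)"
    proof (rule C_class_cong)
      fix w assume w: "w \<in> U"
      then have "d (fst w) (fst (snd w)) (snd (snd w)) = E (fst w) (fst (snd w) - of_int n) (snd (snd w))"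
        by (intro d_eq_E) (auto simp: U_def)
      then show "E (fst w) (fst (snd w) - of_int n) (snd (snd w)) = (case w of (\<epsilon>, \<tau>, y) \<Rightarrow> d \<epsilon> \<tau> y)"
        by (simp add: case_prod_unfold)
    qed
    moreover have "open U"
      unfolding U_def by (intro open_Times open_greaterThanLessThan open_UNIV)
    moreover have "z \<in> U"
    proof -
      have "of_int n \<le> fst (snd z)" "fst (snd z) < of_int n + 1"
        unfolding n_def by linarith+
      then show ?thesis
        using z True by (cases z) (auto simp: U_def)
    qed
    ultimately show ?thesis
      by blast
  next
    case False
    define U where "U = {e1 / 2<..} \<times> (UNIV :: real set) \<times> (UNIV :: 'a set)"
    have "C_class (Suc q) U (\<lambda>(\<epsilon>, \<tau>, y). d \<epsilon> \<tau> y)"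
      by (rule C_class_cong[OF C_class_const[where c = 0]]) (auto simp: U_def d_def E_def \<kappa>_0)
    moreover have "open U"
      unfolding U_def by (intro open_Times open_greaterThan open_UNIV)
    moreover have "z \<in> U"
      using False e1 by (cases z) (auto simp: U_def)
    ultimately show ?thesis
      by blast
  qed
qed

lemma d_periodic: "d \<epsilon> (\<tau> + 1) y = d \<epsilon> \<tau> y"
  by (simp add: d_def frac_def)

text \<open>Three ranges of steps. For \<epsilon> up to \<open>c\<close> the truncation is inactive
  on the ball and \<open>Z_near_h\<close> cancels the negative power of \<epsilon>; between
  \<open>c\<close> and \<open>e1\<close> compactness bounds everything; beyond that \<open>d\<close>
  vanishes. The radius \<rho> + 1 allows for the displacement to the preimage.\<close>

lemma d_bounded:
  assumes "\<rho> \<ge> 0"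
  shows "\<exists>B. \<forall>\<epsilon> \<tau> y. 0 < \<epsilon> \<and> norm y \<le> \<rho> \<longrightarrow> norm (d \<epsilon> \<tau> y) \<le> B"
proof -
  obtain C E1 where C: "C \<ge> 0" "E1 > 0" "\<And>\<epsilon> \<tau> x. 0 < \<epsilon> \<Longrightarrow> \<epsilon> \<le> E1 \<Longrightarrow> 0 \<le> \<tau> \<Longrightarrow> \<tau> \<le> 1 \<Longrightarrow> norm x \<le> \<rho> + 1 \<Longrightarrow>
      norm (Z \<epsilon> \<tau> x - h (W \<epsilon> \<tau> x)) \<le> C * \<epsilon> ^ Suc p"
    using Z_near_h[of "\<rho> + 1"] assms by auto
  obtain E2 where E2: "E2 > 0" "\<And>\<epsilon>. 0 < \<epsilon> \<Longrightarrow> \<epsilon> \<le> E2 \<Longrightarrow> (\<rho> + 1)\<^sup>2 \<le> R \<epsilon>"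
    using R(3) by blast
  define c where "c = min (min E1 E2) e1"
  have c: "c > 0" "c \<le> E1" "c \<le> E2" "c \<le> e1"
    using C(2) E2(1) e1 by (auto simp: c_def)
  let ?K = "{c..e1} \<times> {0..1::real} \<times> cball (0::'a) (\<rho> + 1)"
  have "continuous_on ({0<..e0} \<times> UNIV \<times> UNIV) (\<lambda>z. Z (fst z) (fst (snd z)) (snd (snd z)))"
    using C_class_continuous_on[OF C_Z] by (simp add: case_prod_unfold)
  moreover have "?K \<subseteq> {0<..e0} \<times> UNIV \<times> UNIV"
    using c(1) e1_le e0 by auto
  moreover have "compact ?K"
    by (intro compact_Times) auto
  ultimately obtain M1 where M1: "M1 > 0" "\<And>z. z \<in> ?K \<Longrightarrow> norm (Z (fst z) (fst (snd z)) (snd (snd z))) \<le> M1"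
    using continuous_bounded_on_compact by blast
  obtain M2 where M2: "M2 > 0" "\<And>y. y \<in> cball 0 \<rho> \<Longrightarrow> norm (h y) \<le> M2"
    using continuous_bounded_on_compact[OF cont_h compact_cball[of 0 \<rho>]] by auto
  define B where "B = max C (inverse c ^ Suc p * (M1 + M2))"
  have "norm (d \<epsilon> \<tau> y) \<le> B" if \<epsilon>: "0 < \<epsilon>" and y: "norm y \<le> \<rho>" for \<epsilon> \<tau> y
  proof (cases "\<epsilon> < e1")
    case False
    then show ?thesis
      using C(1) e1 by (simp add: d_def E_def \<kappa>_0 B_def le_max_iff_disj)
  next
    case True
    define s where "s = frac \<tau>"
    have s01: "0 \<le> s" "s \<le> 1"
      using frac_lt_1[of \<tau>] by (auto simp: s_def)
    then have s: "0 \<le> s" "s \<le> 1" "s \<in> {-1/4..5/4}"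
      by auto
    define x where "x = g \<epsilon> s y"
    have "norm (y - x) \<le> 1"
      unfolding x_def using True \<epsilon> s by (intro g_near) auto
    then have x: "norm x \<le> \<rho> + 1"
      using norm_triangle_ineq2[of x y] y by (simp add: norm_minus_commute)
    have fac: "0 \<le> \<kappa> \<epsilon>" "0 \<le> \<beta> \<epsilon> y" "\<kappa> \<epsilon> * \<beta> \<epsilon> y \<le> 1"
      using mult_mono[of "\<kappa> \<epsilon>" 1 "\<beta> \<epsilon> y" 1] by (auto simp: \<kappa>_def \<beta>_def f)
    have "norm (d \<epsilon> \<tau> y) = \<kappa> \<epsilon> * \<beta> \<epsilon> y * (inverse \<epsilon> ^ Suc p * norm (Z \<epsilon> s x - h y))"
      using fac(1,2) \<epsilon> by (simp add: d_def E_def s_def x_def abs_mult mult.assoc)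
    also have "\<dots> \<le> 1 * (inverse \<epsilon> ^ Suc p * norm (Z \<epsilon> s x - h y))"
      using \<epsilon> by (intro mult_right_mono fac) auto
    also have "\<dots> \<le> B"
    proof (cases "\<epsilon> \<le> c")
      case True
      have "(norm x)\<^sup>2 \<le> (\<rho> + 1)\<^sup>2"
        using x by (intro power_mono) auto
      also have "\<dots> \<le> R \<epsilon>"
        using True c(3) by (intro E2(2) \<epsilon>) auto
      finally have "W \<epsilon> s x = y"
        using Wc_eq_W[of x \<epsilon> s] Wc_g[OF \<epsilon> _ s(3), of y] \<open>\<epsilon> < e1\<close> by (simp add: x_def power2_norm_eq_inner)
      then have "norm (Z \<epsilon> s x - h y) \<le> C * \<epsilon> ^ Suc p"
        using C(3)[OF \<epsilon> _ s(1,2) x] True c(2) by simp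
      then have "inverse \<epsilon> ^ Suc p * norm (Z \<epsilon> s x - h y) \<le> inverse \<epsilon> ^ Suc p * (C * \<epsilon> ^ Suc p)"
        using \<epsilon> by (intro mult_left_mono) auto
      also have "\<dots> = C"
        using \<epsilon> by (simp add: field_simps)
      finally show ?thesis
        by (simp add: B_def)
    next
      case False
      have "norm (Z \<epsilon> s x - h y) \<le> M1 + M2"
        using M1(2)[of "(\<epsilon>, s, x)"] M2(2)[of y] norm_triangle_ineq4[of "Z \<epsilon> s x" "h y"] False \<open>\<epsilon> < e1\<close> s x y
        by simp
      moreover have "inverse \<epsilon> ^ Suc p \<le> inverse c ^ Suc p"
        using False c(1) \<epsilon> by (intro power_mono le_imp_inverse_le) auto
      ultimately have "inverse \<epsilon> ^ Suc p * norm (Z \<epsilon> s x - h y) \<le> inverse c ^ Suc p * (M1 + M2)"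
        using M1(1) M2(1) c(1) by (intro mult_mono) auto
      then show ?thesis
        by (simp add: B_def)
    qed
    finally show ?thesis .
  qed
  then show ?thesis
    by blast
qed

text \<open>The interpolated path of \<xi> is the required solution: along it both cutoffs equal 1
  and the inverse map returns \<xi>, so \<open>h\<close> plus the perturbation is the velocity of
  the path.\<close>

lemma d_time_map:
  assumes "\<rho> \<ge> 0"
  shows "\<exists>E0>0. E0 \<le> e0 \<and> (\<forall>\<epsilon> \<xi>. 0 < \<epsilon> \<and> \<epsilon> \<le> E0 \<and> norm \<xi> \<le> \<rho> \<longrightarrow>
    (\<exists>x. x 0 = \<xi> \<and> x \<epsilon> = \<phi> \<epsilon> \<xi> \<and> (\<forall>t\<in>{0..\<epsilon>}.
      (x has_vector_derivative h (x t) + \<epsilon> ^ Suc p *\<^sub>R d \<epsilon> (t / \<epsilon>) (x t)) (at t within {0..\<epsilon>}))))"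
proof -
  \<comment> \<open>The path stays in the ball of radius \<rho> + 1, and this is the condition for
    \<beta> to be 1 on that ball.\<close>
  obtain E2 where E2: "E2 > 0" "\<And>\<epsilon>. 0 < \<epsilon> \<Longrightarrow> \<epsilon> \<le> E2 \<Longrightarrow> 4 * (\<rho> + 1)\<^sup>2 + 100 \<le> R \<epsilon>"
    using R(3) by blast
  define E0 where "E0 = min E2 (e1 / 4)"
  have E0: "E0 > 0" "E0 \<le> E2" "E0 \<le> e1 / 4" "E0 \<le> e0"
    using E2(1) e1 e1_le e0 by (auto simp: E0_def)
  have "\<exists>x. x 0 = \<xi> \<and> x \<epsilon> = \<phi> \<epsilon> \<xi> \<and> (\<forall>t\<in>{0..\<epsilon>}.
      (x has_vector_derivative h (x t) + \<epsilon> ^ Suc p *\<^sub>R d \<epsilon> (t / \<epsilon>) (x t)) (at t within {0..\<epsilon>}))"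
    if \<epsilon>: "0 < \<epsilon>" "\<epsilon> \<le> E0" and \<xi>: "norm \<xi> \<le> \<rho>" for \<epsilon> \<xi>
  proof (intro exI conjI ballI)
    let ?x = "\<lambda>t. W \<epsilon> (t / \<epsilon>) \<xi>"
    show "?x 0 = \<xi>" "?x \<epsilon> = \<phi> \<epsilon> \<xi>"
      using \<epsilon> by auto
    fix t assume t: "t \<in> {0..\<epsilon>}"
    have \<epsilon>1: "\<epsilon> \<le> e1"
      using \<epsilon> E0(3) e1 by simp
    define \<tau> where "\<tau> = t / \<epsilon>"
    have \<tau>: "\<tau> \<in> {-1/4..5/4}" "\<tau> - of_int 0 \<in> {-1/4<..<5/4}"
      using t \<epsilon> by (auto simp: \<tau>_def field_simps)
    define y where "y = W \<epsilon> \<tau> \<xi>"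
    have RR: "4 * (\<rho> + 1)\<^sup>2 + 100 \<le> R \<epsilon>"
      using \<epsilon> E0(2) by (intro E2(2)) auto
    have "\<xi> \<bullet> \<xi> \<le> (\<rho> + 1)\<^sup>2"
      unfolding power2_norm_eq_inner[symmetric] using \<xi> by (intro power_mono) auto
    then have \<xi>R: "\<xi> \<bullet> \<xi> \<le> R \<epsilon>"
      using RR zero_le_power2[of "\<rho> + 1"] by linarith
    have Wy: "Wc \<epsilon> \<tau> \<xi> = y"
      using Wc_eq_W[OF \<xi>R] by (simp add: y_def)
    have "norm y \<le> \<rho> + 1"
      using Wc_near[OF \<epsilon>(1) \<epsilon>1 \<tau>(1), of \<xi>] norm_triangle_ineq2[of y \<xi>] \<xi> by (simp add: Wy)
    then have "y \<bullet> y \<le> (\<rho> + 1)\<^sup>2"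
      unfolding power2_norm_eq_inner[symmetric] by (intro power_mono) auto
    then have "\<beta> \<epsilon> y = 1"
      using RR by (intro \<beta>_1) simp
    moreover have "\<kappa> \<epsilon> = 1"
      using \<epsilon> E0(3) by (intro \<kappa>_1) simp
    moreover have "g \<epsilon> \<tau> y = \<xi>"
      by (rule g_eqI[OF \<epsilon>(1) \<epsilon>1 \<tau>(1) Wy])
    ultimately have "d \<epsilon> \<tau> y = inverse \<epsilon> ^ Suc p *\<^sub>R (Z \<epsilon> \<tau> \<xi> - h y)"
      using d_eq_E[OF \<epsilon>(1) \<epsilon>1 \<tau>(2)] by (simp add: E_def)
    then have "h y + \<epsilon> ^ Suc p *\<^sub>R d \<epsilon> \<tau> y = Z \<epsilon> \<tau> \<xi>"
      using \<epsilon>(1) by (simp add: power_mult_distrib[symmetric] del: power_Suc)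
    then show "(?x has_vector_derivative h (?x t) + \<epsilon> ^ Suc p *\<^sub>R d \<epsilon> (t / \<epsilon>) (?x t)) (at t within {0..\<epsilon>})"
      using W_derivative[OF \<epsilon>(1), of \<xi> t "{0..\<epsilon>}"] by (simp add: y_def \<tau>_def)
  qed
  then show ?thesis
    using E0 by (intro exI[of _ E0]) auto
qed

text \<open>Velocities, iterate displacements and displacements of the scheme all lie in the kernel
  of \<open>T\<close>, hence so does \<open>Z\<close>. This will show that the perturbation is
  tangent to the constraint space.\<close>

lemma linear_d_eq_0:
  fixes T :: "'a \<Rightarrow> 'b::euclidean_space"
  assumes T: "linear T" "\<And>x. T (h x) = 0" "\<And>\<epsilon> x. 0 < \<epsilon> \<Longrightarrow> \<epsilon> \<le> e0 \<Longrightarrow> T (\<phi> \<epsilon> x - x) = 0"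
    and \<epsilon>: "0 < \<epsilon>"
  shows "T (d \<epsilon> \<tau> y) = 0"
proof (cases "\<epsilon> < e1")
  case False
  then show ?thesis
    using e1 T(1) by (simp add: d_def E_def \<kappa>_0 linear_0)
next
  case True
  have "T (Q t (\<phi> \<epsilon> x) - Q s x) = T (Q t (\<phi> \<epsilon> x) - \<phi> \<epsilon> x) + T (\<phi> \<epsilon> x - x) - T (Q s x - x)" for s t x
    by (simp add: T(1) linear_diff del: picard.simps)
  then have "T (Q t (\<phi> \<epsilon> x) - Q s x) = 0" for s t x
    using linear_picard_diff_eq_0[OF T(1,2) cont_h] T(3)[OF \<epsilon>] True e1_le e0
    by (simp del: picard.simps)
  then have "T (Z \<epsilon> \<tau> x) = 0" for \<tau> x
    by (simp add: Z_def T linear_add linear_cmul del: picard.simps)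
  then show ?thesis
    by (simp add: d_def E_def T linear_cmul linear_diff)
qed

end

theorem (in one_step_scheme) embedding:
  obtains d where "C_class (Suc q) ({0<..} \<times> UNIV \<times> UNIV) (\<lambda>(\<epsilon>, \<tau>, y). d \<epsilon> \<tau> y)"
    "\<And>\<epsilon> \<tau> y. d \<epsilon> (\<tau> + 1) y = d \<epsilon> \<tau> y"
    "\<And>\<rho>. \<rho> \<ge> 0 \<Longrightarrow> \<exists>B. \<forall>\<epsilon> \<tau> y. 0 < \<epsilon> \<and> norm y \<le> \<rho> \<longrightarrow> norm (d \<epsilon> \<tau> y) \<le> B"
    "\<And>\<rho>. \<rho> \<ge> 0 \<Longrightarrow> \<exists>E0>0. E0 \<le> e0 \<and> (\<forall>\<epsilon> \<xi>. 0 < \<epsilon> \<and> \<epsilon> \<le> E0 \<and> norm \<xi> \<le> \<rho> \<longrightarrow>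
        (\<exists>x. x 0 = \<xi> \<and> x \<epsilon> = \<phi> \<epsilon> \<xi> \<and> (\<forall>t\<in>{0..\<epsilon>}.
          (x has_vector_derivative h (x t) + \<epsilon> ^ Suc p *\<^sub>R d \<epsilon> (t / \<epsilon>) (x t)) (at t within {0..\<epsilon>}))))"
    "\<And>T :: 'a \<Rightarrow> 'a. linear T \<and> (\<forall>x. T (h x) = 0) \<and>
        (\<forall>\<epsilon> x. 0 < \<epsilon> \<and> \<epsilon> \<le> e0 \<longrightarrow> T (\<phi> \<epsilon> x - x) = 0) \<longrightarrow> (\<forall>\<epsilon> \<tau> y. 0 < \<epsilon> \<longrightarrow> T (d \<epsilon> \<tau> y) = 0)"
proof -
  \<comment> \<open>One order more than the class of \<open>h\<close>, so that the derivative of the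
    cutoff still has class \<open>Suc q\<close>.\<close>
  obtain f Lf where f: "C_class (Suc (Suc q)) UNIV f" "\<And>s. 0 \<le> f s" "\<And>s. f s \<le> (1::real)" "\<And>s. s \<le> 0 \<Longrightarrow> f s = 1"
      "\<And>s. 1 \<le> s \<Longrightarrow> f s = 0" and Lf: "Lf > 0" "\<And>s t. \<bar>f s - f t\<bar> \<le> Lf * \<bar>s - t\<bar>"
    by (rule obtain_cutoff[of "Suc (Suc q)"]) (rule that)
  obtain f' where f': "\<And>s. (f has_derivative f' s) (at s)" "\<And>v. C_class (Suc q) UNIV (\<lambda>s. f' s v)"
    using f(1) unfolding C_class.simps(2)[of "Suc q"] by auto
  have "(f has_real_derivative f' s 1) (at s)" for s
  proof -
    have "f' s v = f' s 1 * v" for v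
      using linear_cmul[OF has_derivative_linear[OF f'(1)[of s]], of v 1] by simp
    then have "f' s = (*) (f' s 1)"
      by (rule ext)
    then show ?thesis
      using f'(1)[of s] by (simp add: has_field_derivative_def)
  qed
  then interpret interpolated_scheme h \<phi> e0 q p f "\<lambda>s. f' s 1" Lf
    by unfold_locales (use f Lf f'(2) C_class_SucD[OF f(1)] in auto)
  obtain R e1 where R: "C_class (Suc q) {0<..} R" "e1 > 0" "\<And>\<epsilon>. 0 < \<epsilon> \<Longrightarrow> \<epsilon> \<le> e1 \<Longrightarrow> good \<epsilon> (R \<epsilon>)"
      "\<And>K. \<exists>E>0. \<forall>\<epsilon>. 0 < \<epsilon> \<and> \<epsilon> \<le> E \<longrightarrow> K \<le> R \<epsilon>"
    by (rule obtain_admissible_radius[of good "Suc q", OF good_ex]) (rule good_mono, assumption+, rule that)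
  interpret cutoff_scheme h \<phi> e0 q p f "\<lambda>s. f' s 1" Lf R e1
    by unfold_locales (use R in auto)
  show thesis
  proof (rule that[of d])
    show "linear T \<and> (\<forall>x. T (h x) = 0) \<and>
        (\<forall>\<epsilon> x. 0 < \<epsilon> \<and> \<epsilon> \<le> e0 \<longrightarrow> T (\<phi> \<epsilon> x - x) = 0) \<longrightarrow> (\<forall>\<epsilon> \<tau> y. 0 < \<epsilon> \<longrightarrow> T (d \<epsilon> \<tau> y) = 0)"
      for T :: "'a \<Rightarrow> 'a"
      using linear_d_eq_0[of T] by simp
  qed (fact C_d d_periodic | erule d_bounded d_time_map)+
qed

section \<open>The Euler-Poincare-Suslov equations\<close>

text \<open>Bounds on the sublevel sets at integers become a continuous majorant, by a locally
  finite sum of ramps.\<close>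

lemma obtain_continuous_bound:
  assumes "\<And>n::nat. \<exists>B. \<forall>x. s x \<le> real n \<longrightarrow> F x \<le> B"
  obtains D :: "real \<Rightarrow> real" where "continuous_on {0..} D" "\<And>x. 0 \<le> s x \<Longrightarrow> F x \<le> D (s x)"
proof -
  have "\<forall>n. \<exists>B. \<forall>x. s x \<le> real n \<longrightarrow> F x \<le> B"
    using assms by blast
  from choice[OF this] obtain B where B: "\<And>n x. s x \<le> real n \<Longrightarrow> F x \<le> B n"
    by blast
  \<comment> \<open>The ramp \<open>n\<close> rises on [n - 1, n] and is full from \<open>n\<close>
    on, with the bound for level n + 1 as its height; so it covers the values in [n, n + 1].\<close>
  define c where "c n u = \<bar>B (Suc n)\<bar> * min 1 (max 0 (u - real n + 1))" for n u
  define D where "D u = (\<Sum>n | real n < u + 1. c n u)" for u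
  have c0: "c n u = 0" if "u + 1 \<le> real n" for n u
    using that by (simp add: c_def)
  have fin: "\<exists>N. {n. real n < u} \<subseteq> {..<N}" for u
  proof -
    obtain N where "u \<le> real N"
      using real_arch_simple by blast
    then show ?thesis
      by (intro exI[of _ N]) auto
  qed
  have "C_class 0 UNIV D"
  proof (rule C_class_local)
    fix u0 :: real
    obtain N where N: "{n. real n < u0 + 2} \<subseteq> {..<N}"
      using fin by blast
    have "C_class 0 {..<u0 + 1} (\<lambda>u. \<Sum>n<N. c n u)"
      by (auto simp: c_def intro!: continuous_intros)
    then have "C_class 0 {..<u0 + 1} D"
    proof (rule C_class_cong)
      fix u assume "u \<in> {..<u0 + 1}"
      then have "{n. real n < u + 1} \<subseteq> {..<N}"
        using N by force
      then show "(\<Sum>n<N. c n u) = D u"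
        unfolding D_def by (intro sum.mono_neutral_right) (auto intro: c0)
    qed
    then show "\<exists>U. open U \<and> u0 \<in> U \<and> C_class 0 U D"
      by (intro exI[of _ "{..<u0 + 1}"]) auto
  qed
  then have "continuous_on {0..} D"
    by (auto intro: continuous_on_subset)
  moreover have "F x \<le> D (s x)" if "0 \<le> s x" for x
  proof -
    define n where "n = nat \<lfloor>s x\<rfloor>"
    have n: "real n \<le> s x" "s x \<le> real (Suc n)"
      using that unfolding n_def by linarith+
    have "F x \<le> \<bar>B (Suc n)\<bar>"
      using B[OF n(2)] by simp
    also have "\<dots> = c n (s x)"
      using n by (simp add: c_def)
    also have "\<dots> \<le> D (s x)"
    proof -
      have "finite {n. real n < s x + 1}"
        using fin finite_subset by blast
      moreover have "n \<in> {n. real n < s x + 1}"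
        using n by simp
      ultimately show ?thesis
        unfolding D_def by (intro member_le_sum) (auto simp: c_def)
    qed
    finally show ?thesis .
  qed
  ultimately show thesis
    using that by blast
qed

section \<open>The constraint space and curves in it\<close>

lemma subspace_projection:
  fixes V :: "'a::euclidean_space set"
  assumes "subspace V"
  obtains \<pi> where "bounded_linear \<pi>" "\<And>x. \<pi> x \<in> V" "\<And>x. x \<in> V \<Longrightarrow> \<pi> x = x"
proof -
  obtain g where g: "range g \<subseteq> V" "linear g" "\<forall>v\<in>V. g (id v) = v"
    using linear_exists_left_inverse_on[of id V] assms by (auto simp: linear_id)
  then show thesis
    using that[of g] by (auto simp: linear_conv_bounded_linear)
qed

text \<open>Each constraint is constantly 0 along the curve. Since the interval is not degenerate,
  one-sided derivatives at its ends are unique, so the differentiated constraint holds there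
  too.\<close>

lemma constr_space_closed_under_derivative:
  assumes x: "(x has_vector_derivative v) (at t within {0..T})" and "0 < T" "t \<in> {0..T}"
    and V: "\<And>s. s \<in> {0..T} \<Longrightarrow> x s \<in> constr_space m a"
  shows "v \<in> constr_space m a"
  unfolding constr_space_def
proof (intro CollectI ballI)
  fix \<alpha> assume \<alpha>: "\<alpha> \<in> {1..m}"
  have "((\<lambda>s. blinfun_apply (a \<alpha>) (x s)) has_vector_derivative blinfun_apply (a \<alpha>) v) (at t within {0..T})"
    by (rule bounded_linear.has_vector_derivative[OF blinfun.bounded_linear_right x])
  moreover have "((\<lambda>s. blinfun_apply (a \<alpha>) (x s)) has_vector_derivative 0) (at t within {0..T})"
    by (rule has_vector_derivative_transform[OF \<open>t \<in> {0..T}\<close> _ has_vector_derivative_const[of 0]])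
       (use V \<alpha> in \<open>auto simp: constr_space_def\<close>)
  moreover have "at t within {0..T} \<noteq> bot"
    using assms(2,3) by (simp add: trivial_limit_within islimpt_Icc)
  ultimately show "blinfun_apply (a \<alpha>) v = 0"
    by (meson vector_derivative_unique_within)
qed

lemma constr_space_invariant:
  assumes x: "\<And>s. s \<in> {0..T} \<Longrightarrow> (x has_vector_derivative v s) (at s within {0..T})"
    and V: "\<And>s. s \<in> {0..T} \<Longrightarrow> v s \<in> constr_space m a" "x 0 \<in> constr_space m a" and t: "t \<in> {0..T}"
  shows "x t \<in> constr_space m a"
  unfolding constr_space_def
proof (intro CollectI ballI)
  fix \<alpha> assume \<alpha>: "\<alpha> \<in> {1..m}"
  have "norm (blinfun_apply (a \<alpha>) (x t) - blinfun_apply (a \<alpha>) (x 0)) \<le> 0 * \<bar>t - 0\<bar>"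
  proof (rule vector_derivative_bound)
    show "((\<lambda>s. blinfun_apply (a \<alpha>) (x s)) has_vector_derivative blinfun_apply (a \<alpha>) (v s)) (at s within {0..T})"
      if "s \<in> {0..T}" for s
      by (rule bounded_linear.has_vector_derivative[OF blinfun.bounded_linear_right x[OF that]])
  qed (use V \<alpha> t in \<open>auto simp: constr_space_def\<close>)
  then show "blinfun_apply (a \<alpha>) (x t) = 0"
    using V(2) \<alpha> by (simp add: constr_space_def)
qed

lemma subspace_constr_space: "subspace (constr_space m a)"
  by (auto simp: subspace_def constr_space_def blinfun.add_right blinfun.scaleR_right)

section \<open>Elimination of the multipliers\<close>

locale suslov_system =
  fixes br :: "'g::euclidean_space \<Rightarrow> 'g \<Rightarrow> 'g" and e :: "'n::finite \<Rightarrow> 'g" and l :: "'g \<Rightarrow> real"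
    and m :: nat and a :: "nat \<Rightarrow> 'g \<Rightarrow>\<^sub>L real" and h :: "'g \<Rightarrow> 'g"
  assumes lie: "lie_bracket br"
    and basis: "is_basis e"
    and l_C2: "C_class 2 UNIV l"
    and l_pos: "\<And>\<xi>. pos_def (hess e l \<xi>)"
    and h_elim: "\<And>\<xi>. \<xi> \<in> constr_space m a \<Longrightarrow> eliminates_to br e l m a 0 \<xi> (h \<xi>)"
begin

abbreviation V where "V \<equiv> constr_space m a"

lemma basis_sum: "(\<Sum>c\<in>UNIV. coord e c v *\<^sub>R e c) = v"
proof -
  have "(\<Sum>b\<in>range e. representation (range e) v b *\<^sub>R b) = v"
    using basis by (intro sum_representation_eq) (auto simp: is_basis_def)
  then show ?thesis
    using basis by (simp add: is_basis_def coord_def sum.reindex)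
qed

lemma linear_coord: "linear (coord e c)"
  unfolding coord_def using basis
  by (intro linearI) (auto simp: is_basis_def representation_add representation_scale)

lemma bounded_linear_coord: "bounded_linear (coord e c)"
  using linear_coord by (simp add: linear_conv_bounded_linear)

lemma coord_basis: "coord e b (e c) = (if c = b then 1 else 0)"
  using basis representation_basis[of "range e" "e c"]
  by (auto simp: is_basis_def coord_def inj_eq)

lemma linear_expand: "linear F \<Longrightarrow> F v = (\<Sum>c\<in>UNIV. coord e c v *\<^sub>R F (e c))"
  using linear_sum[of F "\<lambda>c. coord e c v *\<^sub>R e c" UNIV] by (simp add: basis_sum linear_cmul)

lemma C_class_l: "C_class (Suc (Suc 0)) UNIV l"
  using l_C2 by (simp add: numeral_2_eq_2)

lemma l_derivative: "(l has_derivative frechet_derivative l (at x)) (at x)"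
  using C_class_open_SucD(1)[OF open_UNIV C_class_l] by simp

lemma linear_dl: "linear (frechet_derivative l (at x))"
  using l_derivative by (rule has_derivative_linear)

lemma C_class_partial: "C_class (Suc 0) UNIV (partial e c l)"
  using C_class_open_SucD(2)[OF open_UNIV C_class_l, of "e c"] by (simp add: partial_def[abs_def])

lemma partial_derivative:
  "(partial e c l has_derivative frechet_derivative (partial e c l) (at x)) (at x)"
  using C_class_open_SucD(1)[OF open_UNIV C_class_partial] by simp

lemma continuous_on_hess: "continuous_on UNIV (\<lambda>\<xi>. hess e l \<xi> b c)"
  using C_class_open_SucD(2)[OF open_UNIV C_class_partial[of c], of "e b"]
  by (simp add: hess_def partial_def[of e b])

lemma h_in_V: "\<xi> \<in> V \<Longrightarrow> h \<xi> \<in> V"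
  using h_elim by (auto simp: eliminates_to_def)

text \<open>The covector that the Hessian at \<xi> assigns to \<open>w\<close>, which is the
  external force needed to change the velocity by \<open>w\<close>.\<close>

definition force :: "'g \<Rightarrow> 'g \<Rightarrow> 'g \<Rightarrow>\<^sub>L real" where
  "force \<xi> w = (\<Sum>b\<in>UNIV. (\<Sum>c\<in>UNIV. hess e l \<xi> b c * coord e c w) *\<^sub>R Blinfun (coord e b))"

lemma force_basis: "blinfun_apply (force \<xi> w) (e b) = (\<Sum>c\<in>UNIV. hess e l \<xi> b c * coord e c w)"
  unfolding force_def
  by (simp add: blinfun.sum_left blinfun.scaleR_left bounded_linear_Blinfun_apply
      bounded_linear_coord coord_basis if_distrib[of "\<lambda>x. _ * x"] cong: if_cong)

lemma force_bounded: "\<exists>B. \<forall>\<xi> w. norm \<xi> \<le> \<rho> \<and> norm w \<le> \<rho>' \<longrightarrow> norm (force \<xi> w) \<le> B"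
proof -
  have "continuous_on UNIV (\<lambda>z. force (fst z) (snd z))"
    unfolding force_def
    by (intro continuous_intros continuous_on_compose2[OF continuous_on_hess]
        continuous_on_compose2[OF linear_continuous_on[OF bounded_linear_coord]]) auto
  then obtain B where "\<And>z. z \<in> cball 0 \<rho> \<times> cball 0 \<rho>' \<Longrightarrow> norm (force (fst z) (snd z)) \<le> B"
    using continuous_bounded_on_compact[OF _ compact_Times[OF compact_cball[of 0 \<rho>] compact_cball[of 0 \<rho>']]]
    by blast
  then show ?thesis
    by (intro exI[of _ B]) force
qed

text \<open>The left side of the equations is linear in the velocity, so this force can be moved
  there as a shift of the velocity; the multipliers are the same on both sides.\<close>

lemma forced_eq_force:
  "forced_eq br e l m a (s *\<^sub>R force \<xi> w) \<xi> v \<Lambda> \<longleftrightarrow> forced_eq br e l m a 0 \<xi> (v - s *\<^sub>R w) \<Lambda>"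
proof -
  have eq: "(\<Sum>c\<in>UNIV. hess e l \<xi> b c * coord e c (v - s *\<^sub>R w)) =
      (\<Sum>c\<in>UNIV. hess e l \<xi> b c * coord e c v) - s * (\<Sum>c\<in>UNIV. hess e l \<xi> b c * coord e c w)" for b
    by (simp add: linear_diff[OF linear_coord] linear_cmul[OF linear_coord] right_diff_distrib
        sum_subtractf sum_distrib_left mult.left_commute)
  then show ?thesis
    unfolding forced_eq_def eq by (simp add: blinfun.scaleR_left force_basis diff_eq_eq)
qed

lemma eliminates_to_force:
  assumes "\<xi> \<in> V" "w \<in> V"
  shows "eliminates_to br e l m a (s *\<^sub>R force \<xi> w) \<xi> (h \<xi> + s *\<^sub>R w)"
  unfolding eliminates_to_def
proof
  fix v
  have "v \<in> V \<longleftrightarrow> v - s *\<^sub>R w \<in> V"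
    using subspace_constr_space[of m a] subspace_add[of V "v - s *\<^sub>R w" "s *\<^sub>R w"] assms(2)
      subspace_diff[of V v "s *\<^sub>R w"] subspace_scale[of V w s] by auto
  then show "(v \<in> V \<and> (\<exists>\<Lambda>. forced_eq br e l m a (s *\<^sub>R force \<xi> w) \<xi> v \<Lambda>)) \<longleftrightarrow> v = h \<xi> + s *\<^sub>R w"
    using h_elim[OF assms(1)] unfolding eliminates_to_def forced_eq_force
    by (metis add_diff_cancel diff_add_cancel)
qed

lemma ad_star_basis:
  "ad_star br \<xi> (frechet_derivative l (at \<xi>)) (e b) =
     (\<Sum>d\<in>UNIV. \<Sum>c\<in>UNIV. struct_const br e d b c * coord e c \<xi> * partial e d l \<xi>)"
proof -
  have lin: "linear (\<lambda>x. br x (e b))"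
    using lie by (auto simp: lie_bracket_def)
  have "coord e d (br \<xi> (e b)) = (\<Sum>c\<in>UNIV. struct_const br e d b c * coord e c \<xi>)" for d
    using linear_expand[OF linear_compose[OF lin linear_coord[of d]], of \<xi>]
    by (simp add: o_def struct_const_def mult.commute)
  moreover have "ad_star br \<xi> (frechet_derivative l (at \<xi>)) (e b) =
      (\<Sum>d\<in>UNIV. coord e d (br \<xi> (e b)) * partial e d l \<xi>)"
    unfolding ad_star_def using linear_expand[OF linear_dl, of \<xi> "br \<xi> (e b)"] by (simp add: partial_def)
  ultimately show ?thesis
    by (simp add: sum_distrib_right)
qed

text \<open>Consistency is stated for the covector equation, so solutions of the reduced equation
  must be recognised as solutions of it. The chain rule gives the coordinate equations, and
  linearity in \<eta> extends them to all vectors.\<close>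

lemma suslov_solutionI:
  assumes x: "\<And>t. t \<in> T \<Longrightarrow> (x has_vector_derivative h (x t)) (at t within T)"
    and V: "\<And>t. t \<in> T \<Longrightarrow> x t \<in> V"
  shows "suslov_solution br l m a T x"
  unfolding suslov_solution_def
proof (intro conjI ballI)
  show "x differentiable_on T"
    unfolding differentiable_on_def using x differentiableI_vector by blast
  fix t assume t: "t \<in> T"
  show "x t \<in> V"
    by (rule V[OF t])
  define \<xi> where "\<xi> = x t"
  obtain \<Lambda> where \<Lambda>: "forced_eq br e l m a 0 \<xi> (h \<xi>) \<Lambda>"
    using h_elim[OF V[OF t]] unfolding eliminates_to_def \<xi>_def by blast
  have der: "((\<lambda>s. partial e b l (x s)) has_real_derivative
      ad_star br \<xi> (frechet_derivative l (at \<xi>)) (e b) + (\<Sum>\<alpha>=1..m. \<Lambda> \<alpha> * blinfun_apply (a \<alpha>) (e b)))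
      (at t within T)" for b
  proof -
    let ?F = "frechet_derivative (partial e b l) (at \<xi>)"
    have lin: "linear ?F"
      using partial_derivative by (rule has_derivative_linear)
    have "((\<lambda>s. partial e b l (x s)) has_derivative (\<lambda>r. ?F (r *\<^sub>R h \<xi>))) (at t within T)"
    proof (rule has_derivative_compose[where g = "partial e b l" and f = x])
      show "(x has_derivative (\<lambda>r. r *\<^sub>R h \<xi>)) (at t within T)"
        using x[OF t] by (simp add: has_vector_derivative_def \<xi>_def)
      show "(partial e b l has_derivative ?F) (at (x t))"
        using partial_derivative[of b "x t"] by (simp add: \<xi>_def)
    qed
    then have "((\<lambda>s. partial e b l (x s)) has_real_derivative ?F (h \<xi>)) (at t within T)"
      unfolding has_field_derivative_def
      by (rule has_derivative_eq_rhs) (simp add: linear_cmul[OF lin] fun_eq_iff mult.commute)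
    moreover have "?F (h \<xi>) = (\<Sum>c\<in>UNIV. coord e c (h \<xi>) * hess e l \<xi> c b)"
      using linear_expand[OF lin, of "h \<xi>"] by (simp add: hess_def partial_def[of e _ "partial e b l"])
    \<comment> \<open>The chain rule produces the Hessian with its indices in the other order;
      symmetry is part of \<open>pos_def\<close>.\<close>
    moreover have "\<dots> = (\<Sum>c\<in>UNIV. hess e l \<xi> b c * coord e c (h \<xi>))"
      using l_pos[of \<xi>] by (intro sum.cong) (auto simp: pos_def_def mult.commute)
    ultimately show ?thesis
      using \<Lambda> unfolding forced_eq_def ad_star_basis by simp
  qed
  show "\<exists>\<Lambda>. \<forall>\<eta>. ((\<lambda>s. frechet_derivative l (at (x s)) \<eta>) has_real_derivative
      ad_star br (x t) (frechet_derivative l (at (x t))) \<eta> + (\<Sum>\<alpha>=1..m. \<Lambda> \<alpha> * blinfun_apply (a \<alpha>) \<eta>))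
      (at t within T)"
  proof (intro exI allI)
    fix \<eta>
    let ?R = "\<lambda>\<eta>. ad_star br \<xi> (frechet_derivative l (at \<xi>)) \<eta> + (\<Sum>\<alpha>=1..m. \<Lambda> \<alpha> * blinfun_apply (a \<alpha>) \<eta>)"
    have lin: "linear (br \<xi>)"
      using lie by (auto simp: lie_bracket_def)
    have "linear ?R"
      by (rule linearI)
         (simp_all add: ad_star_def linear_add[OF lin] linear_add[OF linear_dl] linear_cmul[OF lin]
           linear_cmul[OF linear_dl] blinfun.add_right blinfun.scaleR_right sum.distrib
           sum_distrib_left algebra_simps)
    then have R: "?R \<eta> = (\<Sum>c\<in>UNIV. coord e c \<eta> * ?R (e c))"
      using linear_expand[of ?R \<eta>] by simp
    have L: "(\<lambda>s. frechet_derivative l (at (x s)) \<eta>) = (\<lambda>s. \<Sum>c\<in>UNIV. coord e c \<eta> * partial e c l (x s))"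
      using linear_expand[OF linear_dl, of _ \<eta>] by (simp add: partial_def)
    have "((\<lambda>s. frechet_derivative l (at (x s)) \<eta>) has_real_derivative ?R \<eta>) (at t within T)"
      unfolding L R by (intro DERIV_sum DERIV_cmult der)
    then show "((\<lambda>s. frechet_derivative l (at (x s)) \<eta>) has_real_derivative
        ad_star br (x t) (frechet_derivative l (at (x t))) \<eta> + (\<Sum>\<alpha>=1..m. \<Lambda> \<alpha> * blinfun_apply (a \<alpha>) \<eta>))
        (at t within T)"
      by (simp add: \<xi>_def)
  qed
qed

text \<open>The velocity of a constrained curve satisfies the differentiated constraints, so the
  uniqueness in the elimination identifies it; conversely, elimination provides multipliers.\<close>

lemma forced_solution_iff:
  assumes "0 < T" and dV: "\<And>t \<xi>. d t \<xi> \<in> V"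
  shows "forced_solution br e l m a (\<lambda>t \<xi>. s *\<^sub>R force \<xi> (d t \<xi>)) {0..T} x \<longleftrightarrow>
    (\<forall>t\<in>{0..T}. x t \<in> V \<and> (x has_vector_derivative h (x t) + s *\<^sub>R d t (x t)) (at t within {0..T}))"
    (is "?L \<longleftrightarrow> ?R")
proof
  assume L: ?L
  then have V: "\<And>t. t \<in> {0..T} \<Longrightarrow> x t \<in> V"
    by (auto simp: forced_solution_def)
  show ?R
  proof (intro ballI conjI V)
    fix t assume t: "t \<in> {0..T}"
    then obtain v \<Lambda> where v: "(x has_vector_derivative v) (at t within {0..T})"
        "forced_eq br e l m a (s *\<^sub>R force (x t) (d t (x t))) (x t) v \<Lambda>"
      using L unfolding forced_solution_def by blast
    have "v \<in> V"
      using constr_space_closed_under_derivative[OF v(1) assms(1) t V] by simp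
    then have "v = h (x t) + s *\<^sub>R d t (x t)"
      using eliminates_to_force[OF V[OF t] dV, of s t] v(2) unfolding eliminates_to_def by blast
    then show "(x has_vector_derivative h (x t) + s *\<^sub>R d t (x t)) (at t within {0..T})"
      using v(1) by simp
  qed
next
  assume R: ?R
  show ?L
    unfolding forced_solution_def
  proof (intro ballI conjI)
    fix t assume t: "t \<in> {0..T}"
    show "x t \<in> V"
      using R t by blast
    then obtain \<Lambda> where "forced_eq br e l m a (s *\<^sub>R force (x t) (d t (x t))) (x t) (h (x t) + s *\<^sub>R d t (x t)) \<Lambda>"
      using eliminates_to_force[OF _ dV, of "x t" s t] unfolding eliminates_to_def by blast
    then show "\<exists>v \<Lambda>. (x has_vector_derivative v) (at t within {0..T}) \<and>
        forced_eq br e l m a (s *\<^sub>R force (x t) (d t (x t))) (x t) v \<Lambda>"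
      using R t by blast
  qed
qed

end

theorem theorem6p3:
  fixes br :: "'g::euclidean_space \<Rightarrow> 'g \<Rightarrow> 'g"
    and e :: "'n::finite \<Rightarrow> 'g"
    and l :: "'g \<Rightarrow> real"
    and m p r :: nat
    and a :: "nat \<Rightarrow> 'g \<Rightarrow>\<^sub>L real"
    and h :: "'g \<Rightarrow> 'g"
    and \<epsilon>0 :: real
    and \<phi> :: "real \<Rightarrow> 'g \<Rightarrow> 'g"
  assumes lie: "lie_bracket br"
    and basis: "is_basis e"
    and l_C2: "C_class 2 UNIV l"
    and l_pos: "\<And>\<xi>. pos_def (hess e l \<xi>)"
    and a_indep: "inj_on a {1..m}" "independent (a ` {1..m})"
    and h_elim: "\<And>\<xi>. \<xi> \<in> constr_space m a \<Longrightarrow> eliminates_to br e l m a 0 \<xi> (h \<xi>)"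
    and r: "r \<ge> 1"
    and h_Cr: "C_class r (constr_space m a) h"
    and p: "p \<ge> 1"
    and eps0: "\<epsilon>0 > 0"
    and preserving: "\<And>\<epsilon> \<xi>. 0 < \<epsilon> \<Longrightarrow> \<epsilon> \<le> \<epsilon>0 \<Longrightarrow> \<xi> \<in> constr_space m a \<Longrightarrow>
                        \<phi> \<epsilon> \<xi> \<in> constr_space m a"
    and phi_Cr: "C_class r ({0..\<epsilon>0} \<times> constr_space m a) (\<lambda>(\<epsilon>, \<xi>). \<phi> \<epsilon> \<xi>)"
    and consistent: "consistency_order br l m a \<epsilon>0 \<phi> p"
  shows "\<exists>(dt :: real \<Rightarrow> real \<Rightarrow> 'g \<Rightarrow> 'g \<Rightarrow>\<^sub>L real) (d :: real \<Rightarrow> real \<Rightarrow> 'g \<Rightarrow> 'g).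
      (\<forall>\<epsilon> t \<xi>. 0 < \<epsilon> \<and> \<epsilon> \<le> \<epsilon>0 \<and> \<xi> \<in> constr_space m a \<longrightarrow>
          dt \<epsilon> ((t + \<epsilon>) / \<epsilon>) \<xi> = dt \<epsilon> (t / \<epsilon>) \<xi>) \<and>
      (\<exists>D::real \<Rightarrow> real. continuous_on {0..} D \<and>
          (\<forall>\<epsilon> \<tau> \<xi>. 0 < \<epsilon> \<and> \<epsilon> \<le> \<epsilon>0 \<and> \<xi> \<in> constr_space m a \<longrightarrow>
             norm (dt \<epsilon> \<tau> \<xi>) \<le> D (norm \<xi>))) \<and>
      (\<forall>\<epsilon> t \<xi>. 0 < \<epsilon> \<and> \<epsilon> \<le> \<epsilon>0 \<and> \<xi> \<in> constr_space m a \<longrightarrow>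
          eliminates_to br e l m a (\<epsilon> ^ p *\<^sub>R dt \<epsilon> (t / \<epsilon>) \<xi>) \<xi>
            (h \<xi> + \<epsilon> ^ p *\<^sub>R d \<epsilon> (t / \<epsilon>) \<xi>)) \<and>
      C_class r ({0<..\<epsilon>0} \<times> UNIV \<times> constr_space m a) (\<lambda>(\<epsilon>, \<tau>, \<xi>). d \<epsilon> \<tau> \<xi>) \<and>
      (\<forall>K. bounded K \<and> K \<subseteq> constr_space m a \<longrightarrow>
         (\<exists>\<epsilon>1. 0 < \<epsilon>1 \<and> \<epsilon>1 \<le> \<epsilon>0 \<and>
            (\<forall>\<epsilon> \<xi>. 0 < \<epsilon> \<and> \<epsilon> \<le> \<epsilon>1 \<and> \<xi> \<in> K \<longrightarrow>
               time_map_value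
                 (forced_solution br e l m a (\<lambda>t \<xi>. \<epsilon> ^ p *\<^sub>R dt \<epsilon> (t / \<epsilon>) \<xi>))
                 \<epsilon> \<xi> (\<phi> \<epsilon> \<xi>))))"
proof -
  interpret suslov_system br e l m a h
    by unfold_locales (fact lie basis l_C2 l_pos h_elim)+
  obtain q where q: "r = Suc q"
    using r by (cases r) auto
  obtain p' where p': "p = Suc p'"
    using p by (cases p) auto
  obtain \<pi> where \<pi>: "bounded_linear \<pi>" "\<And>x. \<pi> x \<in> V" "\<And>x. x \<in> V \<Longrightarrow> \<pi> x = x"
    using subspace_projection[OF subspace_constr_space] by blast
  interpret \<pi>: bounded_linear \<pi>
    by (rule \<pi>(1))
  have C_\<pi>: "C_class k S (\<lambda>x. \<pi> (f x))" if "C_class k S f" for k S and f :: "'b::real_normed_vector \<Rightarrow> 'g"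
    by (rule C_class_bounded_linear[OF \<pi>(1) that])
  define h1 where "h1 x = h (\<pi> x)" for x
  \<comment> \<open>Only the displacement of the scheme is extended, so that the extension is again
    the identity at step 0; composing \<phi> with \<pi> would collapse the transverse directions and
    destroy invertibility.\<close>
  define \<phi>1 where "\<phi>1 \<epsilon> x = x + \<phi> \<epsilon> (\<pi> x) - \<pi> x" for \<epsilon> x
  have C_h1: "C_class (Suc q) UNIV h1"
    unfolding h1_def[abs_def] using C_class_compose[OF h_Cr[unfolded q] C_\<pi>[OF C_class_id]] \<pi>(2) by auto
  have h1V: "h1 x \<in> V" for x
    unfolding h1_def by (intro h_in_V \<pi>)
  interpret one_step_scheme h1 \<phi>1 \<epsilon>0 q p'
  proof
    show "C_class (Suc q) UNIV h1" "\<epsilon>0 > 0"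
      by (fact C_h1 eps0)+
    show "C_class (Suc q) ({0..\<epsilon>0} \<times> UNIV) (\<lambda>(\<epsilon>, x). \<phi>1 \<epsilon> x)"
      unfolding \<phi>1_def case_prod_unfold
      by (intro C_class_add C_class_diff C_class_comp2[OF phi_Cr[unfolded q]] C_\<pi> C_class_fst C_class_snd C_class_id)
         (auto intro: \<pi>)
  next
    fix \<rho>
    obtain C where C: "continuous_on {0..} C" "\<And>s. s \<ge> 0 \<Longrightarrow> 0 \<le> C s"
        "\<And>\<epsilon> \<xi> x. 0 < \<epsilon> \<Longrightarrow> \<epsilon> \<le> \<epsilon>0 \<Longrightarrow> \<xi> \<in> V \<Longrightarrow> suslov_solution br l m a {0..\<epsilon>} x \<Longrightarrow> x 0 = \<xi> \<Longrightarrow>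
          norm (\<phi> \<epsilon> \<xi> - x \<epsilon>) \<le> C (norm \<xi>) * \<epsilon> ^ (p + 1)"
      using consistent unfolding consistency_order_def by blast
    obtain k where k: "0 \<le> k" "\<And>x. norm (\<pi> x) \<le> norm x * k"
      using \<pi>.nonneg_bounded by blast
    \<comment> \<open>The projected initial values have norm at most \<rho> k, so the continuous
      function \<open>C\<close> is bounded on the relevant compact interval.\<close>
    obtain M where M: "\<And>s. s \<in> {0..\<rho> * k} \<Longrightarrow> norm (C s) \<le> M"
      using continuous_bounded_on_compact[OF C(1) compact_Icc[of 0 "\<rho> * k"]] by auto
    have "norm (\<phi>1 \<epsilon> \<xi> - x \<epsilon>) \<le> M * \<epsilon> ^ (Suc p' + 1)"
      if \<epsilon>: "0 < \<epsilon>" "\<epsilon> \<le> \<epsilon>0" and \<xi>: "norm \<xi> \<le> \<rho>" "x 0 = \<xi>"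
        and x: "\<And>t. t \<in> {0..\<epsilon>} \<Longrightarrow> (x has_vector_derivative h1 (x t)) (at t within {0..\<epsilon>})" for \<epsilon> \<xi> x
    proof -
      have y: "((\<lambda>t. \<pi> (x t)) has_vector_derivative h (\<pi> (x t))) (at t within {0..\<epsilon>})" if "t \<in> {0..\<epsilon>}" for t
        using \<pi>.has_vector_derivative[OF x[OF that]] \<pi>(3)[OF h1V] by (simp add: h1_def)
      have "suslov_solution br l m a {0..\<epsilon>} (\<lambda>t. \<pi> (x t))"
        by (rule suslov_solutionI) (use y \<pi>(2) in auto)
      then have 1: "norm (\<phi> \<epsilon> (\<pi> \<xi>) - \<pi> (x \<epsilon>)) \<le> C (norm (\<pi> \<xi>)) * \<epsilon> ^ (p + 1)"
        using \<epsilon> \<xi> \<pi>(2) by (intro C(3)) auto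
      \<comment> \<open>The transverse component is constant along solutions because
        \<open>h1\<close> is tangent, and \<phi>1 preserves it as well; the error is therefore that
        of \<phi> at the projected point.\<close>
      have "norm ((x \<epsilon> - \<pi> (x \<epsilon>)) - (x 0 - \<pi> (x 0))) \<le> 0 * \<bar>\<epsilon> - 0\<bar>"
        by (rule vector_derivative_bound[OF _ has_vector_derivative_diff[OF x y]])
           (use \<epsilon> in \<open>auto simp: h1_def\<close>)
      then have "\<phi>1 \<epsilon> \<xi> - x \<epsilon> = \<phi> \<epsilon> (\<pi> \<xi>) - \<pi> (x \<epsilon>)"
        by (simp add: \<phi>1_def \<xi>(2) algebra_simps)
      moreover have "norm (\<pi> \<xi>) \<le> \<rho> * k"
        using order_trans[OF k(2) mult_right_mono[OF \<xi>(1) k(1)]] .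
      then have "C (norm (\<pi> \<xi>)) \<le> M"
        using M[of "norm (\<pi> \<xi>)"] by auto
      then have "C (norm (\<pi> \<xi>)) * \<epsilon> ^ (p + 1) \<le> M * \<epsilon> ^ (Suc p' + 1)"
        unfolding p' using \<epsilon> by (intro mult_right_mono) auto
      ultimately show ?thesis
        using 1 by simp
    qed
    then show "\<exists>C. \<forall>\<epsilon> \<xi> x. 0 < \<epsilon> \<and> \<epsilon> \<le> \<epsilon>0 \<and> norm \<xi> \<le> \<rho> \<and> x 0 = \<xi> \<and>
        (\<forall>t\<in>{0..\<epsilon>}. (x has_vector_derivative h1 (x t)) (at t within {0..\<epsilon>})) \<longrightarrow>
        norm (\<phi>1 \<epsilon> \<xi> - x \<epsilon>) \<le> C * \<epsilon> ^ (Suc p' + 1)"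
      by (intro exI[of _ M]) auto
  qed
  obtain d where d: "C_class (Suc q) ({0<..} \<times> UNIV \<times> UNIV) (\<lambda>(\<epsilon>, \<tau>, y). d \<epsilon> \<tau> y)"
      "\<And>\<epsilon> \<tau> y. d \<epsilon> (\<tau> + 1) y = d \<epsilon> \<tau> y"
      "\<And>\<rho>. \<rho> \<ge> 0 \<Longrightarrow> \<exists>B. \<forall>\<epsilon> \<tau> y. 0 < \<epsilon> \<and> norm y \<le> \<rho> \<longrightarrow> norm (d \<epsilon> \<tau> y) \<le> B"
      "\<And>\<rho>. \<rho> \<ge> 0 \<Longrightarrow> \<exists>E0>0. E0 \<le> \<epsilon>0 \<and> (\<forall>\<epsilon> \<xi>. 0 < \<epsilon> \<and> \<epsilon> \<le> E0 \<and> norm \<xi> \<le> \<rho> \<longrightarrow>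
        (\<exists>x. x 0 = \<xi> \<and> x \<epsilon> = \<phi>1 \<epsilon> \<xi> \<and> (\<forall>t\<in>{0..\<epsilon>}.
          (x has_vector_derivative h1 (x t) + \<epsilon> ^ Suc p' *\<^sub>R d \<epsilon> (t / \<epsilon>) (x t)) (at t within {0..\<epsilon>}))))"
      and T: "\<And>T :: 'g \<Rightarrow> 'g. linear T \<and> (\<forall>x. T (h1 x) = 0) \<and>
        (\<forall>\<epsilon> x. 0 < \<epsilon> \<and> \<epsilon> \<le> \<epsilon>0 \<longrightarrow> T (\<phi>1 \<epsilon> x - x) = 0) \<longrightarrow> (\<forall>\<epsilon> \<tau> y. 0 < \<epsilon> \<longrightarrow> T (d \<epsilon> \<tau> y) = 0)"
    by (rule embedding) (rule that)
  have dV: "d \<epsilon> \<tau> y \<in> V" if "0 < \<epsilon>" for \<epsilon> \<tau> y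
  proof -
    have "d \<epsilon> \<tau> y - \<pi> (d \<epsilon> \<tau> y) = 0"
    \<comment> \<open>The complement of the projection annihilates exactly the constraint space, to
      which both \<open>h1\<close> and the displacement of \<phi>1 are tangent.\<close>
    proof (rule T[of "\<lambda>x. x - \<pi> x", rule_format], intro conjI allI impI)
      show "linear (\<lambda>x. x - \<pi> x)"
        by (intro linear_compose_sub linear_ident \<pi>.linear)
      show "h1 x - \<pi> (h1 x) = 0" for x
        using \<pi>(3)[OF h1V] by simp
      show "\<phi>1 \<epsilon> x - x - \<pi> (\<phi>1 \<epsilon> x - x) = 0" if "0 < \<epsilon> \<and> \<epsilon> \<le> \<epsilon>0" for \<epsilon> x
        using that \<pi>(3)[OF preserving[of \<epsilon> "\<pi> x"]] \<pi>(2)[of x] \<pi>(3)[OF \<pi>(2)[of x]]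
        by (simp add: \<phi>1_def \<pi>.diff)
    qed (rule that)
    then show ?thesis
      using \<pi>(2)[of "d \<epsilon> \<tau> y"] by simp
  qed
  define dt where "dt \<epsilon> \<tau> \<xi> = force \<xi> (d \<epsilon> \<tau> \<xi>)" for \<epsilon> \<tau> \<xi>
  \<comment> \<open>Step, time and point are packed into one variable \<open>z\<close>, with default
    value 0 for nonpositive steps, where no bound on \<open>d\<close> is known.\<close>
  have "\<exists>B. \<forall>z. norm (snd (snd z)) \<le> real n \<longrightarrow> (if 0 < fst z then norm (dt (fst z) (fst (snd z)) (snd (snd z))) else 0) \<le> B" for n
  proof -
    obtain B1 where B1: "\<And>\<epsilon> \<tau> y. 0 < \<epsilon> \<Longrightarrow> norm y \<le> real n \<Longrightarrow> norm (d \<epsilon> \<tau> y) \<le> B1"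
      using d(3)[of "real n"] by auto
    obtain B2 where "\<And>\<xi> w. norm \<xi> \<le> real n \<Longrightarrow> norm w \<le> B1 \<Longrightarrow> norm (force \<xi> w) \<le> B2"
      using force_bounded[of "real n" B1] by auto
    then show ?thesis
      by (intro exI[of _ "max 0 B2"]) (auto simp: dt_def le_max_iff_disj intro: B1)
  qed
  then obtain D where D: "continuous_on {0..} D" "\<And>z. 0 \<le> norm (snd (snd z)) \<Longrightarrow>
      (if 0 < fst z then norm (dt (fst z) (fst (snd z)) (snd (snd z))) else 0) \<le> D (norm (snd (snd z)))"
    by (rule obtain_continuous_bound[where s = "\<lambda>z. norm (snd (snd z))"]) blast+
  have time_map: "\<exists>\<epsilon>1. 0 < \<epsilon>1 \<and> \<epsilon>1 \<le> \<epsilon>0 \<and> (\<forall>\<epsilon> \<xi>. 0 < \<epsilon> \<and> \<epsilon> \<le> \<epsilon>1 \<and> \<xi> \<in> K \<longrightarrow>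
      time_map_value (forced_solution br e l m a (\<lambda>t \<xi>. \<epsilon> ^ p *\<^sub>R dt \<epsilon> (t / \<epsilon>) \<xi>)) \<epsilon> \<xi> (\<phi> \<epsilon> \<xi>))"
    if K: "bounded K" "K \<subseteq> V" for K
  proof -
    obtain \<rho> where \<rho>: "0 < \<rho>" "\<And>\<xi>. \<xi> \<in> K \<Longrightarrow> norm \<xi> \<le> \<rho>"
      using K(1) unfolding bounded_pos by blast
    obtain E0 where E0: "E0 > 0" "E0 \<le> \<epsilon>0" "\<And>\<epsilon> \<xi>. 0 < \<epsilon> \<Longrightarrow> \<epsilon> \<le> E0 \<Longrightarrow> norm \<xi> \<le> \<rho> \<Longrightarrow>
        \<exists>x. x 0 = \<xi> \<and> x \<epsilon> = \<phi>1 \<epsilon> \<xi> \<and> (\<forall>t\<in>{0..\<epsilon>}.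
          (x has_vector_derivative h1 (x t) + \<epsilon> ^ Suc p' *\<^sub>R d \<epsilon> (t / \<epsilon>) (x t)) (at t within {0..\<epsilon>}))"
      using d(4)[of \<rho>] \<rho>(1) by auto
    have "time_map_value (forced_solution br e l m a (\<lambda>t \<xi>. \<epsilon> ^ p *\<^sub>R dt \<epsilon> (t / \<epsilon>) \<xi>)) \<epsilon> \<xi> (\<phi> \<epsilon> \<xi>)"
      if \<epsilon>: "0 < \<epsilon>" "\<epsilon> \<le> E0" and \<xi>: "\<xi> \<in> K" for \<epsilon> \<xi>
    proof -
      define f where "f t u = h1 u + \<epsilon> ^ p *\<^sub>R d \<epsilon> (t / \<epsilon>) u" for t u
      have sol: "forced_solution br e l m a (\<lambda>t \<xi>. \<epsilon> ^ p *\<^sub>R dt \<epsilon> (t / \<epsilon>) \<xi>) {0..\<epsilon>} x \<longleftrightarrow>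
          (\<forall>t\<in>{0..\<epsilon>}. x t \<in> V \<and> (x has_vector_derivative f t (x t)) (at t within {0..\<epsilon>}))" for x
        using forced_solution_iff[of \<epsilon> "\<lambda>t. d \<epsilon> (t / \<epsilon>)" "\<epsilon> ^ p" x] \<epsilon>(1) dV[OF \<epsilon>(1)] \<pi>(3)
        by (auto simp: dt_def f_def h1_def)
      have fV: "f t u \<in> V" for t u
        unfolding f_def by (intro subspace_add subspace_scale subspace_constr_space h1V dV \<epsilon>)
      obtain x where x: "x 0 = \<xi>" "x \<epsilon> = \<phi>1 \<epsilon> \<xi>"
          "\<And>t. t \<in> {0..\<epsilon>} \<Longrightarrow> (x has_vector_derivative f t (x t)) (at t within {0..\<epsilon>})"
        using E0(3)[OF \<epsilon> \<rho>(2)[OF \<xi>]] unfolding f_def p' by blast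
      have xV: "x t \<in> V" if "t \<in> {0..\<epsilon>}" for t
        by (rule constr_space_invariant[OF x(3) fV _ that]) (use x(1) \<xi> K(2) in auto)
      have "x \<epsilon> = \<phi> \<epsilon> \<xi>"
        using x(2) \<pi>(3)[of \<xi>] \<xi> K(2) by (auto simp: \<phi>1_def)
      moreover have "y \<epsilon> = x \<epsilon>"
        if y: "\<And>t. t \<in> {0..\<epsilon>} \<Longrightarrow> (y has_vector_derivative f t (y t)) (at t within {0..\<epsilon>})" "y 0 = \<xi>" for y
      proof -
        have cont: "continuous_on {0..\<epsilon>} w"
          if "\<And>t. t \<in> {0..\<epsilon>} \<Longrightarrow> (w has_vector_derivative f t (w t)) (at t within {0..\<epsilon>})" for w
          using has_vector_derivative_continuous[OF that] by (simp add: continuous_on_eq_continuous_within)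
        obtain M1 where M1: "\<And>t. t \<in> {0..\<epsilon>} \<Longrightarrow> norm (x t) \<le> M1"
          using continuous_bounded_on_compact[OF cont[OF x(3)] compact_Icc] by blast
        obtain M2 where M2: "\<And>t. t \<in> {0..\<epsilon>} \<Longrightarrow> norm (y t) \<le> M2"
          using continuous_bounded_on_compact[OF cont[OF y(1)] compact_Icc] by blast
        \<comment> \<open>The ball contains both solutions being compared, so the Lipschitz constant
          may depend on them; for fixed \<epsilon> > 0 the field is of class C^1 jointly in time and
          point.\<close>
        define B :: "'g set" where "B = cball 0 (max M1 M2)"
        have "C_class (Suc q) UNIV (\<lambda>z. f (fst z) (snd z))"
          unfolding f_def divide_inverse
          by (intro C_class_add C_class_scaleR C_class_const C_class_compose[OF C_h1] C_class_comp3[OF d(1)]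
              C_class_mult C_class_fst C_class_snd C_class_id) (use \<epsilon> in auto)
        then obtain L where L: "\<And>z w. z \<in> {0..\<epsilon>} \<times> B \<Longrightarrow> w \<in> {0..\<epsilon>} \<times> B \<Longrightarrow>
            norm (f (fst z) (snd z) - f (fst w) (snd w)) \<le> L * norm (z - w)"
          by (rule C_class_Lipschitz[of q UNIV _ "{0..\<epsilon>} \<times> B"])
             (auto simp: B_def intro!: compact_Times convex_Times)
        show ?thesis
        proof (rule solution_unique[OF y(1) x(3)])
          show "norm (f t u - f t v) \<le> L * norm (u - v)" if "t \<in> {0..\<epsilon>}" "u \<in> B" "v \<in> B" for t u v
            using L[of "(t, u)" "(t, v)"] that by (simp add: norm_Pair)
        qed (use M1 M2 \<epsilon> x(1) y(2) in \<open>auto simp: B_def le_max_iff_disj\<close>)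
      qed
      ultimately have "(\<exists>x. (\<forall>t\<in>{0..\<epsilon>}. x t \<in> V \<and> (x has_vector_derivative f t (x t)) (at t within {0..\<epsilon>})) \<and> x 0 = \<xi>)"
        "\<And>y. (\<forall>t\<in>{0..\<epsilon>}. y t \<in> V \<and> (y has_vector_derivative f t (y t)) (at t within {0..\<epsilon>})) \<Longrightarrow>
          y 0 = \<xi> \<Longrightarrow> y \<epsilon> = \<phi> \<epsilon> \<xi>"
        using x(1,3) xV by (auto intro!: exI[of _ x])
      then show ?thesis
        unfolding time_map_value_def sol by simp
    qed
    then show ?thesis
      using E0(1,2) by (intro exI[of _ E0]) simp
  qed
  show ?thesis
  proof (rule exI[of _ dt], rule exI[of _ d], intro conjI allI impI)
    show "dt \<epsilon> ((t + \<epsilon>) / \<epsilon>) \<xi> = dt \<epsilon> (t / \<epsilon>) \<xi>" if "0 < \<epsilon> \<and> \<epsilon> \<le> \<epsilon>0 \<and> \<xi> \<in> V" for \<epsilon> t \<xi>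
      using that d(2)[of \<epsilon> "t / \<epsilon>" \<xi>] by (simp add: dt_def add_divide_distrib)
    show "\<exists>D. continuous_on {0..} D \<and> (\<forall>\<epsilon> \<tau> \<xi>. 0 < \<epsilon> \<and> \<epsilon> \<le> \<epsilon>0 \<and> \<xi> \<in> V \<longrightarrow> norm (dt \<epsilon> \<tau> \<xi>) \<le> D (norm \<xi>))"
    proof (intro exI[of _ D] conjI D(1) allI impI)
      show "norm (dt \<epsilon> \<tau> \<xi>) \<le> D (norm \<xi>)" if "0 < \<epsilon> \<and> \<epsilon> \<le> \<epsilon>0 \<and> \<xi> \<in> V" for \<epsilon> \<tau> \<xi>
        using D(2)[of "(\<epsilon>, \<tau>, \<xi>)"] that by simp
    qed
    show "eliminates_to br e l m a (\<epsilon> ^ p *\<^sub>R dt \<epsilon> (t / \<epsilon>) \<xi>) \<xi> (h \<xi> + \<epsilon> ^ p *\<^sub>R d \<epsilon> (t / \<epsilon>) \<xi>)"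
      if "0 < \<epsilon> \<and> \<epsilon> \<le> \<epsilon>0 \<and> \<xi> \<in> V" for \<epsilon> t \<xi>
      unfolding dt_def using that by (intro eliminates_to_force dV) auto
    show "C_class r ({0<..\<epsilon>0} \<times> UNIV \<times> V) (\<lambda>(\<epsilon>, \<tau>, \<xi>). d \<epsilon> \<tau> \<xi>)"
      unfolding q by (rule C_class_subset[OF d(1)]) auto
  qed (use time_map in blast)
qed

end
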